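(* Let $(T_t)_{t\in\mathbb{R}}$ be a weakly mixing, almost continuous flow acting on a standard Borel probability space $(X,\mathscr{B},\mu)$, where $X$ is a complete $\sigma$-compact metric space with metric $d$. Assume that $(T_t)_{t\in\mathbb{R}}$ satisfies the SWR-property. Let $(S_t)_{t\in\mathbb{R}}$ be an ergodic flow acting on a standard Borel probability space $(Y,\mathscr{C},\nu)$ and let $\rho$ be an ergodic joining of $(T_t)_{t\in\mathbb{R}}$ and $(S_t)_{t\in\mathbb{R}}$. Then either $\rho=\mu\otimes\nu$ or $\rho$ is a finite extension of $\nu$.
   Context: Joining: a joining of $(T_t)$ and $(S_t)$ is a probability measure $\rho$ on $X\times Y$, invariant under $(T_t\times S_t)_{t\in\mathbb{R}}$, with marginals $\mu$ on $X$ and $\nu$ on $Y$; it is ergodic if the flow $(T_t\times S_t)$ on $(X\times Y,\rho)$ is ergodic. "$\rho$ is a finite extension of $\nu$" means that the flow $(T_t\times S_t)$ on $(X\times Y,\rho)$ is a finite extension of $(S_t)$ on $(Y,\nu)$ via the projection to $Y$, i.e. for $\nu$-a.e. $y$ the conditional measure of $\rho$ on the fibre over $y$ is supported on finitely many points. Almost continuous: $(T_t)$ is almost continuous if for every $\epsilon>0$ there is a set $X(\epsilon)\in\mathscr{B}$ with $\mu(X(\epsilon))>1-\epsilon$ such that for every $\epsilon'>0$ there exists $\delta'>0$ such that for every $x\in X(\epsilon)$, $d(T_t(x),T_{t'}(x))<\epsilon'$ for all $t,t'\in[-\delta',\delta']$. SWR-property: let $t_0>0$ and $P\subset\mathbb{R}\setminus\{0\}$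 compact. An ergodic flow $(T_t)$ has the switchable $R(t_0,P)$-property if for every $\epsilon>0$ and $N\in\mathbb{N}$ there exist $\kappa=\kappa(\epsilon)>0$, $\delta=\delta(\epsilon,N)>0$ and $Z=Z(\epsilon,N)\in\mathscr{B}$ with $\mu(Z)>1-\epsilon$ such that for any $x,y\in Z$ with $d(x,y)<\delta$ and $x$ not in the orbit of $y$, there exist $M,L\in\mathbb{N}$ with $M,L>N$ and $L/M\ge\kappa$, and $p\in P$, such that $\frac1L|\{n\in[M,M+L]\cap\mathbb{Z}: d(T_{nt_0}(x),T_{nt_0+p}(y))<\epsilon\}|>1-\epsilon$ or $\frac1L|\{n\in[M,M+L]\cap\mathbb{Z}: d(T_{-nt_0}(x),T_{-nt_0+p}(y))<\epsilon\}|>1-\epsilon$. The flow has the SWR-property if for some compact $P\subset\mathbb{R}\setminus\{0\}$ the set of $t_0>0$ for which it has the switchable $R(t_0,P)$-property is uncountable. *)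

theory Defs
  imports "HOL-Probability.Probability"
begin

text \<open>A standard Borel space carries the Borel sets of some Polish topology on its underlying set.\<close>

definition standard_borel :: "'a measure \<Rightarrow> bool" where
  "standard_borel M \<longleftrightarrow>
     (\<exists>\<tau>. topspace \<tau> = space M \<and> completely_metrizable_space \<tau> \<and> second_countable \<tau> \<and>
          sets M = sigma_sets (space M) {U. openin \<tau> U})"

definition standard_borel_prob_space :: "'a measure \<Rightarrow> bool" where
  "standard_borel_prob_space M \<longleftrightarrow> standard_borel M \<and> prob_space M"

definition sigma_compact :: "'a::topological_space set \<Rightarrow> bool" where
  "sigma_compact S \<longleftrightarrow> (\<exists>K :: nat \<Rightarrow> 'a set. (\<forall>n. compact (K n)) \<and> S = (\<Union>n. K n))"

text \<open>Flows are jointly measurable, measure-preserving actions of the additive group of reals.\<close>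

definition flow :: "'a measure \<Rightarrow> (real \<Rightarrow> 'a \<Rightarrow> 'a) \<Rightarrow> bool" where
  "flow M T \<longleftrightarrow>
     (\<lambda>(t, x). T t x) \<in> measurable (borel \<Otimes>\<^sub>M M) M \<and>
     (\<forall>x\<in>space M. T 0 x = x) \<and>
     (\<forall>s t. \<forall>x\<in>space M. T (s + t) x = T s (T t x)) \<and>
     (\<forall>t. distr M M (T t) = M)"

text \<open>Invariance is understood modulo null sets, the null set being allowed to depend on the time.\<close>

definition ergodic_flow :: "'a measure \<Rightarrow> (real \<Rightarrow> 'a \<Rightarrow> 'a) \<Rightarrow> bool" where
  "ergodic_flow M T \<longleftrightarrow>
     flow M T \<and>
     (\<forall>A\<in>sets M. (\<forall>t. AE x in M. T t x \<in> A \<longleftrightarrow> x \<in> A) \<longrightarrow> measure M A = 0 \<or> measure M A = 1)"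

definition prod_flow ::
  "(real \<Rightarrow> 'a \<Rightarrow> 'a) \<Rightarrow> (real \<Rightarrow> 'b \<Rightarrow> 'b) \<Rightarrow> real \<Rightarrow> 'a \<times> 'b \<Rightarrow> 'a \<times> 'b" where
  "prod_flow T S t = map_prod (T t) (S t)"

definition weakly_mixing_flow :: "'a measure \<Rightarrow> (real \<Rightarrow> 'a \<Rightarrow> 'a) \<Rightarrow> bool" where
  "weakly_mixing_flow M T \<longleftrightarrow> flow M T \<and> ergodic_flow (M \<Otimes>\<^sub>M M) (prod_flow T T)"

definition almost_continuous_flow ::
  "'a::metric_space measure \<Rightarrow> (real \<Rightarrow> 'a \<Rightarrow> 'a) \<Rightarrow> bool" where
  "almost_continuous_flow M T \<longleftrightarrow>
     (\<forall>\<epsilon>>0. \<exists>X\<in>sets M. measure M X > 1 - \<epsilon> \<and>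
        (\<forall>\<epsilon>'>0. \<exists>\<delta>'>0. \<forall>x\<in>X. \<forall>t\<in>{-\<delta>'..\<delta>'}. \<forall>t'\<in>{-\<delta>'..\<delta>'}. dist (T t x) (T t' x) < \<epsilon>'))"

definition flow_orbit :: "(real \<Rightarrow> 'a \<Rightarrow> 'a) \<Rightarrow> 'a \<Rightarrow> 'a set" where
  "flow_orbit T x = range (\<lambda>t. T t x)"

text \<open>
  Note the order of the quantifiers: \<open>\<kappa>\<close> depends on \<open>\<epsilon>\<close> only, whereas \<open>\<delta>\<close> and \<open>Z\<close> depend on
  \<open>\<epsilon>\<close> and \<open>N\<close>. The choice of time direction may depend on the pair of points.
\<close>

definition switchable_R ::
  "'a::metric_space measure \<Rightarrow> (real \<Rightarrow> 'a \<Rightarrow> 'a) \<Rightarrow> real \<Rightarrow> real set \<Rightarrow> bool" where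
  "switchable_R \<mu> T t0 P \<longleftrightarrow>
     ergodic_flow \<mu> T \<and>
     (\<forall>\<epsilon>>0. \<exists>\<kappa>>0. \<forall>N::nat. \<exists>\<delta>>0. \<exists>Z\<in>sets \<mu>. measure \<mu> Z > 1 - \<epsilon> \<and>
        (\<forall>x\<in>Z. \<forall>y\<in>Z. dist x y < \<delta> \<and> x \<notin> flow_orbit T y \<longrightarrow>
           (\<exists>M L :: nat. \<exists>p\<in>P. M > N \<and> L > N \<and> real L / real M \<ge> \<kappa> \<and>
              (real (card {n\<in>{M..M + L}.
                   dist (T (real n * t0) x) (T (real n * t0 + p) y) < \<epsilon>}) / real L > 1 - \<epsilon> \<or>
               real (card {n\<in>{M..M + L}.
                   dist (T (- (real n * t0)) x) (T (- (real n * t0) + p) y) < \<epsilon>}) / real L > 1 - \<epsilon>))))"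

definition SWR_property :: "'a::metric_space measure \<Rightarrow> (real \<Rightarrow> 'a \<Rightarrow> 'a) \<Rightarrow> bool" where
  "SWR_property M T \<longleftrightarrow>
     (\<exists>P. compact P \<and> P \<subseteq> UNIV - {0} \<and> uncountable {t0. t0 > 0 \<and> switchable_R M T t0 P})"

definition joining ::
  "'a measure \<Rightarrow> (real \<Rightarrow> 'a \<Rightarrow> 'a) \<Rightarrow> 'b measure \<Rightarrow> (real \<Rightarrow> 'b \<Rightarrow> 'b) \<Rightarrow> ('a \<times> 'b) measure \<Rightarrow> bool" where
  "joining M T N S \<rho> \<longleftrightarrow>
     prob_space \<rho> \<and> sets \<rho> = sets (M \<Otimes>\<^sub>M N) \<and>
     (\<forall>t. distr \<rho> \<rho> (prod_flow T S t) = \<rho>) \<and>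
     distr \<rho> M fst = M \<and> distr \<rho> N snd = N"

definition ergodic_joining ::
  "'a measure \<Rightarrow> (real \<Rightarrow> 'a \<Rightarrow> 'a) \<Rightarrow> 'b measure \<Rightarrow> (real \<Rightarrow> 'b \<Rightarrow> 'b) \<Rightarrow> ('a \<times> 'b) measure \<Rightarrow> bool" where
  "ergodic_joining M T N S \<rho> \<longleftrightarrow> joining M T N S \<rho> \<and> ergodic_flow \<rho> (prod_flow T S)"

definition factor_map ::
  "'a measure \<Rightarrow> (real \<Rightarrow> 'a \<Rightarrow> 'a) \<Rightarrow> 'b measure \<Rightarrow> (real \<Rightarrow> 'b \<Rightarrow> 'b) \<Rightarrow> ('a \<Rightarrow> 'b) \<Rightarrow> bool" where
  "factor_map M T N S \<pi> \<longleftrightarrow>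
     flow M T \<and> flow N S \<and> \<pi> \<in> measurable M N \<and> distr M N \<pi> = N \<and>
     (\<forall>t. AE x in M. \<pi> (T t x) = S t (\<pi> x))"

text \<open>
  \<open>k y\<close> is the conditional measure of \<open>M\<close> on the fibre of \<open>\<pi>\<close> over \<open>y\<close>.
\<close>

definition disintegration :: "'a measure \<Rightarrow> 'b measure \<Rightarrow> ('a \<Rightarrow> 'b) \<Rightarrow> ('b \<Rightarrow> 'a measure) \<Rightarrow> bool" where
  "disintegration M N \<pi> k \<longleftrightarrow>
     k \<in> measurable N (prob_algebra M) \<and>
     (AE y in N. emeasure (k y) (\<pi> -` {y} \<inter> space M) = 1) \<and>
     (\<forall>A\<in>sets M. emeasure M A = (\<integral>\<^sup>+ y. emeasure (k y) A \<partial>N))"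

text \<open>
  On standard Borel spaces disintegrations exist and are unique up to null sets, so it is immaterial
  which one is used; asserting existence rules out vacuity.
\<close>

definition finite_extension ::
  "'a measure \<Rightarrow> (real \<Rightarrow> 'a \<Rightarrow> 'a) \<Rightarrow> 'b measure \<Rightarrow> (real \<Rightarrow> 'b \<Rightarrow> 'b) \<Rightarrow> ('a \<Rightarrow> 'b) \<Rightarrow> bool" where
  "finite_extension M T N S \<pi> \<longleftrightarrow>
     factor_map M T N S \<pi> \<and>
     (\<exists>k. disintegration M N \<pi> k \<and>
          (AE y in N. \<exists>F\<subseteq>space M. finite F \<and> emeasure (k y) F = 1))"

end

theory Submission
  imports Defs
begin

text \<open>
  Assume that \<open>\<rho>\<close> is not the product measure. For \<open>p \<noteq> 0\<close> weak mixing makes \<open>T p\<close> ergodic, and an ergodic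
  map is disjoint from the identity, so applying \<open>T p\<close> to the first coordinate changes \<open>\<rho>\<close>. Hence some
  Lipschitz function \<open>f\<close> on \<open>X\<close> and some measurable \<open>B \<subseteq> Y\<close> have different correlations
  \<open>\<integral> f(x) 1\<^sub>B(y) d\<rho>\<close> and \<open>\<integral> f(T p x) 1\<^sub>B(y) d\<rho>\<close> (\<open>correlation_separates\<close>). Almost continuity makes
  these correlations continuous in \<open>p\<close>, so finitely many of them, with a uniform gap, serve all \<open>p\<close> in
  the compact set \<open>P\<close>, and countably many serve all \<open>p \<noteq> 0\<close>.

  An ergodic flow on a countably generated space has only countably many times whose time map is not
  ergodic (\<open>countable_nonergodic_times\<close>), so one of the uncountably many times \<open>t\<^sub>0\<close> of the SWR-property has an ergodic time map on \<open>(X \<times> Y, \<rho>)\<close>.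
  By Birkhoff's theorem, applied in both time directions, the averages of the observables above and of
  all their shifts converge, uniformly off a small set. Take two points \<open>(x, y)\<close> and \<open>(x', y)\<close> of one
  fibre with \<open>x\<close> close to \<open>x'\<close>. If \<open>x\<close> and \<open>x'\<close> lie on different orbits, the SWR-property makes the orbit
  of \<open>x\<close> follow the orbit of \<open>x'\<close> shifted by some \<open>p \<in> P\<close> along a long block of times. As the second
  coordinates agree, the averages of an observable and of its shift by \<open>p\<close> then nearly agree, against
  the gap. If \<open>x = T s x'\<close> with \<open>s \<noteq> 0\<close>, the limits for an observable and for its shift by \<open>s\<close> agree, which
  again contradicts the choice of the observables. So a set of positive measure has uniformly
  separated, hence countable, fibres (\<open>separated_fibres\<close>).

  Finally disintegrate \<open>\<rho>\<close> over \<open>Y\<close>. The mass of a point in the conditional measure of its own fibre is an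
  invariant function on \<open>X \<times> Y\<close>, and it does not vanish since some set of positive measure has
  countable fibres. By ergodicity it exceeds a positive constant almost everywhere, so almost every
  conditional measure sits on finitely many atoms (\<open>finite_extension_if_countable_fibres\<close>).
\<close>

section \<open>Birkhoff averages\<close>

definition ergodic_map :: "'a measure \<Rightarrow> ('a \<Rightarrow> 'a) \<Rightarrow> bool" where
  "ergodic_map M \<tau> \<longleftrightarrow>
     \<tau> \<in> measurable M M \<and> distr M M \<tau> = M \<and>
     (\<forall>A\<in>sets M. (AE z in M. \<tau> z \<in> A \<longleftrightarrow> z \<in> A) \<longrightarrow> measure M A = 0 \<or> measure M A = 1)"

definition orbit_sum :: "('a \<Rightarrow> 'a) \<Rightarrow> ('a \<Rightarrow> real) \<Rightarrow> nat \<Rightarrow> 'a \<Rightarrow> real" where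
  "orbit_sum \<tau> f n z = (\<Sum>j<n. f ((\<tau> ^^ j) z))"

lemma orbit_sum_0 [simp]: "orbit_sum \<tau> f 0 z = 0"
  by (simp add: orbit_sum_def)

lemma orbit_sum_Suc: "orbit_sum \<tau> f (Suc n) z = f z + orbit_sum \<tau> f n (\<tau> z)"
  unfolding orbit_sum_def by (subst sum.lessThan_Suc_shift) (simp add: funpow_swap1)

lemma orbit_sum_diff_const:
  "orbit_sum \<tau> (\<lambda>z. f z - c) n z = orbit_sum \<tau> f n z - real n * c"
  unfolding orbit_sum_def by (simp add: sum_subtractf)

lemma orbit_sum_uminus: "orbit_sum \<tau> (\<lambda>z. - f z) n z = - orbit_sum \<tau> f n z"
  unfolding orbit_sum_def by (simp add: sum_negf)

lemma measurable_funpow: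
  assumes "\<tau> \<in> measurable M M" shows "(\<tau> ^^ n) \<in> measurable M M"
proof (induction n)
  case 0 show ?case by (simp add: id_def)
next
  case (Suc n) then show ?case unfolding funpow.simps by (rule measurable_comp) (rule assms)
qed

lemma measurable_orbit_sum:
  assumes [measurable]: "\<tau> \<in> measurable M M" "f \<in> borel_measurable M"
  shows "orbit_sum \<tau> f n \<in> borel_measurable M"
proof -
  have [measurable]: "(\<tau> ^^ j) \<in> measurable M M" for j by (rule measurable_funpow) fact
  show ?thesis unfolding orbit_sum_def by measurable
qed

text \<open>
  The maximum of the Birkhoff sums of length at most \<open>n\<close>. In this recursive form Garsia's identity
  between consecutive maxima is the defining equation.
\<close>

fun orbit_max :: "('a \<Rightarrow> 'a) \<Rightarrow> ('a \<Rightarrow> real) \<Rightarrow> nat \<Rightarrow> 'a \<Rightarrow> real" where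
  "orbit_max \<tau> f 0 z = 0"
| "orbit_max \<tau> f (Suc n) z = max 0 (f z + orbit_max \<tau> f n (\<tau> z))"

declare orbit_max.simps(2) [simp del]

lemma orbit_max_nonneg: "orbit_max \<tau> f n z \<ge> 0"
  by (cases n) (auto simp: orbit_max.simps(2))

lemma orbit_max_Suc_mono: "orbit_max \<tau> f n z \<le> orbit_max \<tau> f (Suc n) z"
proof (induction n arbitrary: z)
  case (Suc n)
  from Suc[of "\<tau> z"] show ?case by (auto simp: orbit_max.simps(2))
qed (simp add: orbit_max.simps(2))

lemma orbit_max_mono: "m \<le> n \<Longrightarrow> orbit_max \<tau> f m z \<le> orbit_max \<tau> f n z"
  by (rule lift_Suc_mono_le[of "\<lambda>n. orbit_max \<tau> f n z"]) (rule orbit_max_Suc_mono)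

lemma orbit_sum_le_orbit_max: "orbit_sum \<tau> f n z \<le> orbit_max \<tau> f n z"
proof (induction n arbitrary: z)
  case (Suc n)
  from Suc[of "\<tau> z"] show ?case by (auto simp: orbit_sum_Suc orbit_max.simps(2))
qed simp

lemma orbit_max_le:
  assumes "\<And>z. f z \<le> C" "C \<ge> 0" shows "orbit_max \<tau> f n z \<le> real n * C"
proof (induction n arbitrary: z)
  case (Suc n)
  have "f z + orbit_max \<tau> f n (\<tau> z) \<le> C + real n * C" using Suc[of "\<tau> z"] assms(1)[of z] by linarith
  moreover have "0 \<le> real (Suc n) * C" using assms by simp
  ultimately show ?case by (simp add: algebra_simps orbit_max.simps(2))
qed simp

lemma measurable_orbit_max:
  assumes [measurable]: "\<tau> \<in> measurable M M" "f \<in> borel_measurable M"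
  shows "orbit_max \<tau> f n \<in> borel_measurable M"
proof (induction n)
  case 0 have "orbit_max \<tau> f 0 = (\<lambda>z. 0)" by auto then show ?case by simp
next
  case (Suc n)
  note [measurable] = Suc
  have "orbit_max \<tau> f (Suc n) = (\<lambda>z. max 0 (f z + orbit_max \<tau> f n (\<tau> z)))" by (auto simp: orbit_max.simps(2))
  then show ?case by simp
qed

text \<open>
  Garsia's argument: where the running maximum is positive, the function is the increment of the
  running maxima along the orbit, and the increments have nonnegative integral by invariance.
\<close>

lemma (in prob_space) maximal_ergodic_inequality:
  assumes [measurable]: "\<tau> \<in> measurable M M" "f \<in> borel_measurable M"
    and inv: "distr M M \<tau> = M" and bd: "\<And>z. \<bar>f z\<bar> \<le> C"
  shows "0 \<le> (\<integral>z. indicator {z\<in>space M. orbit_max \<tau> f n z > 0} z * f z \<partial>M)"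
proof (cases n)
  case 0 then show ?thesis by simp
next
  case (Suc m)
  define G where "G k = orbit_max \<tau> f k" for k
  have G[measurable]: "G k \<in> borel_measurable M" for k
    unfolding G_def by (rule measurable_orbit_max) fact+
  have C0: "C \<ge> 0" using bd[of undefined] by linarith
  have Gb: "\<bar>G k z\<bar> \<le> real k * C" for k z
    unfolding G_def using orbit_max_le[of f C \<tau> k z] bd C0 orbit_max_nonneg[of \<tau> f k z]
    by (metis abs_le_D1 abs_of_nonneg)
  have int: "integrable M (G k)" for k
    by (rule integrable_const_bound[of _ "real k * C"]) (auto simp: Gb)
  have int': "integrable M (\<lambda>z. G k (\<tau> z))" for k
    by (rule integrable_const_bound[of _ "real k * C"]) (auto simp: Gb)
  have intf: "integrable M (\<lambda>z. indicator {z\<in>space M. G n z > 0} z * f z)"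
    by (rule integrable_const_bound[of _ C]) (auto simp: bd C0 indicator_def)
  have "(\<integral>z. G m (\<tau> z) \<partial>M) = (\<integral>z. G m z \<partial>distr M M \<tau>)" by (subst integral_distr) auto
  then have eq: "(\<integral>z. G m (\<tau> z) \<partial>M) = (\<integral>z. G m z \<partial>M)" by (simp add: inv)
  have "0 \<le> (\<integral>z. G n z \<partial>M) - (\<integral>z. G m z \<partial>M)"
    using integral_mono[OF int int, of m n] orbit_max_mono[of m n \<tau> f] Suc by (simp add: G_def)
  also have "\<dots> = (\<integral>z. G n z - G m (\<tau> z) \<partial>M)" using int int' eq by simp
  also have "\<dots> \<le> (\<integral>z. indicator {z\<in>space M. G n z > 0} z * f z \<partial>M)"
  proof (rule integral_mono)
    show "integrable M (\<lambda>z. G n z - G m (\<tau> z))" using int int' by simp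
    fix z assume "z \<in> space M"
    then show "G n z - G m (\<tau> z) \<le> indicator {z\<in>space M. G n z > 0} z * f z"
      using orbit_max_nonneg[of \<tau> f m "\<tau> z"] orbit_max_nonneg[of \<tau> f n z] Suc
      by (auto simp: G_def indicator_def orbit_max.simps(2) split: if_splits)
  qed (fact intf)
  finally show ?thesis by (simp add: G_def)
qed

text \<open>
  Unboundedness of the Birkhoff sums is an invariant event. If it had probability one, the sets in
  the maximal inequality would exhaust the space and the inequality would give \<open>0 \<le> \<integral>f\<close>.
\<close>

lemma (in prob_space) orbit_sums_bounded_above:
  assumes erg: "ergodic_map M \<tau>" and [measurable]: "f \<in> borel_measurable M"
    and bd: "\<And>z. \<bar>f z\<bar> \<le> C" and neg: "(\<integral>z. f z \<partial>M) < 0"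
  shows "AE z in M. \<exists>b. \<forall>n. orbit_sum \<tau> f n z \<le> b"
proof -
  have [measurable]: "\<tau> \<in> measurable M M" and inv: "distr M M \<tau> = M"
    using erg by (auto simp: ergodic_map_def)
  have [measurable]: "orbit_sum \<tau> f n \<in> borel_measurable M" for n by (rule measurable_orbit_sum) fact+
  have [measurable]: "orbit_max \<tau> f n \<in> borel_measurable M" for n by (rule measurable_orbit_max) fact+
  define B where "B = {z\<in>space M. \<forall>k::nat. \<exists>n. orbit_sum \<tau> f n z > real k}"
  have B[measurable]: "B \<in> sets M" unfolding B_def by measurable
  have nB: "(\<exists>b. \<forall>n. orbit_sum \<tau> f n z \<le> b) \<longleftrightarrow> \<not> (\<forall>k::nat. \<exists>n. orbit_sum \<tau> f n z > real k)" for z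
    by (meson linorder_not_less order_trans real_arch_simple)
  have shift: "(\<exists>b. \<forall>n. orbit_sum \<tau> f n z \<le> b) \<longleftrightarrow> (\<exists>b. \<forall>n. orbit_sum \<tau> f n (\<tau> z) \<le> b)" for z
  proof
    assume "\<exists>b. \<forall>n. orbit_sum \<tau> f n z \<le> b"
    then obtain b where b: "\<And>n. orbit_sum \<tau> f n z \<le> b" by blast
    have "orbit_sum \<tau> f n (\<tau> z) \<le> b - f z" for n using b[of "Suc n"] by (simp add: orbit_sum_Suc)
    then show "\<exists>b. \<forall>n. orbit_sum \<tau> f n (\<tau> z) \<le> b" by blast
  next
    assume "\<exists>b. \<forall>n. orbit_sum \<tau> f n (\<tau> z) \<le> b"
    then obtain b where b: "\<And>n. orbit_sum \<tau> f n (\<tau> z) \<le> b" by blast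
    have "orbit_sum \<tau> f n z \<le> max 0 (f z + b)" for n
      using b[of "n - 1"] by (cases n) (auto simp: orbit_sum_Suc max_def)
    then show "\<exists>b. \<forall>n. orbit_sum \<tau> f n z \<le> b" by blast
  qed
  have B_iff: "z \<in> B \<longleftrightarrow> z \<in> space M \<and> \<not> (\<exists>b. \<forall>n. orbit_sum \<tau> f n z \<le> b)" for z
    unfolding nB not_not B_def by (rule mem_Collect_eq)
  have "\<tau> z \<in> B \<longleftrightarrow> z \<in> B" if "z \<in> space M" for z
    unfolding B_iff shift[of z, symmetric] using that measurable_space[OF \<open>\<tau> \<in> measurable M M\<close>] by simp
  then have "AE z in M. \<tau> z \<in> B \<longleftrightarrow> z \<in> B" by (intro AE_I2) 
  then have "prob B = 0 \<or> prob B = 1" using erg B by (auto simp: ergodic_map_def)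
  moreover have "prob B \<noteq> 1"
  proof
    assume "prob B = 1"
    then have AEB: "AE z in M. z \<in> B" using prob_eq_1[OF B] by simp
    have "(\<lambda>n. \<integral>z. indicator {z\<in>space M. orbit_max \<tau> f n z > 0} z * f z \<partial>M) \<longlonglongrightarrow> (\<integral>z. f z \<partial>M)"
    proof (rule integral_dominated_convergence[where w="\<lambda>_. C"])
      show "AE z in M. (\<lambda>n. indicator {z\<in>space M. orbit_max \<tau> f n z > 0} z * f z) \<longlonglongrightarrow> f z"
        using AEB AE_space
      proof eventually_elim
        case (elim z)
        then have "\<exists>n. orbit_sum \<tau> f n z > real 0" unfolding B_def by blast
        then obtain n0 where "orbit_sum \<tau> f n0 z > 0" by auto
        then have "orbit_max \<tau> f n z > 0" if "n \<ge> n0" for n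
          using orbit_max_mono[OF that, of \<tau> f z] orbit_sum_le_orbit_max[of \<tau> f n0 z] by linarith
        then have "eventually (\<lambda>n. indicator {z\<in>space M. orbit_max \<tau> f n z > 0} z * f z = f z) sequentially"
          using elim by (auto simp: eventually_sequentially intro!: exI[of _ n0])
        then show ?case by (rule tendsto_eventually)
      qed
    qed (use bd in \<open>auto simp: indicator_def intro: order_trans[OF abs_ge_zero bd]\<close>)
    then have "0 \<le> (\<integral>z. f z \<partial>M)"
      by (rule LIMSEQ_le_const) (auto intro!: exI[of _ 0] maximal_ergodic_inequality[OF _ _ inv bd])
    with neg show False by simp
  qed
  ultimately have "prob B = 0" by simp
  then have "AE z in M. z \<notin> B" using prob_eq_0[OF B] by simp
  then show ?thesis using AE_space by eventually_elim (metis B_iff)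
qed

text \<open>
  Subtracting slightly more than the mean makes the Birkhoff sums bounded above, so they exceed the
  mean rate only by a constant.
\<close>

lemma (in prob_space) orbit_average_upper:
  assumes erg: "ergodic_map M \<tau>" and [measurable]: "f \<in> borel_measurable M"
    and bd: "\<And>z. \<bar>f z\<bar> \<le> C" and e: "e > 0"
  shows "AE z in M. eventually (\<lambda>n. orbit_sum \<tau> f n z < real n * ((\<integral>z. f z \<partial>M) + e)) sequentially"
proof -
  define I where "I = (\<integral>z. f z \<partial>M)"
  define g where "g z = f z - (I + e / 2)" for z
  have C0: "C \<ge> 0" using bd[of undefined] by linarith
  have "integrable M f" by (rule integrable_const_bound[of _ C]) (auto simp: bd)
  then have neg: "(\<integral>z. g z \<partial>M) < 0" unfolding g_def using e by (simp add: I_def prob_space)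
  have "AE z in M. \<exists>b. \<forall>n. orbit_sum \<tau> g n z \<le> b"
  proof (rule orbit_sums_bounded_above[OF erg _ _ neg])
    show "\<bar>g z\<bar> \<le> C + \<bar>I + e / 2\<bar>" for z unfolding g_def using bd[of z] by linarith
  qed (simp add: g_def)
  then show ?thesis
  proof eventually_elim
    case (elim z)
    then obtain b where b: "\<And>n. orbit_sum \<tau> g n z \<le> b" by blast
    obtain n0 where n0: "real n0 > b * 2 / e" using reals_Archimedean2 by blast
    have "orbit_sum \<tau> f n z < real n * (I + e)" if "n \<ge> n0" for n
    proof -
      have "b * 2 / e < real n" using n0 that by linarith
      then have "b < real n * (e / 2)" using e by (simp add: field_simps)
      then show ?thesis using b[of n] unfolding g_def orbit_sum_diff_const
        by (simp add: algebra_simps)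
    qed
    then show ?case unfolding I_def eventually_sequentially by blast
  qed
qed

lemma (in prob_space) orbit_average_close:
  assumes erg: "ergodic_map M \<tau>" and [measurable]: "f \<in> borel_measurable M"
    and bd: "\<And>z. \<bar>f z\<bar> \<le> C" and e: "e > 0"
  shows "AE z in M. eventually (\<lambda>n. \<bar>orbit_sum \<tau> f n z - real n * (\<integral>z. f z \<partial>M)\<bar> < real n * e) sequentially"
proof -
  have "AE z in M. eventually (\<lambda>n. orbit_sum \<tau> (\<lambda>z. - f z) n z < real n * ((\<integral>z. - f z \<partial>M) + e)) sequentially"
    by (rule orbit_average_upper[OF erg, where C=C]) (use bd e in auto)
  with orbit_average_upper[OF erg assms(2) bd e]
  show ?thesis
  proof eventually_elim
    case (elim z)
    then show ?case
      by eventually_elim (simp add: orbit_sum_uminus algebra_simps abs_less_iff)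
  qed
qed

lemma tendsto_averageI:
  fixes a :: "nat \<Rightarrow> real"
  assumes "\<And>k. eventually (\<lambda>n. \<bar>a n - real n * l\<bar> < real n * inverse (real (Suc k))) sequentially"
  shows "(\<lambda>n. a n / real n) \<longlonglongrightarrow> l"
proof (rule tendstoI)
  fix e :: real assume "e > 0"
  then obtain k where k: "inverse (real (Suc k)) < e" using reals_Archimedean by blast
  show "eventually (\<lambda>n. dist (a n / real n) l < e) sequentially"
    using assms[of k] eventually_gt_at_top[of "0::nat"]
  proof eventually_elim
    case (elim n)
    have "a n / real n - l = (a n - real n * l) / real n" using elim(2) by (simp add: field_simps)
    then have "\<bar>a n / real n - l\<bar> = \<bar>a n - real n * l\<bar> / real n" using elim(2) by simp
    also have "\<dots> < inverse (real (Suc k))" using elim by (simp add: pos_divide_less_eq mult.commute)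
    finally show ?case using k by (simp add: dist_real_def)
  qed
qed

theorem (in prob_space) birkhoff_ergodic:
  assumes erg: "ergodic_map M \<tau>" and [measurable]: "f \<in> borel_measurable M"
    and bd: "\<And>z. \<bar>f z\<bar> \<le> C"
  shows "AE z in M. (\<lambda>n. orbit_sum \<tau> f n z / real n) \<longlonglongrightarrow> (\<integral>z. f z \<partial>M)"
proof -
  have "AE z in M. \<forall>k. eventually (\<lambda>n. \<bar>orbit_sum \<tau> f n z - real n * (\<integral>z. f z \<partial>M)\<bar>
      < real n * inverse (real (Suc k))) sequentially"
    unfolding AE_all_countable by (intro allI orbit_average_close[OF erg assms(2) bd]) simp
  then show ?thesis by eventually_elim (rule tendsto_averageI, erule spec)
qed

text \<open>
  An Egorov statement: the sets of points whose averages stay good from time \<open>N\<close> on increase with \<open>N\<close>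
  to a set of full measure.
\<close>

lemma (in prob_space) uniform_orbit_averages:
  assumes erg: "ergodic_map M \<tau>" and fin: "finite F"
    and meas: "\<And>f. f \<in> F \<Longrightarrow> f \<in> borel_measurable M" and bd: "\<And>f z. f \<in> F \<Longrightarrow> \<bar>f z\<bar> \<le> C"
    and e: "e > 0" and c: "c > 0"
  shows "\<exists>W\<in>sets M. prob W > 1 - c \<and> (\<exists>N0. \<forall>z\<in>W. \<forall>n\<ge>N0. \<forall>f\<in>F.
           \<bar>orbit_sum \<tau> f n z - real n * (\<integral>z. f z \<partial>M)\<bar> \<le> real n * e)"
proof -
  have [measurable]: "\<tau> \<in> measurable M M" using erg by (auto simp: ergodic_map_def)
  define Q where "Q N = {z\<in>space M. \<forall>n\<ge>N. \<forall>f\<in>F. \<bar>orbit_sum \<tau> f n z - real n * (\<integral>z. f z \<partial>M)\<bar> \<le> real n * e}" for N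
  have om: "orbit_sum \<tau> f n \<in> borel_measurable M" if "f \<in> F" for f n
    by (rule measurable_orbit_sum) (use meas that in auto)
  have Q: "Q N \<in> sets M" for N
  proof -
    have "{z\<in>space M. \<forall>f\<in>F. \<bar>orbit_sum \<tau> f n z - real n * (\<integral>z. f z \<partial>M)\<bar> \<le> real n * e} \<in> sets M" for n
      by (rule sets.sets_Collect_finite_All) (use om fin in \<open>measurable\<close>)
    then have "(\<lambda>z. \<forall>f\<in>F. \<bar>orbit_sum \<tau> f n z - real n * (\<integral>z. f z \<partial>M)\<bar> \<le> real n * e) \<in> measurable M (count_space UNIV)" for n
      by (simp add: pred_def)
    note [measurable] = this
    show ?thesis unfolding Q_def by measurable
  qed
  have inc: "incseq Q" unfolding incseq_def Q_def by auto
  have "AE z in M. \<forall>f\<in>F. eventually (\<lambda>n. \<bar>orbit_sum \<tau> f n z - real n * (\<integral>z. f z \<partial>M)\<bar> < real n * e) sequentially"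
    by (subst AE_finite_all[OF fin]) (use orbit_average_close[OF erg meas bd e] in auto)
  then have "AE z in M. z \<in> (\<Union>N. Q N)"
    using AE_space
  proof eventually_elim
    case (elim z)
    then have "eventually (\<lambda>n. \<forall>f\<in>F. \<bar>orbit_sum \<tau> f n z - real n * (\<integral>z. f z \<partial>M)\<bar> < real n * e) sequentially"
      using fin by (simp add: eventually_ball_finite)
    then obtain N where "\<forall>n\<ge>N. \<forall>f\<in>F. \<bar>orbit_sum \<tau> f n z - real n * (\<integral>z. f z \<partial>M)\<bar> < real n * e"
      unfolding eventually_sequentially by blast
    then have "z \<in> Q N" using elim unfolding Q_def by (auto intro: less_imp_le)
    then show ?case by blast
  qed
  then have "prob (\<Union>N. Q N) = 1" by (subst prob_eq_1) (use Q in auto)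
  moreover have "(\<lambda>N. prob (Q N)) \<longlonglongrightarrow> prob (\<Union>N. Q N)"
    by (rule finite_Lim_measure_incseq) (use Q inc in auto)
  ultimately have "eventually (\<lambda>N. prob (Q N) > 1 - c) sequentially"
    using c by (intro order_tendstoD) auto
  then obtain N where "prob (Q N) > 1 - c" unfolding eventually_sequentially by blast
  moreover have "\<forall>z\<in>Q N. \<forall>n\<ge>N. \<forall>f\<in>F. \<bar>orbit_sum \<tau> f n z - real n * (\<integral>z. f z \<partial>M)\<bar> \<le> real n * e"
    unfolding Q_def by blast
  ultimately show ?thesis using Q by blast
qed

section \<open>Translations, periods and separability\<close>

lemma enn2real_less:
  assumes "r > 0" "x < ennreal r" shows "enn2real x < r"
  using assms by (cases x) (auto simp: ennreal_less_iff)

text \<open>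
  Continuity of translation, from regularity of Lebesgue measure: a compact subset of \<open>E\<close> stays inside
  an open superset under small shifts, so the two sets differ only inside the regularity defects.
\<close>

lemma translation_small_measure:
  fixes E :: "real set"
  assumes E: "E \<in> sets borel" and e: "e > 0"
  shows "\<exists>d>0. \<forall>h. \<bar>h\<bar> < d \<longrightarrow> measure lborel {u\<in>{0..1}. (u + h \<in> E) \<noteq> (u \<in> E)} < e"
proof -
  \<comment> \<open>For shifts below one only this part of \<open>E\<close> is seen from \<open>[0, 1]\<close>; it is bounded, which makes \<open>C\<close> compact.\<close>
  define E' where "E' = E \<inter> {-1..2}"
  have E'[measurable]: "E' \<in> sets borel" unfolding E'_def using E by simp
  obtain U where U: "open U" "E' \<subseteq> U" "emeasure lborel (U - E') < e / 4"
    using outer_regular_lborel[OF E', of "e / 4"] e by auto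
  have cE: "- E' \<in> sets borel" using E' by (simp add: borel_comp)
  obtain V where V: "open V" "- E' \<subseteq> V" "emeasure lborel (V - (- E')) < e / 4"
    using outer_regular_lborel[OF cE, of "e / 4"] e by auto
  have [measurable]: "U \<in> sets borel" "V \<in> sets borel" using U V by auto
  define C where "C = - V"
  have C: "C \<subseteq> E'" "C \<subseteq> U" using U V unfolding C_def by auto
  have "compact C" unfolding compact_eq_bounded_closed
  proof
    show "bounded C" by (rule bounded_subset[of "{-1..2}"]) (use C in \<open>auto simp: E'_def\<close>)
    show "closed C" using V unfolding C_def by (simp add: closed_def)
  qed
  moreover have "closed (- U)" using U by (simp add: closed_def)
  moreover have "C \<inter> - U = {}" using C by auto
  ultimately obtain d where d: "d > 0" "\<And>x y. x \<in> C \<Longrightarrow> y \<in> - U \<Longrightarrow> d \<le> dist x y"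
    using separate_compact_closed by metis
  define P where "P = U - E'"
  define Q where "Q = V - (- E')"
  have PQ[measurable]: "P \<in> sets borel" "Q \<in> sets borel" unfolding P_def Q_def by measurable
  have mP: "measure lborel P < e / 4" and mQ: "measure lborel Q < e / 4"
    unfolding P_def Q_def measure_def using enn2real_less[OF _ U(3)] enn2real_less[OF _ V(3)] e by auto
  have fin: "emeasure lborel P < \<infinity>" "emeasure lborel Q < \<infinity>"
    using U(3) V(3) unfolding P_def Q_def by (auto intro: less_trans)
  have tr: "emeasure lborel {u. u + h \<in> A} = emeasure lborel A" if "A \<in> sets borel" for h and A :: "real set"
  proof -
    have "emeasure lborel A = emeasure (distr lborel borel ((+) h)) A" by (simp add: lborel_distr_plus)
    also have "\<dots> = emeasure lborel {u. u + h \<in> A}"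
      by (subst emeasure_distr) (use that in \<open>auto simp: vimage_def add.commute\<close>)
    finally show ?thesis by simp
  qed
  have "measure lborel {u\<in>{0..1}. (u + h \<in> E) \<noteq> (u \<in> E)} < e" if h: "\<bar>h\<bar> < min d 1" for h
  proof -
    have sub: "{u\<in>{0..1}. (u + h \<in> E) \<noteq> (u \<in> E)} \<subseteq> (P \<union> Q) \<union> ({u. u + h \<in> P} \<union> {u. u + h \<in> Q})"
    proof
      fix u assume "u \<in> {u\<in>{0..1}. (u + h \<in> E) \<noteq> (u \<in> E)}"
      then have u: "(u + h \<in> E') \<noteq> (u \<in> E')" using h unfolding E'_def by auto
      have 1: "u \<in> U" if "u + h \<in> C" using d(2)[OF that, of u] h by (force simp: dist_real_def)
      have 2: "u + h \<in> U" if "u \<in> C" using d(2)[OF that, of "u + h"] h by (force simp: dist_real_def)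
      show "u \<in> (P \<union> Q) \<union> ({u. u + h \<in> P} \<union> {u. u + h \<in> Q})"
        using u 1 2 unfolding P_def Q_def C_def by blast
    qed
    have [measurable]: "{u. u + h \<in> P} \<in> sets borel" "{u. u + h \<in> Q} \<in> sets borel" by measurable
    have fm: "P \<in> fmeasurable lborel" "Q \<in> fmeasurable lborel" "{u. u + h \<in> P} \<in> fmeasurable lborel"
      "{u. u + h \<in> Q} \<in> fmeasurable lborel"
      using fin by (auto simp: fmeasurable_def tr)
    have "measure lborel {u\<in>{0..1}. (u + h \<in> E) \<noteq> (u \<in> E)}
        \<le> measure lborel ((P \<union> Q) \<union> ({u. u + h \<in> P} \<union> {u. u + h \<in> Q}))"
      by (rule measure_mono_fmeasurable[OF sub]) (use fm E in \<open>auto intro!: fmeasurable.Un\<close>)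
    also have "\<dots> \<le> measure lborel (P \<union> Q) + measure lborel ({u. u + h \<in> P} \<union> {u. u + h \<in> Q})"
      by (rule measure_Un_le) auto
    also have "\<dots> \<le> (measure lborel P + measure lborel Q) + (measure lborel {u. u + h \<in> P} + measure lborel {u. u + h \<in> Q})"
      by (intro add_mono measure_Un_le) auto
    also have "\<dots> = 2 * (measure lborel P + measure lborel Q)" by (simp add: measure_def tr)
    also have "\<dots> < e" using mP mQ by simp
    finally show ?thesis .
  qed
  then show ?thesis using d(1) by (intro exI[of _ "min d 1"]) auto
qed

text \<open>
  Cut \<open>[v, v + t)\<close> at \<open>t\<close> and move the overhang back by one period.
\<close>

lemma periodic_set_translate:
  fixes b :: "real set"
  assumes [measurable]: "b \<in> sets borel" and per: "AE u in lborel. u + t \<in> b \<longleftrightarrow> u \<in> b"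
    and t: "t > 0" and v: "v \<ge> 0"
  shows "measure lborel {u\<in>{0..<t}. u + v \<in> b} = measure lborel {u\<in>{0..<t}. u \<in> b}"
proof -
  have tr: "measure lborel {u. u + h \<in> A} = measure lborel A" if "A \<in> sets borel" for h and A :: "real set"
  proof -
    have "measure lborel A = measure (distr lborel borel ((+) h)) A" by (simp add: lborel_distr_plus)
    also have "\<dots> = measure lborel {u. u + h \<in> A}"
      by (subst measure_distr) (use that in \<open>auto simp: vimage_def add.commute\<close>)
    finally show ?thesis by simp
  qed
  define m where "m x y = measure lborel (b \<inter> {x..<y})" for x y
  have m_add: "m x z = m x y + m y z" if "x \<le> y" "y \<le> z" for x y z
  proof -
    have eq: "b \<inter> {x..<z} = (b \<inter> {x..<y}) \<union> (b \<inter> {y..<z})" using that by auto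
    have fm: "b \<inter> {x..<y} \<in> fmeasurable lborel" for x y :: real
      by (rule fmeasurableI[OF _ emeasure_bounded_finite]) (auto intro: bounded_subset[of "{x..y}"])
    show ?thesis unfolding m_def eq by (rule measure_Un3[THEN trans]) (use fm in \<open>auto simp: Int_ac\<close>)
  qed
  have shift: "{u\<in>{0..<t}. u + v \<in> b} = {u. u + v \<in> b \<inter> {v..<v + t}}" by auto
  have 1: "measure lborel {u\<in>{0..<t}. u + v \<in> b} = m v (v + t)" unfolding m_def shift by (rule tr) measurable
  have "m t (t + v) = measure lborel {u. u + t \<in> b \<inter> {t..<t + v}}"
    unfolding m_def by (rule tr[symmetric]) measurable
  also have "\<dots> = measure lborel (b \<inter> {0..<v})"
    by (rule measure_eq_AE) (use per in \<open>auto elim!: eventually_mono\<close>)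
  finally have 2: "m t (t + v) = m 0 v" unfolding m_def .
  have "m 0 v + m v (v + t) = m 0 t + m t (t + v)"
    using m_add[of 0 v "v + t"] m_add[of 0 t "t + v"] t v by (simp add: add.commute)
  then have "m v (v + t) = m 0 t" using 2 by simp
  moreover have "m 0 t = measure lborel {u\<in>{0..<t}. u \<in> b}" unfolding m_def by (rule arg_cong[of _ _ "measure lborel"]) auto
  ultimately show ?thesis using 1 by simp
qed

text \<open>Two incommensurable periods generate a dense group, hence force a continuous function to be constant.\<close>

lemma incommensurable_periods_constant:
  fixes c :: "real \<Rightarrow> real"
  assumes cont: "\<And>e. e > 0 \<Longrightarrow> \<exists>d>0. \<forall>u v. \<bar>u - v\<bar> < d \<longrightarrow> \<bar>c u - c v\<bar> < e"
    and p: "\<And>u. c (u + s) = c u" and q: "\<And>u. c (u + t) = c u"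
    and t: "t > 0" and irr: "s / t \<notin> \<rat>"
  shows "c u = c 0"
proof (rule ccontr)
  assume "c u \<noteq> c 0"
  then obtain d where d: "d > 0" "\<And>u' v. \<bar>u' - v\<bar> < d \<Longrightarrow> \<bar>c u' - c v\<bar> < \<bar>c u - c 0\<bar>"
    using cont[of "\<bar>c u - c 0\<bar>"] by auto
  have mult: "c (u + of_int k * r) = c u" if per: "\<And>u. c (u + r) = c u" for k u r
  proof -
    have n: "c (u + real n * r) = c u" for n u
    proof (induction n)
      case (Suc n) then show ?case using per[of "u + real n * r"] by (simp add: algebra_simps)
    qed simp
    show ?thesis
    proof (cases "k \<ge> 0")
      case True then show ?thesis using n[of u "nat k"] by simp
    next
      case False then show ?thesis using n[of "u + of_int k * r" "nat (- k)"] by simp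
    qed
  qed
  obtain N :: nat where N: "real N > t / d" using reals_Archimedean2 by blast
  moreover have "t / d > 0" using t d by simp
  ultimately have N0: "real N > 0" "N > 0" using order.strict_trans of_nat_0_less_iff by blast+
  then obtain h k where hk: "0 < k" "\<bar>of_int k * (s / t) - of_int h\<bar> < 1 / real N"
    using Dirichlet_approx[of N "s / t"] by blast
  define r where "r = of_int k * s - of_int h * t"
  have "r = t * (of_int k * (s / t) - of_int h)" unfolding r_def using t by (simp add: field_simps)
  then have "\<bar>r\<bar> = t * \<bar>of_int k * (s / t) - of_int h\<bar>" using t by (simp add: abs_mult)
  also have "\<dots> < t * (1 / real N)" using hk(2) t by (intro mult_strict_left_mono) auto
  also have "\<dots> < d" using N N0 d(1) by (simp add: field_simps)
  finally have r: "\<bar>r\<bar> < d" .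
  have "r \<noteq> 0"
  proof
    assume "r = 0"
    then have "s / t = of_int h / of_int k" unfolding r_def using t hk(1) by (simp add: field_simps)
    then show False using irr by simp
  qed
  have perr: "c (u + r) = c u" for u
    using mult[of s u k, OF p] mult[of t "u + r" h, OF q] unfolding r_def by (simp add: algebra_simps)
  define m where "m = \<lfloor>u / r\<rfloor>"
  have "u / r - of_int m \<ge> 0" "u / r - of_int m < 1" unfolding m_def by linarith+
  then have "\<bar>u / r - of_int m\<bar> < 1" by simp
  moreover have "u - of_int m * r = r * (u / r - of_int m)" using \<open>r \<noteq> 0\<close> by (simp add: field_simps)
  ultimately have "\<bar>u - of_int m * r\<bar> < \<bar>r\<bar>"
    using \<open>r \<noteq> 0\<close> by (simp add: abs_mult)
  then have "\<bar>c (u - of_int m * r) - c 0\<bar> < \<bar>c u - c 0\<bar>" using d(2)[of "u - of_int m * r" 0] r by simp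
  moreover have "c (u - of_int m * r) = c u" using mult[of r u "- m", OF perr] by simp
  ultimately show False by simp
qed

text \<open>
  The algebra generated by \<open>G\<close>, exhausted by stages so that its countability is evident.
\<close>

primrec algebra_stage :: "'a set \<Rightarrow> 'a set set \<Rightarrow> nat \<Rightarrow> 'a set set" where
  "algebra_stage \<Omega> G 0 = insert {} G"
| "algebra_stage \<Omega> G (Suc n) = algebra_stage \<Omega> G n \<union> (\<lambda>a. \<Omega> - a) ` algebra_stage \<Omega> G n
     \<union> (\<lambda>(a, b). a \<union> b) ` (algebra_stage \<Omega> G n \<times> algebra_stage \<Omega> G n)"

text \<open>
  The sets that can be approximated in measure by members of the generated algebra form a
  \<open>\<sigma>\<close>-algebra.
\<close>

lemma (in prob_space) separable_measure_algebra:
  assumes G: "sets M = sigma_sets (space M) G" "countable G"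
  shows "\<exists>C. countable C \<and> C \<subseteq> sets M \<and> (\<forall>A\<in>sets M. \<forall>e>0. \<exists>D\<in>C. prob (A - D \<union> (D - A)) < e)"
proof -
  define C where "C = (\<Union>n. algebra_stage (space M) G n)"
  have cs: "countable (algebra_stage (space M) G n)" for n by (induction n) (auto simp: G)
  have sub: "algebra_stage (space M) G n \<subseteq> sets M" for n
  proof (induction n)
    case 0 show ?case using sigma_sets.Basic[of _ G] G(1) by auto
  next
    case (Suc n) then show ?case by (auto intro!: sets.Un sets.compl_sets)
  qed
  have C: "countable C" "C \<subseteq> sets M" using cs sub unfolding C_def by auto
  have mono: "algebra_stage (space M) G m \<subseteq> algebra_stage (space M) G n" if "m \<le> n" for m n
    using that by (rule lift_Suc_mono_le[rotated]) auto
  have Ccompl: "space M - a \<in> C" if a: "a \<in> C" for a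
  proof -
    obtain n where "a \<in> algebra_stage (space M) G n" using a unfolding C_def by auto
    then have "space M - a \<in> algebra_stage (space M) G (Suc n)" by auto
    then show ?thesis unfolding C_def by blast
  qed
  have CUn: "a \<union> b \<in> C" if ab: "a \<in> C" "b \<in> C" for a b
  proof -
    obtain n m where "a \<in> algebra_stage (space M) G n" "b \<in> algebra_stage (space M) G m"
      using ab unfolding C_def by auto
    then have "a \<in> algebra_stage (space M) G (max n m)" "b \<in> algebra_stage (space M) G (max n m)"
      using mono[of n "max n m"] mono[of m "max n m"] by auto
    then have "a \<union> b \<in> algebra_stage (space M) G (Suc (max n m))" by force
    then show ?thesis unfolding C_def by blast
  qed
  have Cemp: "{} \<in> C" unfolding C_def by (auto intro: exI[of _ 0])
  have CUN: "(\<Union>i<n. D i) \<in> C" if "\<And>i. D i \<in> C" for D :: "nat \<Rightarrow> 'a set" and n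
    by (induction n) (auto simp: Cemp lessThan_Suc intro!: CUn that)
  define P where "P A \<longleftrightarrow> (\<forall>e>0. \<exists>D\<in>C. prob (A - D \<union> (D - A)) < e)" for A
  have "P A" if "A \<in> sets M" for A
    using that unfolding G(1)
  proof (induction rule: sigma_sets.induct)
    case (Basic a)
    then have "a \<in> C" unfolding C_def by (auto intro: exI[of _ 0])
    then show ?case unfolding P_def by (auto intro!: bexI[of _ a])
  next
    case Empty
    show ?case unfolding P_def by (auto intro!: bexI[OF _ Cemp])
  next
    case (Compl a)
    show ?case unfolding P_def
    proof safe
      fix e :: real assume "e > 0"
      then obtain D where D: "D \<in> C" "prob (a - D \<union> (D - a)) < e" using Compl.IH unfolding P_def by blast
      have "a \<subseteq> space M" "D \<subseteq> space M"
        using D C Compl.hyps sets.sets_into_space unfolding G(1)[symmetric] by blast+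
      then have "(space M - a) - (space M - D) \<union> ((space M - D) - (space M - a)) = a - D \<union> (D - a)" by auto
      then show "\<exists>D\<in>C. prob ((space M - a) - D \<union> (D - (space M - a))) < e"
        using D Ccompl by (intro bexI[of _ "space M - D"]) auto
    qed
  next
    case (Union a)
    have a[measurable]: "a i \<in> sets M" for i using Union.hyps G(1) by auto
    show ?case unfolding P_def
    proof safe
      fix e :: real assume e: "e > 0"
      have "(\<lambda>n. prob (\<Union>i<n. a i)) \<longlonglongrightarrow> prob (\<Union>n. \<Union>i<n. a i)"
        by (rule finite_Lim_measure_incseq) (auto simp: lessThan_Suc intro!: incseq_SucI)
      moreover have "(\<Union>n. \<Union>i<n. a i) = (\<Union>i. a i)" by auto
      ultimately have "eventually (\<lambda>n. prob (\<Union>i<n. a i) > prob (\<Union>i. a i) - e / 2) sequentially"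
        using e by (intro order_tendstoD) auto
      then obtain n where n: "prob (\<Union>i<n. a i) > prob (\<Union>i. a i) - e / 2"
        unfolding eventually_sequentially by blast
      have "\<exists>D. D \<in> C \<and> prob (a i - D \<union> (D - a i)) < e / (2 * (real n + 1))" for i
        using Union.IH[of i] e unfolding P_def by (auto simp: Bex_def)
      then obtain D where D: "\<And>i. D i \<in> C" "\<And>i. prob (a i - D i \<union> (D i - a i)) < e / (2 * (real n + 1))"
        by metis
      have [measurable]: "D i \<in> sets M" for i using D C by auto
      have Dsub: "(\<Union>i. a i) - (\<Union>i<n. D i) \<union> ((\<Union>i<n. D i) - (\<Union>i. a i))
          \<subseteq> ((\<Union>i. a i) - (\<Union>i<n. a i)) \<union> (\<Union>i<n. a i - D i \<union> (D i - a i))" by auto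
      have "prob ((\<Union>i. a i) - (\<Union>i<n. D i) \<union> ((\<Union>i<n. D i) - (\<Union>i. a i)))
          \<le> prob (((\<Union>i. a i) - (\<Union>i<n. a i)) \<union> (\<Union>i<n. a i - D i \<union> (D i - a i)))"
        by (rule finite_measure_mono[OF Dsub]) measurable
      also have "\<dots> \<le> prob ((\<Union>i. a i) - (\<Union>i<n. a i)) + prob (\<Union>i<n. a i - D i \<union> (D i - a i))"
        by (rule measure_Un_le) measurable
      also have "prob ((\<Union>i. a i) - (\<Union>i<n. a i)) = prob (\<Union>i. a i) - prob (\<Union>i<n. a i)"
        by (rule finite_measure_Diff) auto
      also have "prob (\<Union>i<n. a i - D i \<union> (D i - a i)) \<le> (\<Sum>i<n. prob (a i - D i \<union> (D i - a i)))"
        by (rule measure_UNION_le) auto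
      also have "\<dots> \<le> (\<Sum>i<n. e / (2 * (real n + 1)))" by (intro sum_mono less_imp_le D)
      also have "\<dots> = real n * (e / (2 * (real n + 1)))" by simp
      also have "\<dots> \<le> e / 2" using e by (simp add: field_simps)
      finally have "prob ((\<Union>i. a i) - (\<Union>i<n. D i) \<union> ((\<Union>i<n. D i) - (\<Union>i. a i))) < e"
        using n by simp
      then show "\<exists>D\<in>C. prob ((\<Union>i. a i) - D \<union> (D - (\<Union>i. a i))) < e"
        using CUN[of D n] D by blast
    qed
  qed
  then show ?thesis using C unfolding P_def by blast
qed

section \<open>Measurable flows\<close>

locale prob_flow = prob_space M for M :: "'a measure" +
  fixes R :: "real \<Rightarrow> 'a \<Rightarrow> 'a"
  assumes flow: "flow M R"
begin

lemma joint_measurable: "(\<lambda>(t, x). R t x) \<in> borel \<Otimes>\<^sub>M M \<rightarrow>\<^sub>M M"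
  using flow by (simp add: flow_def)

lemma flow_measurable [measurable (raw)]:
  assumes [measurable]: "f \<in> borel_measurable N" "g \<in> N \<rightarrow>\<^sub>M M"
  shows "(\<lambda>w. R (f w) (g w)) \<in> N \<rightarrow>\<^sub>M M"
  using measurable_compose[OF measurable_Pair[OF assms] joint_measurable] by simp

lemma flow_distr: "distr M M (R t) = M"
  using flow by (simp add: flow_def)

lemma flow_0: "z \<in> space M \<Longrightarrow> R 0 z = z"
  using flow by (simp add: flow_def)

lemma flow_add: "z \<in> space M \<Longrightarrow> R (s + t) z = R s (R t z)"
  using flow by (simp add: flow_def)

lemma flow_space: "z \<in> space M \<Longrightarrow> R t z \<in> space M"
  by (rule measurable_space[of "R t" M M]) measurable

lemma AE_flow: "AE z in M. P z \<Longrightarrow> AE z in M. P (R t z)"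
  by (rule AE_distrD[of "R t" M M]) (measurable, subst flow_distr)

lemma emeasure_flow:
  assumes "A \<in> sets M" shows "emeasure M {z\<in>space M. R t z \<in> A} = emeasure M A"
proof -
  have "emeasure M A = emeasure (distr M M (R t)) A" by (simp add: flow_distr)
  also have "\<dots> = emeasure M {z\<in>space M. R t z \<in> A}"
    by (subst emeasure_distr) (use assms in \<open>auto simp: vimage_def Int_def conj_commute\<close>)
  finally show ?thesis by simp
qed

lemma prob_flow: "A \<in> sets M \<Longrightarrow> prob {z\<in>space M. R t z \<in> A} = prob A"
  by (simp add: measure_def emeasure_flow)

text \<open>
  A jointly measurable flow acts continuously on the measure algebra. By invariance the measure in
  question equals its average over the translates by times in \<open>[0, 1]\<close>; exchanging the integrals
  turns it into the translation modulus of the set of times at which an orbit visits \<open>B\<close>.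
\<close>

lemma flow_translation_continuous_0:
  assumes B[measurable]: "B \<in> sets M"
  shows "((\<lambda>h. prob {z\<in>space M. (R h z \<in> B) \<noteq> (z \<in> B)}) \<longlongrightarrow> 0) (at 0)"
  unfolding tendsto_at_iff_sequentially
proof (intro allI impI)
  fix h :: "nat \<Rightarrow> real" assume "\<forall>i. h i \<in> UNIV - {0}" and lim: "h \<longlonglongrightarrow> 0"
  define k where "k n z u = (indicator {u\<in>{0..1}. (R (u + h n) z \<in> B) \<noteq> (R u z \<in> B)} u :: ennreal)" for n z u
  have k[measurable]: "(\<lambda>(z, u). k n z u) \<in> borel_measurable (M \<Otimes>\<^sub>M lborel)" for n
    unfolding k_def indicator_def by measurable
  have Bo: "{u. R u z \<in> B} \<in> sets borel" if "z \<in> space M" for z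
  proof -
    have "(\<lambda>u. R u z) \<in> borel \<rightarrow>\<^sub>M M" using that by measurable
    from measurable_sets[OF this B] show ?thesis by (simp add: vimage_def)
  qed
  have "(\<lambda>n. \<integral>\<^sup>+z. (\<integral>\<^sup>+u. k n z u \<partial>lborel) \<partial>M) \<longlonglongrightarrow> (\<integral>\<^sup>+z. 0 \<partial>M)"
  proof (rule nn_integral_dominated_convergence[where w="\<lambda>_. 1"])
    show "AE z in M. (\<integral>\<^sup>+u. k n z u \<partial>lborel) \<le> 1" for n
    proof (intro AE_I2)
      fix z
      have "(\<integral>\<^sup>+u. k n z u \<partial>lborel) \<le> (\<integral>\<^sup>+(u::real). indicator {0..1} u \<partial>lborel)"
        by (intro nn_integral_mono) (auto simp: k_def indicator_def)
      then show "(\<integral>\<^sup>+u. k n z u \<partial>lborel) \<le> 1" by simp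
    qed
    show "(\<integral>\<^sup>+z. 1 \<partial>M) < \<infinity>" by (simp add: emeasure_space_1)
    show "AE z in M. (\<lambda>n. \<integral>\<^sup>+u. k n z u \<partial>lborel) \<longlonglongrightarrow> 0"
    proof (intro AE_I2)
      fix z assume z: "z \<in> space M"
      define E where "E = {u. R u z \<in> B}"
      have E[measurable]: "E \<in> sets borel" unfolding E_def by (rule Bo[OF z])
      have eq: "(\<integral>\<^sup>+u. k n z u \<partial>lborel) = ennreal (measure lborel {u\<in>{0..1}. (u + h n \<in> E) \<noteq> (u \<in> E)})" for n
      proof -
        have kE: "k n z = indicator {u\<in>{0..1}. (u + h n \<in> E) \<noteq> (u \<in> E)}"
          unfolding k_def E_def by (intro ext) (simp add: indicator_def)
        have "(\<integral>\<^sup>+u. k n z u \<partial>lborel) = emeasure lborel {u\<in>{0..1}. (u + h n \<in> E) \<noteq> (u \<in> E)}"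
          unfolding kE by (rule nn_integral_indicator) measurable
        also have "\<dots> = ennreal (measure lborel {u\<in>{0..1}. (u + h n \<in> E) \<noteq> (u \<in> E)})"
          by (rule emeasure_eq_ennreal_measure)
             (rule less_imp_neq, unfold infinity_ennreal_def[symmetric], rule emeasure_bounded_finite,
              rule bounded_subset[of "{0..1::real}"], auto)
        finally show ?thesis .
      qed
      have "(\<lambda>n. measure lborel {u\<in>{0..1}. (u + h n \<in> E) \<noteq> (u \<in> E)}) \<longlonglongrightarrow> 0"
      proof (rule tendstoI)
        fix e :: real assume "e > 0"
        then obtain d where d: "d > 0" "\<And>h. \<bar>h\<bar> < d \<Longrightarrow> measure lborel {u\<in>{0..1}. (u + h \<in> E) \<noteq> (u \<in> E)} < e"
          using translation_small_measure[OF E] by blast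
        from tendstoD[OF lim d(1)]
        show "eventually (\<lambda>n. dist (measure lborel {u\<in>{0..1}. (u + h n \<in> E) \<noteq> (u \<in> E)}) 0 < e) sequentially"
          by eventually_elim (use d(2) in simp)
      qed
      then have "(\<lambda>n. \<integral>\<^sup>+u. k n z u \<partial>lborel) \<longlonglongrightarrow> ennreal 0"
        unfolding eq by (rule tendsto_ennrealI)
      then show "(\<lambda>n. \<integral>\<^sup>+u. k n z u \<partial>lborel) \<longlonglongrightarrow> 0" unfolding ennreal_0 .
    qed
  qed measurable
  moreover have "(\<integral>\<^sup>+z. (\<integral>\<^sup>+u. k n z u \<partial>lborel) \<partial>M) = ennreal (prob {z\<in>space M. (R (h n) z \<in> B) \<noteq> (z \<in> B)})" for n
  proof -
    interpret P: pair_sigma_finite M lborel ..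
    have "(\<integral>\<^sup>+z. (\<integral>\<^sup>+u. k n z u \<partial>lborel) \<partial>M) = (\<integral>\<^sup>+u. (\<integral>\<^sup>+z. k n z u \<partial>M) \<partial>lborel)"
      by (rule P.Fubini'[symmetric]) measurable
    also have "\<dots> = (\<integral>\<^sup>+(u::real). indicator {0..1} u * emeasure M {z\<in>space M. (R (h n) z \<in> B) \<noteq> (z \<in> B)} \<partial>lborel)"
    proof (rule nn_integral_cong)
      fix u :: real
      have "(\<integral>\<^sup>+z. k n z u \<partial>M) = (\<integral>\<^sup>+z. indicator {0..1} u * indicator {z\<in>space M. R u z \<in> {z\<in>space M. (R (h n) z \<in> B) \<noteq> (z \<in> B)}} z \<partial>M)"
        by (rule nn_integral_cong) (auto simp: k_def indicator_def flow_space add.commute[of u "h n"] flow_add[of _ "h n" u])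
      also have "\<dots> = indicator {0..1} u * emeasure M {z\<in>space M. R u z \<in> {z\<in>space M. (R (h n) z \<in> B) \<noteq> (z \<in> B)}}"
        by (subst nn_integral_cmult_indicator) measurable
      also have "emeasure M {z\<in>space M. R u z \<in> {z\<in>space M. (R (h n) z \<in> B) \<noteq> (z \<in> B)}} = emeasure M {z\<in>space M. (R (h n) z \<in> B) \<noteq> (z \<in> B)}"
        by (rule emeasure_flow) measurable
      finally show "(\<integral>\<^sup>+z. k n z u \<partial>M) = indicator {0..1} u * emeasure M {z\<in>space M. (R (h n) z \<in> B) \<noteq> (z \<in> B)}" .
    qed
    also have "\<dots> = emeasure M {z\<in>space M. (R (h n) z \<in> B) \<noteq> (z \<in> B)}"
      by (subst nn_integral_multc) auto
    finally show ?thesis by (simp add: emeasure_eq_measure)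
  qed
  ultimately have "(\<lambda>n. ennreal (prob {z\<in>space M. (R (h n) z \<in> B) \<noteq> (z \<in> B)})) \<longlonglongrightarrow> ennreal 0" by simp
  then show "((\<lambda>h. prob {z\<in>space M. (R h z \<in> B) \<noteq> (z \<in> B)}) \<circ> h) \<longlonglongrightarrow> 0"
    unfolding comp_def by (subst (asm) tendsto_ennreal_iff) auto
qed

lemma flow_translation_continuous:
  assumes B[measurable]: "B \<in> sets M" and A[measurable]: "A \<in> sets M" and e: "e > 0"
  shows "\<exists>d>0. \<forall>u v. \<bar>u - v\<bar> < d \<longrightarrow> \<bar>prob {z\<in>A. R u z \<in> B} - prob {z\<in>A. R v z \<in> B}\<bar> < e"
proof -
  from tendstoD[OF flow_translation_continuous_0[OF B] e]
  obtain d where d: "d > 0" "\<And>h. h \<noteq> 0 \<Longrightarrow> \<bar>h\<bar> < d \<Longrightarrow> prob {z\<in>space M. (R h z \<in> B) \<noteq> (z \<in> B)} < e"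
    unfolding eventually_at by (auto simp: dist_real_def)
  have Asub: "A \<subseteq> space M" by (rule sets.sets_into_space) (rule A)
  have Aeq: "{z\<in>A. R u z \<in> B} = {z\<in>space M. z \<in> A \<and> R u z \<in> B}" for u using Asub by auto
  have m[measurable]: "{z\<in>A. R u z \<in> B} \<in> sets M" for u unfolding Aeq by measurable
  have "\<bar>prob {z\<in>A. R u z \<in> B} - prob {z\<in>A. R v z \<in> B}\<bar> < e" if uv: "\<bar>u - v\<bar> < d" "u \<noteq> v" for u v
  proof -
    define D where "D = {z\<in>space M. R v z \<in> {z\<in>space M. (R (u - v) z \<in> B) \<noteq> (z \<in> B)}}"
    have D[measurable]: "D \<in> sets M" unfolding D_def by measurable
    have D_iff: "z \<in> D \<longleftrightarrow> z \<in> space M \<and> (R u z \<in> B) \<noteq> (R v z \<in> B)" for z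
      unfolding D_def using flow_add[of z "u - v" v] flow_space[of z v] by auto
    have "prob D = prob {z\<in>space M. (R (u - v) z \<in> B) \<noteq> (z \<in> B)}" unfolding D_def
      by (rule prob_flow) measurable
    also have "\<dots> < e" using d(2)[of "u - v"] uv by simp
    finally have De: "prob D < e" .
    have "prob {z\<in>A. R u z \<in> B} \<le> prob ({z\<in>A. R v z \<in> B} \<union> D)"
      by (rule finite_measure_mono) (use Asub in \<open>auto simp: D_iff\<close>)
    also have "\<dots> \<le> prob {z\<in>A. R v z \<in> B} + prob D" by (rule measure_Un_le) auto
    finally have 1: "prob {z\<in>A. R u z \<in> B} \<le> prob {z\<in>A. R v z \<in> B} + prob D" .
    have "prob {z\<in>A. R v z \<in> B} \<le> prob ({z\<in>A. R u z \<in> B} \<union> D)"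
      by (rule finite_measure_mono) (use Asub in \<open>auto simp: D_iff\<close>)
    also have "\<dots> \<le> prob {z\<in>A. R u z \<in> B} + prob D" by (rule measure_Un_le) auto
    finally show ?thesis using 1 De by linarith
  qed
  moreover have "\<bar>prob {z\<in>A. R u z \<in> B} - prob {z\<in>A. R u z \<in> B}\<bar> < e" for u using e by simp
  ultimately have "\<forall>u v. \<bar>u - v\<bar> < d \<longrightarrow> \<bar>prob {z\<in>A. R u z \<in> B} - prob {z\<in>A. R v z \<in> B}\<bar> < e"
    by (metis (no_types, lifting))
  then show ?thesis using d(1) by blast
qed

text \<open>
  The set where the function exceeds its mean is invariant, and it cannot have probability one.
\<close>

lemma invariant_function_constant:
  assumes erg: "ergodic_flow M R" and h[measurable]: "h \<in> borel_measurable M"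
    and bd: "\<And>z. \<bar>h z\<bar> \<le> C" and inv: "\<And>v. AE z in M. h (R v z) = (h z :: real)"
  shows "AE z in M. h z = (\<integral>z. h z \<partial>M)"
proof -
  define I where "I = (\<integral>z. h z \<partial>M)"
  have int: "integrable M h" by (rule integrable_const_bound[of _ C]) (auto simp: bd)
  define A where "A = {z\<in>space M. h z > I}"
  have A[measurable]: "A \<in> sets M" unfolding A_def by measurable
  have "AE z in M. R v z \<in> A \<longleftrightarrow> z \<in> A" for v
    using inv[of v] AE_space by eventually_elim (auto simp: A_def flow_space)
  then have "prob A = 0 \<or> prob A = 1" using erg A unfolding ergodic_flow_def by blast
  moreover have "prob A \<noteq> 1"
  proof
    assume "prob A = 1"
    then have "AE z in M. z \<in> A" using prob_eq_1[OF A] by simp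
    then have "AE z in M. h z > I" by eventually_elim (simp add: A_def)
    then have "(\<integral>z. I \<partial>M) < (\<integral>z. h z \<partial>M)"
      by (intro integral_less_AE_space) (auto simp: int emeasure_space_1)
    then show False by (simp add: I_def prob_space)
  qed
  ultimately have "prob A = 0" by simp
  then have "AE z in M. z \<notin> A" using prob_eq_0[OF A] by simp
  then have le: "AE z in M. 0 \<le> I - h z" using AE_space by eventually_elim (auto simp: A_def)
  have "(\<integral>z. I - h z \<partial>M) = 0" using int by (simp add: I_def prob_space)
  then have "AE z in M. I - h z = 0"
    using integral_nonneg_eq_0_iff_AE[of M "\<lambda>z. I - h z"] int le by simp
  then show ?thesis by eventually_elim (simp add: I_def)
qed

text \<open>
  The time that an orbit spends in \<open>B\<close> during one period does not depend on when the period starts, so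
  it is an invariant function and therefore constant; integrate it over \<open>A\<close>.
\<close>

lemma average_over_period:
  assumes erg: "ergodic_flow M R" and A[measurable]: "A \<in> sets M" and B[measurable]: "B \<in> sets M"
    and t: "t > 0" and per: "AE z in M. R t z \<in> B \<longleftrightarrow> z \<in> B"
  shows "(\<integral>\<^sup>+u. ennreal (prob {z\<in>A. R u z \<in> B}) * indicator {0..<t} u \<partial>lborel) = ennreal (t * (prob A * prob B))"
proof -
  define h where "h z = measure lborel {u\<in>{0..<t}. z \<in> space M \<and> R u z \<in> B}" for z
  have sec[measurable]: "{u. R u z \<in> B} \<in> sets borel" if "z \<in> space M" for z
  proof -
    have "(\<lambda>u. R u z) \<in> borel \<rightarrow>\<^sub>M M" using that by measurable
    from measurable_sets[OF this B] show ?thesis by (simp add: vimage_def)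
  qed
  have fm: "{u\<in>{0..<t}. z \<in> space M \<and> R u z \<in> B} \<in> fmeasurable lborel" for z
  proof (cases "z \<in> space M")
    case True
    then have "{u\<in>{0..<t}. z \<in> space M \<and> R u z \<in> B} = {u. R u z \<in> B} \<inter> {0..<t}" by auto
    moreover have "{u. R u z \<in> B} \<inter> {0..<t} \<in> fmeasurable lborel"
      by (rule fmeasurableI[OF _ emeasure_bounded_finite])
        (use sec[OF True] in \<open>auto intro: bounded_subset[of "{0..t}"]\<close>)
    ultimately show ?thesis by simp
  qed simp
  have he: "ennreal (h z) = (\<integral>\<^sup>+u. indicator {u\<in>{0..<t}. z \<in> space M \<and> R u z \<in> B} u \<partial>lborel)" for z
    using fm[of z] unfolding h_def by (simp add: emeasure_eq_measure2 fmeasurableD)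
  have hm[measurable]: "h \<in> borel_measurable M"
  proof -
    have "(\<lambda>z. \<integral>\<^sup>+u. indicator {u\<in>{0..<t}. z \<in> space M \<and> R u z \<in> B} u \<partial>lborel) \<in> borel_measurable M"
      unfolding indicator_def by measurable
    then have "(\<lambda>z. enn2real (ennreal (h z))) \<in> borel_measurable M" unfolding he by measurable
    moreover have "enn2real (ennreal (h z)) = h z" for z by (simp add: h_def)
    ultimately show ?thesis by simp
  qed
  have bd: "\<bar>h z\<bar> \<le> t" for z
  proof -
    have "h z \<le> measure lborel {0..<t}" unfolding h_def
      by (rule measure_mono_fmeasurable) (use fm[of z] t in \<open>auto simp: fmeasurable_def\<close>)
    then show ?thesis using t by (simp add: h_def)
  qed
  have perz: "AE z in M. AE u in lborel. R (u + t) z \<in> B \<longleftrightarrow> R u z \<in> B"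
  proof -
    interpret P: pair_sigma_finite M lborel ..
    have "AE u in lborel. AE z in M. R (u + t) z \<in> B \<longleftrightarrow> R u z \<in> B"
    proof (rule AE_I2)
      fix u :: real
      show "AE z in M. R (u + t) z \<in> B \<longleftrightarrow> R u z \<in> B"
        using AE_flow[OF per, of u] AE_space
        by eventually_elim (simp add: flow_add[symmetric] add.commute)
    qed
    moreover have "(AE z in M. AE u in lborel. R (u + t) z \<in> B \<longleftrightarrow> R u z \<in> B) \<longleftrightarrow>
        (AE u in lborel. AE z in M. R (u + t) z \<in> B \<longleftrightarrow> R u z \<in> B)"
      by (rule P.AE_commute) measurable
    ultimately show ?thesis by simp
  qed
  have inv0: "AE z in M. h (R v z) = h z" if v: "v \<ge> 0" for v
    using perz AE_space
  proof eventually_elim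
    case (elim z)
    have "measure lborel {u\<in>{0..<t}. u + v \<in> {u. R u z \<in> B}} = measure lborel {u\<in>{0..<t}. u \<in> {u. R u z \<in> B}}"
      by (rule periodic_set_translate[OF sec _ t v]) (use elim in auto)
    then show ?case using elim by (simp add: h_def flow_add flow_space)
  qed
  have inv: "AE z in M. h (R v z) = h z" for v
  proof (cases "v \<ge> 0")
    case False
    then have "AE z in M. h (R (- v) z) = h z" by (intro inv0) simp
    from AE_flow[OF this, of v] AE_space show ?thesis
      by eventually_elim (simp add: flow_add[symmetric] flow_0)
  qed (rule inv0)
  define I where "I = (\<integral>z. h z \<partial>M)"
  have const: "AE z in M. h z = I" unfolding I_def by (rule invariant_function_constant[OF erg hm bd inv])
  have I0: "I \<ge> 0" unfolding I_def by (rule integral_nonneg_AE) (simp add: h_def)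
  have main: "(\<integral>\<^sup>+u. ennreal (prob {z\<in>A. R u z \<in> B}) * indicator {0..<t} u \<partial>lborel) = ennreal (I * prob A)"
    if A[measurable]: "A \<in> sets M" for A
  proof -
    interpret P: pair_sigma_finite M lborel ..
    have Asub: "A \<subseteq> space M" by (rule sets.sets_into_space) (rule A)
    have Aeq: "{z\<in>A. R u z \<in> B} = {z\<in>space M. z \<in> A \<and> R u z \<in> B}" for u using Asub by auto
    have m[measurable]: "{z\<in>A. R u z \<in> B} \<in> sets M" for u unfolding Aeq by measurable
    have "ennreal (I * prob A) = (\<integral>\<^sup>+z. ennreal I * indicator A z \<partial>M)"
      using I0 by (subst nn_integral_cmult_indicator) (auto simp: ennreal_mult emeasure_eq_measure)
    also have "\<dots> = (\<integral>\<^sup>+z. ennreal (h z) * indicator A z \<partial>M)"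
      by (rule nn_integral_cong_AE) (use const in \<open>auto elim!: eventually_mono\<close>)
    also have "\<dots> = (\<integral>\<^sup>+z. (\<integral>\<^sup>+u. indicator {u\<in>{0..<t}. z \<in> space M \<and> R u z \<in> B} u * indicator A z \<partial>lborel) \<partial>M)"
      unfolding he by (intro nn_integral_cong nn_integral_multc[symmetric]) (use fm in \<open>auto simp: fmeasurable_def\<close>)
    also have "\<dots> = (\<integral>\<^sup>+u. (\<integral>\<^sup>+z. indicator {u\<in>{0..<t}. z \<in> space M \<and> R u z \<in> B} u * indicator A z \<partial>M) \<partial>lborel)"
      by (rule P.Fubini'[symmetric]) (unfold indicator_def, measurable)
    also have "\<dots> = (\<integral>\<^sup>+u. (\<integral>\<^sup>+z. indicator {0..<t} u * indicator {z\<in>A. R u z \<in> B} z \<partial>M) \<partial>lborel)"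
      by (intro nn_integral_cong) (auto simp: indicator_def)
    also have "\<dots> = (\<integral>\<^sup>+u. ennreal (prob {z\<in>A. R u z \<in> B}) * indicator {0..<t} u \<partial>lborel)"
      by (intro nn_integral_cong) (subst nn_integral_cmult_indicator, auto simp: emeasure_eq_measure mult.commute)
    finally show ?thesis by simp
  qed
  have "{z\<in>space M. R u z \<in> B} = {z\<in>space M. R u z \<in> B}" for u by simp
  have "ennreal (I * prob (space M)) = (\<integral>\<^sup>+(u::real). ennreal (prob B) * indicator {0..<t} u \<partial>lborel)"
    using main[of "space M"] by (simp add: prob_flow)
  also have "\<dots> = ennreal (prob B * t)"
    using t by (subst nn_integral_cmult_indicator) (auto simp: ennreal_mult)
  finally have "I = prob B * t" using I0 t by (simp add: prob_space)
  then show ?thesis using main[OF A] by (simp add: mult_ac)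
qed

end

section \<open>Ergodicity of time maps\<close>

context prob_flow
begin

text \<open>
  The correlation \<open>M(A \<inter> R\<^sub>-\<^sub>u B)\<close> has both periods \<open>s\<close> and \<open>t\<close> in \<open>u\<close>, hence is constant; its average over
  one period of \<open>B\<close> is the product of the measures.
\<close>

lemma independent_if_incommensurable:
  assumes erg: "ergodic_flow M R" and A[measurable]: "A \<in> sets M" and B[measurable]: "B \<in> sets M"
    and s: "AE z in M. R s z \<in> A \<longleftrightarrow> z \<in> A" and t: "AE z in M. R t z \<in> B \<longleftrightarrow> z \<in> B"
    and t0: "t > 0" and irr: "s / t \<notin> \<rat>"
  shows "prob (A \<inter> B) = prob A * prob B"
proof -
  define c where "c u = prob {z\<in>A. R u z \<in> B}" for u
  have Asub: "A \<subseteq> space M" by (rule sets.sets_into_space) (rule A)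
  have Aeq: "{z\<in>A. R u z \<in> B} = {z\<in>space M. z \<in> A \<and> R u z \<in> B}" for u using Asub by auto
  have m[measurable]: "{z\<in>A. R u z \<in> B} \<in> sets M" for u unfolding Aeq by measurable
  have ct: "c (u + t) = c u" for u unfolding c_def
  proof (rule measure_eq_AE)
    show "AE z in M. z \<in> {z\<in>A. R (u + t) z \<in> B} \<longleftrightarrow> z \<in> {z\<in>A. R u z \<in> B}"
      using AE_flow[OF t, of u] AE_space
      by eventually_elim (auto simp: flow_add[symmetric] add.commute)
  qed measurable
  have cs: "c (u + s) = c u" for u
  proof -
    have "c (u + s) = prob {z\<in>space M. R s z \<in> {z\<in>A. R u z \<in> B}}" unfolding c_def
    proof (rule measure_eq_AE)
      show "AE z in M. z \<in> {z\<in>A. R (u + s) z \<in> B} \<longleftrightarrow> z \<in> {z\<in>space M. R s z \<in> {z\<in>A. R u z \<in> B}}"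
        using s AE_space by eventually_elim (auto simp: flow_add)
    qed measurable
    also have "\<dots> = c u" unfolding c_def by (rule prob_flow) measurable
    finally show ?thesis .
  qed
  have "c u = c 0" for u
    by (rule incommensurable_periods_constant[OF _ cs ct t0 irr])
       (unfold c_def, rule flow_translation_continuous[OF B A])
  moreover have c0: "c 0 = prob (A \<inter> B)"
    unfolding c_def by (rule arg_cong[of _ _ prob]) (use Asub flow_0 in auto)
  ultimately have "(\<integral>\<^sup>+u. ennreal (prob {z\<in>A. R u z \<in> B}) * indicator {0..<t} u \<partial>lborel)
      = (\<integral>\<^sup>+(u::real). ennreal (prob (A \<inter> B)) * indicator {0..<t} u \<partial>lborel)"
    unfolding c_def by simp
  also have "\<dots> = ennreal (t * prob (A \<inter> B))"
    using t0 by (subst nn_integral_cmult_indicator) (auto simp: ennreal_mult mult.commute)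
  finally have "t * prob (A \<inter> B) = t * (prob A * prob B)"
    using average_over_period[OF erg A B t0 t] t0 by (simp add: ennreal_inj)
  then show ?thesis using t0 by simp
qed

lemma ergodic_map_flow_iff:
  "ergodic_map M (R t) \<longleftrightarrow>
     (\<forall>A\<in>sets M. (AE z in M. R t z \<in> A \<longleftrightarrow> z \<in> A) \<longrightarrow> prob A = 0 \<or> prob A = 1)"
proof -
  have "R t \<in> M \<rightarrow>\<^sub>M M" by measurable
  then show ?thesis by (simp add: ergodic_map_def flow_distr)
qed

lemma ergodic_map_flow_uminus:
  assumes "ergodic_map M (R t)" shows "ergodic_map M (R (- t))"
  unfolding ergodic_map_flow_iff
proof (intro ballI impI)
  fix A assume A: "A \<in> sets M" and inv: "AE z in M. R (- t) z \<in> A \<longleftrightarrow> z \<in> A"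
  have "AE z in M. R t z \<in> A \<longleftrightarrow> z \<in> A"
    using AE_flow[OF inv, of t] AE_space
    by eventually_elim (simp add: flow_add[symmetric] flow_0)
  then show "prob A = 0 \<or> prob A = 1" using assms A unfolding ergodic_map_flow_iff by blast
qed

text \<open>
  Sets invariant under incommensurable times are independent, so they stay apart in the measure
  algebra; separability leaves room for only countably many commensurability classes.
\<close>

lemma countable_nonergodic_times:
  assumes erg: "ergodic_flow M R" and G: "sets M = sigma_sets (space M) G" "countable G"
  shows "countable {t. t > 0 \<and> \<not> ergodic_map M (R t)}"
proof -
  define Bad where "Bad = {t. t > 0 \<and> \<not> ergodic_map M (R t)}"
  obtain C where C: "countable C" "C \<subseteq> sets M"
    and dense: "\<And>A e. A \<in> sets M \<Longrightarrow> e > 0 \<Longrightarrow> \<exists>D\<in>C. prob (A - D \<union> (D - A)) < e"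
    using separable_measure_algebra[OF G] by blast
  have ex: "\<forall>t\<in>Bad. \<exists>A. A \<in> sets M \<and> (AE z in M. R t z \<in> A \<longleftrightarrow> z \<in> A) \<and> prob A \<noteq> 0 \<and> prob A \<noteq> 1"
    unfolding Bad_def ergodic_map_flow_iff by blast
  obtain A where AA: "\<forall>t\<in>Bad. A t \<in> sets M \<and> (AE z in M. R t z \<in> A t \<longleftrightarrow> z \<in> A t)
      \<and> prob (A t) \<noteq> 0 \<and> prob (A t) \<noteq> 1"
    using bchoice[OF ex] by (elim exE)
  then have A: "\<And>t. t \<in> Bad \<Longrightarrow> A t \<in> sets M"
    and inv: "\<And>t. t \<in> Bad \<Longrightarrow> AE z in M. R t z \<in> A t \<longleftrightarrow> z \<in> A t"
    and nontriv: "\<And>t. t \<in> Bad \<Longrightarrow> prob (A t) \<noteq> 0 \<and> prob (A t) \<noteq> 1"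
    by simp_all
  define \<eta> where "\<eta> n = inverse (real (Suc n))" for n
  \<comment> \<open>Two independent sets with measures in \<open>(\<eta>, 1 - \<eta>)\<close> are at distance more than \<open>2 \<eta>\<^sup>2\<close>, so they cannot
    both lie within \<open>\<eta>\<^sup>2\<close> of the same \<open>D\<close>.\<close>
  define K where "K n D = {t\<in>Bad. \<eta> n < prob (A t) \<and> prob (A t) < 1 - \<eta> n \<and>
      prob (A t - D \<union> (D - A t)) < \<eta> n * \<eta> n}" for n D
  have "Bad \<subseteq> (\<Union>n. \<Union>D\<in>C. K n D)"
  proof
    fix t assume t: "t \<in> Bad"
    have pos: "prob (A t) > 0" and less: "prob (A t) < 1"
      using nontriv[OF t] measure_nonneg[of M "A t"] prob_le_1[of "A t"] by linarith+
    then have "min (prob (A t)) (1 - prob (A t)) > 0" by simp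
    then have "\<exists>n. inverse (real (Suc n)) < min (prob (A t)) (1 - prob (A t))" by (rule reals_Archimedean)
    then obtain n where n: "\<eta> n < prob (A t)" "prob (A t) < 1 - \<eta> n" unfolding \<eta>_def by auto
    have "\<eta> n * \<eta> n > 0" unfolding \<eta>_def by simp
    then obtain D where "D \<in> C" "prob (A t - D \<union> (D - A t)) < \<eta> n * \<eta> n"
      using dense[OF A[OF t]] by blast
    then show "t \<in> (\<Union>n. \<Union>D\<in>C. K n D)" unfolding K_def using t n by blast
  qed
  moreover have "countable (K n D)" if D: "D \<in> C" for n D
  proof (cases "K n D = {}")
    case False
    then obtain t where t: "t \<in> K n D" by blast
    have "K n D \<subseteq> (\<lambda>q. q * t) ` \<rat>"
    proof
      fix s assume s: "s \<in> K n D"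
      have sB: "s \<in> Bad" and tB: "t \<in> Bad" and t0: "t > 0" using s t unfolding K_def Bad_def by auto
      note [measurable] = A[OF sB] A[OF tB] subsetD[OF C(2) D]
      have "s / t \<in> \<rat>"
      proof (rule ccontr)
        assume "s / t \<notin> \<rat>"
        then have ind: "prob (A s \<inter> A t) = prob (A s) * prob (A t)"
          by (intro independent_if_incommensurable[OF erg A[OF sB] A[OF tB] inv[OF sB] inv[OF tB] t0])
        define a where "a = prob (A s)"
        define b where "b = prob (A t)"
        define e where "e = \<eta> n"
        have e: "e > 0" unfolding e_def \<eta>_def by simp
        have ab: "e < a" "e < 1 - a" "e < b" "e < 1 - b" using s t unfolding K_def a_def b_def e_def by auto
        have "prob (A s - A t) = a - a * b" "prob (A t - A s) = b - a * b"
          unfolding a_def b_def ind[symmetric]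
          by (simp_all add: finite_measure_Diff' Int_commute)
        moreover have "prob (A s - A t \<union> (A t - A s)) = prob (A s - A t) + prob (A t - A s)"
          by (rule finite_measure_Union) auto
        ultimately have 1: "prob (A s - A t \<union> (A t - A s)) = a * (1 - b) + b * (1 - a)"
          by (simp add: algebra_simps)
        have "e * e < a * (1 - b)" "e * e < b * (1 - a)" using ab e by (auto intro!: mult_strict_mono)
        then have low: "prob (A s - A t \<union> (A t - A s)) > 2 * (e * e)" using 1 by linarith
        have "prob (A s - A t \<union> (A t - A s)) \<le> prob ((A s - D \<union> (D - A s)) \<union> (A t - D \<union> (D - A t)))"
          by (rule finite_measure_mono) auto
        also have "\<dots> \<le> prob (A s - D \<union> (D - A s)) + prob (A t - D \<union> (D - A t))"
          by (rule measure_Un_le) auto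
        also have "\<dots> < 2 * (e * e)" using s t unfolding K_def e_def by auto
        finally show False using low by simp
      qed
      then show "s \<in> (\<lambda>q. q * t) ` \<rat>" using t0 by (intro image_eqI[of _ _ "s / t"]) auto
    qed
    then show ?thesis using countable_rat countable_image countable_subset by blast
  qed simp
  then have "countable (\<Union>n. \<Union>D\<in>C. K n D)" using C(1) by (intro countable_UN) auto
  ultimately have "countable Bad" by (rule countable_subset)
  then show ?thesis unfolding Bad_def .
qed

end

text \<open>
  For \<open>A\<close> invariant under time \<open>p\<close> both \<open>c u = \<mu>(A \<inter> T\<^sub>-\<^sub>u A)\<close> and its square average over a period
  to the value predicted by independence, so \<open>c\<close> has variance zero; being continuous it is constant
  and \<open>c 0 = \<mu>(A)\<^sup>2\<close>.
\<close>

lemma weakly_mixing_time_ergodic_pos: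
  assumes M: "prob_space M" and wm: "weakly_mixing_flow M T" and p: "p > 0"
  shows "ergodic_map M (T p)"
proof -
  interpret prob_flow M T
    using M wm by (simp add: prob_flow_def prob_flow_axioms_def weakly_mixing_flow_def)
  interpret P: pair_prob_space M M ..
  have ergP: "ergodic_flow (M \<Otimes>\<^sub>M M) (prod_flow T T)" using wm by (simp add: weakly_mixing_flow_def)
  interpret MM: prob_flow "M \<Otimes>\<^sub>M M" "prod_flow T T"
    using ergP by unfold_locales (simp add: ergodic_flow_def)
  have AE_fst: "AE z in M \<Otimes>\<^sub>M M. Q (fst z)" and AE_snd: "AE z in M \<Otimes>\<^sub>M M. Q (snd z)"
    if Q: "AE x in M. Q x" for Q
  proof -
    obtain N where N: "N \<in> null_sets M" "{x\<in>space M. \<not> Q x} \<subseteq> N"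
      using Q unfolding eventually_ae_filter by blast
    have [measurable]: "N \<in> sets M" and N0: "emeasure M N = 0" using N(1) by auto
    have 1: "N \<times> space M \<in> null_sets (M \<Otimes>\<^sub>M M)" "space M \<times> N \<in> null_sets (M \<Otimes>\<^sub>M M)"
      using N0 by (simp_all add: null_sets_def emeasure_pair_measure_Times)
    show "AE z in M \<Otimes>\<^sub>M M. Q (fst z)"
      by (rule AE_I'[OF 1(1)]) (use N(2) in \<open>auto simp: space_pair_measure\<close>)
    show "AE z in M \<Otimes>\<^sub>M M. Q (snd z)"
      by (rule AE_I'[OF 1(2)]) (use N(2) in \<open>auto simp: space_pair_measure\<close>)
  qed
  have times: "P.prob (A \<times> B) = prob A * prob B" if "A \<in> sets M" "B \<in> sets M" for A B
    using that by (simp add: measure_def emeasure_pair_measure_Times enn2real_mult)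
  have erg: "ergodic_flow M T" unfolding ergodic_flow_def
  proof (intro conjI ballI impI flow)
    fix A assume A: "A \<in> sets M" and inv: "\<forall>t. AE x in M. T t x \<in> A \<longleftrightarrow> x \<in> A"
    have "AE z in M \<Otimes>\<^sub>M M. prod_flow T T t z \<in> A \<times> space M \<longleftrightarrow> z \<in> A \<times> space M" for t
      using AE_fst[OF inv[rule_format, of t]] AE_space
      by eventually_elim (auto simp: prod_flow_def flow_space space_pair_measure)
    then have "P.prob (A \<times> space M) = 0 \<or> P.prob (A \<times> space M) = 1"
      using ergP A unfolding ergodic_flow_def by (auto dest!: bspec[of _ _ "A \<times> space M"])
    then show "prob A = 0 \<or> prob A = 1" using A by (simp add: times prob_space)
  qed
  show ?thesis unfolding ergodic_map_flow_iff
  proof (intro ballI impI)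
    fix A assume A[measurable]: "A \<in> sets M" and inv: "AE x in M. T p x \<in> A \<longleftrightarrow> x \<in> A"
    define c where "c u = prob {z\<in>A. T u z \<in> A}" for u
    define a where "a = prob A"
    have Asub: "A \<subseteq> space M" by (rule sets.sets_into_space) (rule A)
    have Aeq: "{z\<in>A. T u z \<in> A} = {z\<in>space M. z \<in> A \<and> T u z \<in> A}" for u using Asub by auto
    have m[measurable]: "{z\<in>A. T u z \<in> A} \<in> sets M" for u unfolding Aeq by measurable
    have 1: "(\<integral>\<^sup>+u. ennreal (c u) * indicator {0..<p} u \<partial>lborel) = ennreal (p * (a * a))"
      unfolding c_def a_def by (rule average_over_period[OF erg A A p inv])
    have invP: "AE z in M \<Otimes>\<^sub>M M. prod_flow T T p z \<in> A \<times> A \<longleftrightarrow> z \<in> A \<times> A"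
      using AE_fst[OF inv] AE_snd[OF inv] by eventually_elim (auto simp: prod_flow_def)
    have sq: "P.prob {z\<in>A \<times> A. prod_flow T T u z \<in> A \<times> A} = c u * c u" for u
    proof -
      have "{z\<in>A \<times> A. prod_flow T T u z \<in> A \<times> A} = {z\<in>A. T u z \<in> A} \<times> {z\<in>A. T u z \<in> A}"
        by (auto simp: prod_flow_def)
      then show ?thesis by (simp add: times c_def)
    qed
    have 2: "(\<integral>\<^sup>+u. ennreal (c u * c u) * indicator {0..<p} u \<partial>lborel) = ennreal (p * ((a * a) * (a * a)))"
      using MM.average_over_period[OF ergP _ _ p invP, of "A \<times> A"] by (simp add: sq times a_def)
    have cont: "\<exists>d>0. \<forall>u v. \<bar>u - v\<bar> < d \<longrightarrow> \<bar>c u - c v\<bar> < e" if "e > 0" for e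
      unfolding c_def by (rule flow_translation_continuous) (use that in auto)
    have cm[measurable]: "c \<in> borel_measurable borel"
    proof (rule borel_measurable_continuous_onI)
      show "continuous_on UNIV c" unfolding continuous_on_iff
        using cont by (fastforce simp: dist_real_def)
    qed
    have c0: "c u \<ge> 0" for u by (simp add: c_def)
    have b1: "has_bochner_integral lborel (\<lambda>u. c u * indicator {0..<p} u) (p * (a * a))"
      by (rule has_bochner_integral_nn_integral)
         (use 1 c0 p in \<open>auto simp: ennreal_mult ennreal_indicator a_def\<close>)
    have b2: "has_bochner_integral lborel (\<lambda>u. (c u * c u) * indicator {0..<p} u) (p * ((a * a) * (a * a)))"
      by (rule has_bochner_integral_nn_integral)
         (use 2 c0 p in \<open>auto simp: ennreal_mult'' ennreal_indicator a_def\<close>)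
    have b3: "has_bochner_integral lborel (\<lambda>u. ((a * a) * (a * a)) * indicator {0..<p} u) (((a * a) * (a * a)) * p)"
      using has_bochner_integral_real_indicator[of "{0..<p}" lborel] p
      by (intro has_bochner_integral_mult_right) auto
    define g where "g u = (c u - a * a) * (c u - a * a) * indicator {0..<p} u" for u
    have b: "has_bochner_integral lborel g 0"
    proof -
      have "has_bochner_integral lborel (\<lambda>u. (c u * c u) * indicator {0..<p} u
          + ((- 2) * (a * a) * (c u * indicator {0..<p} u) + ((a * a) * (a * a)) * indicator {0..<p} u))
          (p * ((a * a) * (a * a)) + ((- 2) * (a * a) * (p * (a * a)) + ((a * a) * (a * a)) * p))"
        by (intro has_bochner_integral_add b2 b3 has_bochner_integral_mult_right b1)
      moreover have "(\<lambda>u. (c u * c u) * indicator {0..<p} u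
          + ((- 2) * (a * a) * (c u * indicator {0..<p} u) + ((a * a) * (a * a)) * indicator {0..<p} u)) = g"
        unfolding g_def by (auto simp: algebra_simps)
      moreover have "p * ((a * a) * (a * a)) + ((- 2) * (a * a) * (p * (a * a)) + ((a * a) * (a * a)) * p) = 0"
        by (simp add: algebra_simps)
      ultimately show ?thesis by simp
    qed
    have AEg: "AE u in lborel. g u = 0"
      using integral_nonneg_eq_0_iff_AE[of lborel g] has_bochner_integral_integral_eq[OF b] integrable.intros[OF b]
      by (auto simp: g_def)
    have "c 0 = a * a"
    proof (rule ccontr)
      assume ne: "c 0 \<noteq> a * a"
      then obtain d where d: "d > 0" "\<And>u. \<bar>u - 0\<bar> < d \<Longrightarrow> \<bar>c u - c 0\<bar> < \<bar>c 0 - a * a\<bar>"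
        using cont[of "\<bar>c 0 - a * a\<bar>"] by force
      have gne: "g u \<noteq> 0" if "u \<in> {0..<min d p}" for u
        using d(2)[of u] that by (auto simp: g_def)
      have "AE u in lborel. u \<notin> {0..<min d p}" using AEg by eventually_elim (use gne in blast)
      moreover have sets: "{0..<min d p} \<in> sets lborel" by simp
      ultimately have "{0..<min d p} \<in> null_sets lborel" using AE_iff_null_sets[OF sets] by blast
      then have "emeasure lborel {0..<min d p} = 0" by (rule null_setsD1)
      then show False using d(1) p by simp
    qed
    moreover have "c 0 = a" unfolding c_def a_def by (rule arg_cong[of _ _ prob]) (use Asub flow_0 in auto)
    ultimately have "a * (1 - a) = 0" by (simp add: algebra_simps)
    then show "prob A = 0 \<or> prob A = 1" by (auto simp: a_def)
  qed
qed

lemma weakly_mixing_time_ergodic: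
  assumes M: "prob_space M" and wm: "weakly_mixing_flow M T" and p: "p \<noteq> 0"
  shows "ergodic_map M (T p)"
proof (cases "p > 0")
  case False
  interpret prob_flow M T
    using M wm by (simp add: prob_flow_def prob_flow_axioms_def weakly_mixing_flow_def)
  from False p have "ergodic_map M (T (- p))" by (intro weakly_mixing_time_ergodic_pos[OF M wm]) simp
  from ergodic_map_flow_uminus[OF this] show ?thesis by simp
qed (rule weakly_mixing_time_ergodic_pos[OF M wm])

section \<open>Joinings and correlations\<close>

locale flow_joining = mu: prob_flow \<mu> T + nu: prob_flow \<nu> S + rho: prob_flow \<rho> "prod_flow T S"
  for \<mu> :: "'a::metric_space measure" and T :: "real \<Rightarrow> 'a \<Rightarrow> 'a"
    and \<nu> :: "'b measure" and S :: "real \<Rightarrow> 'b \<Rightarrow> 'b" and \<rho> :: "('a \<times> 'b) measure" +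
  assumes sets_mu [measurable_cong]: "sets \<mu> = sets borel"
    and sets_rho [measurable_cong]: "sets \<rho> = sets (\<mu> \<Otimes>\<^sub>M \<nu>)"
    and distr_fst: "distr \<rho> \<mu> fst = \<mu>" and distr_snd: "distr \<rho> \<nu> snd = \<nu>"
begin

lemma space_mu [simp]: "space \<mu> = UNIV"
  using sets_eq_imp_space_eq[OF sets_mu] by simp

lemma space_rho: "space \<rho> = UNIV \<times> space \<nu>"
  using sets_eq_imp_space_eq[OF sets_rho] by (simp add: space_pair_measure)

lemma measurable_fst_rho [measurable]: "fst \<in> \<rho> \<rightarrow>\<^sub>M \<mu>"
  and measurable_snd_rho [measurable]: "snd \<in> \<rho> \<rightarrow>\<^sub>M \<nu>"
  by (simp_all add: measurable_cong_sets[OF sets_rho refl])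

lemma T_0 [simp]: "T 0 x = x" and T_add: "T (s + t) x = T s (T t x)"
  using mu.flow_0 mu.flow_add by auto

lemma emeasure_fst: "A \<in> sets \<mu> \<Longrightarrow> emeasure \<rho> {z\<in>space \<rho>. fst z \<in> A} = emeasure \<mu> A"
  using arg_cong[OF distr_fst, of "\<lambda>m. emeasure m A"]
  by (subst (asm) emeasure_distr) (auto simp: vimage_def Int_def conj_commute)

lemma emeasure_snd: "B \<in> sets \<nu> \<Longrightarrow> emeasure \<rho> {z\<in>space \<rho>. snd z \<in> B} = emeasure \<nu> B"
  using arg_cong[OF distr_snd, of "\<lambda>m. emeasure m B"]
  by (subst (asm) emeasure_distr) (auto simp: vimage_def Int_def conj_commute)

lemma AE_fst: assumes "AE x in \<mu>. Q x" shows "AE z in \<rho>. Q (fst z)"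
  by (rule AE_distrD[of fst \<rho> \<mu>]) (measurable, subst distr_fst, rule assms)

text \<open>
  An ergodic automorphism is disjoint from the identity: averaging the indicator of \<open>A\<close> along the
  powers of \<open>T p\<close> does not change its correlation with \<open>B\<close>, while the averages converge to \<open>\<mu>(A)\<close>.
\<close>

lemma product_if_invariant:
  assumes erg: "ergodic_map \<mu> (T p)"
    and inv: "\<And>A B. A \<in> sets \<mu> \<Longrightarrow> B \<in> sets \<nu> \<Longrightarrow>
      rho.prob {z\<in>space \<rho>. T p (fst z) \<in> A \<and> snd z \<in> B} = rho.prob {z\<in>space \<rho>. fst z \<in> A \<and> snd z \<in> B}"
  shows "\<rho> = \<mu> \<Otimes>\<^sub>M \<nu>"
proof -
  have eq: "rho.prob {z\<in>space \<rho>. fst z \<in> A \<and> snd z \<in> B} = mu.prob A * nu.prob B"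
    if A[measurable]: "A \<in> sets \<mu>" and B[measurable]: "B \<in> sets \<nu>" for A B
  proof -
    define r where "r = rho.prob {z\<in>space \<rho>. fst z \<in> A \<and> snd z \<in> B}"
    have Tj[measurable]: "(T p ^^ j) \<in> \<mu> \<rightarrow>\<^sub>M \<mu>" for j
      by (rule measurable_funpow) measurable
    have pow: "rho.prob {z\<in>space \<rho>. (T p ^^ j) (fst z) \<in> A \<and> snd z \<in> B} = r" for j
    proof (induction j)
      case 0 show ?case by (simp add: r_def)
    next
      case (Suc j)
      define A' where "A' = {x\<in>space \<mu>. (T p ^^ j) x \<in> A}"
      have A': "A' \<in> sets \<mu>" unfolding A'_def by measurable
      have "rho.prob {z\<in>space \<rho>. (T p ^^ Suc j) (fst z) \<in> A \<and> snd z \<in> B}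
          = rho.prob {z\<in>space \<rho>. T p (fst z) \<in> A' \<and> snd z \<in> B}"
        by (simp add: A'_def funpow_swap1)
      also have "\<dots> = rho.prob {z\<in>space \<rho>. fst z \<in> A' \<and> snd z \<in> B}" by (rule inv[OF A' B])
      also have "\<dots> = r" using Suc by (simp add: A'_def)
      finally show ?case .
    qed
    define a where "a n x = orbit_sum (T p) (indicator A) n x / real n" for n x
    have [measurable]: "orbit_sum (T p) (indicator A) n \<in> borel_measurable \<mu>" for n
      by (rule measurable_orbit_sum) measurable
    have [measurable]: "a n \<in> borel_measurable \<mu>" for n unfolding a_def by measurable
    have lim: "AE x in \<mu>. (\<lambda>n. a n x) \<longlonglongrightarrow> (\<integral>x. indicator A x \<partial>\<mu>)"
      unfolding a_def by (rule mu.birkhoff_ergodic[OF erg, where C=1]) (auto simp: indicator_def)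
    have "(\<lambda>n. \<integral>z. a n (fst z) * indicator B (snd z) \<partial>\<rho>) \<longlonglongrightarrow> (\<integral>z. mu.prob A * indicator B (snd z) \<partial>\<rho>)"
    proof (rule integral_dominated_convergence[where w="\<lambda>_. 1"])
      show "AE z in \<rho>. (\<lambda>n. a n (fst z) * indicator B (snd z)) \<longlonglongrightarrow> mu.prob A * indicator B (snd z)"
        using AE_fst[OF lim] by eventually_elim (auto intro!: tendsto_intros)
      show "AE z in \<rho>. norm (a n (fst z) * indicator B (snd z)) \<le> 1" for n
      proof (intro AE_I2)
        fix z :: "'a \<times> 'b"
        have "orbit_sum (T p) (indicator A) n (fst z) \<le> (\<Sum>j<n. 1)" unfolding orbit_sum_def
          by (rule sum_mono) (auto simp: indicator_def)
        moreover have "0 \<le> orbit_sum (T p) (indicator A) n (fst z)" unfolding orbit_sum_def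
          by (rule sum_nonneg) auto
        ultimately show "norm (a n (fst z) * indicator B (snd z)) \<le> 1"
          unfolding a_def by (auto simp: indicator_def divide_le_eq)
      qed
    qed measurable
    moreover have "(\<integral>z. a n (fst z) * indicator B (snd z) \<partial>\<rho>) = r" if n: "n > 0" for n
    proof -
      have "(\<integral>z. a n (fst z) * indicator B (snd z) \<partial>\<rho>)
          = (\<integral>z. (\<Sum>j<n. indicator {z\<in>space \<rho>. (T p ^^ j) (fst z) \<in> A \<and> snd z \<in> B} z / real n) \<partial>\<rho>)"
        unfolding a_def orbit_sum_def
      proof (rule Bochner_Integration.integral_cong[OF refl])
        fix z assume z: "z \<in> space \<rho>"
        show "(\<Sum>j<n. indicator A ((T p ^^ j) (fst z))) / real n * indicator B (snd z)
            = (\<Sum>j<n. indicator {z\<in>space \<rho>. (T p ^^ j) (fst z) \<in> A \<and> snd z \<in> B} z / real n)"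
          unfolding sum_divide_distrib sum_distrib_right
          by (rule sum.cong) (use z in \<open>auto simp: indicator_def\<close>)
      qed
      also have "\<dots> = (\<Sum>j<n. \<integral>z. indicator {z\<in>space \<rho>. (T p ^^ j) (fst z) \<in> A \<and> snd z \<in> B} z / real n \<partial>\<rho>)"
        by (rule Bochner_Integration.integral_sum, rule integrable_divide, rule integrable_real_indicator)
           (measurable, simp add: rho.emeasure_eq_measure)
      also have "\<dots> = (\<Sum>j<n. r / real n)" by (rule sum.cong) (auto simp: pow)
      finally show ?thesis using n by simp
    qed
    then have "(\<lambda>n. \<integral>z. a n (fst z) * indicator B (snd z) \<partial>\<rho>) \<longlonglongrightarrow> r"
      by (intro tendsto_eventually eventually_mono[OF eventually_gt_at_top[of 0]]) auto
    ultimately have "(\<integral>z. mu.prob A * indicator B (snd z) \<partial>\<rho>) = r" by (rule LIMSEQ_unique)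
    moreover have "(\<integral>z. mu.prob A * indicator B (snd z) \<partial>\<rho>) = mu.prob A * (\<integral>z. indicator {z\<in>space \<rho>. snd z \<in> B} z \<partial>\<rho>)"
      by (subst Bochner_Integration.integral_mult_right_zero[symmetric], rule Bochner_Integration.integral_cong)
         (auto simp: indicator_def)
    moreover have "(\<integral>z. indicator {z\<in>space \<rho>. snd z \<in> B} z \<partial>\<rho>) = nu.prob B"
      using emeasure_snd[OF B] by (simp add: measure_def)
    ultimately show ?thesis by (simp add: r_def)
  qed
  show ?thesis
  proof (rule pair_measure_eqI[symmetric])
    show "sigma_finite_measure \<mu>" "sigma_finite_measure \<nu>" by unfold_locales
    show "sets (\<mu> \<Otimes>\<^sub>M \<nu>) = sets \<rho>" by (simp add: sets_rho)
    fix A B assume AB: "A \<in> sets \<mu>" "B \<in> sets \<nu>"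
    have "A \<times> B = {z\<in>space \<rho>. fst z \<in> A \<and> snd z \<in> B}"
      using sets.sets_into_space[OF AB(2)] by (auto simp: space_rho)
    then show "emeasure \<mu> A * emeasure \<nu> B = emeasure \<rho> (A \<times> B)"
      using eq[OF AB] by (simp add: mu.emeasure_eq_measure nu.emeasure_eq_measure rho.emeasure_eq_measure ennreal_mult)
  qed
qed

definition observable :: "('a \<Rightarrow> real) \<Rightarrow> 'b set \<Rightarrow> real \<Rightarrow> 'a \<times> 'b \<Rightarrow> real" where
  "observable f B s z = f (T s (fst z)) * indicator B (snd z)"

definition correlation :: "('a \<Rightarrow> real) \<Rightarrow> 'b set \<Rightarrow> real \<Rightarrow> real" where
  "correlation f B s = (\<integral>z. observable f B s z \<partial>\<rho>)"

definition test_function :: "real \<Rightarrow> ('a \<Rightarrow> real) \<Rightarrow> bool" where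
  "test_function K f \<longleftrightarrow> K \<ge> 0 \<and> (\<forall>x. 0 \<le> f x \<and> f x \<le> 1) \<and> (\<forall>x y. \<bar>f x - f y\<bar> \<le> K * dist x y)"

lemma test_function_mono: "test_function K f \<Longrightarrow> K \<le> K' \<Longrightarrow> test_function K' f"
  unfolding test_function_def by (meson mult_right_mono order_trans zero_le_dist)

lemma test_function_measurable:
  assumes "test_function K f" shows "f \<in> borel_measurable borel"
proof (rule borel_measurable_continuous_onI)
  have "K-lipschitz_on UNIV f"
    using assms by (auto simp: test_function_def lipschitz_on_def dist_real_def)
  then show "continuous_on UNIV f" by (rule lipschitz_on_continuous_on)
qed

lemma observable_measurable [measurable]:
  assumes "test_function K f" and [measurable]: "B \<in> sets \<nu>"
  shows "observable f B s \<in> borel_measurable \<rho>"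
proof -
  have [measurable]: "f \<in> borel_measurable \<mu>" using test_function_measurable[OF assms(1)]
    by (simp add: measurable_cong_sets[OF sets_mu refl])
  show ?thesis unfolding observable_def by measurable
qed

lemma observable_range: "test_function K f \<Longrightarrow> 0 \<le> observable f B s z \<and> observable f B s z \<le> 1"
  unfolding test_function_def observable_def indicator_def by auto

lemma observable_integrable:
  assumes "test_function K f" "B \<in> sets \<nu>" shows "integrable \<rho> (observable f B s)"
  by (rule rho.integrable_const_bound[of _ 1])
     (use observable_range[OF assms(1), of B s] observable_measurable[OF assms, of s] in auto)

text \<open>
  Lipschitz functions that decrease, as \<open>m\<close> grows, to the indicator of \<open>C\<close> when \<open>C\<close> is closed and
  nonempty.
\<close>

definition bump :: "'a set \<Rightarrow> nat \<Rightarrow> 'a \<Rightarrow> real" where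
  "bump C m x = max 0 (1 - real m * infdist x C)"

lemma test_function_bump: "test_function (real m) (bump C m)"
  unfolding test_function_def
proof (intro conjI allI)
  fix x y
  have "\<bar>real m * infdist x C - real m * infdist y C\<bar> = real m * \<bar>infdist x C - infdist y C\<bar>"
    by (simp add: abs_mult right_diff_distrib[symmetric])
  also have "\<dots> \<le> real m * dist x y" by (intro mult_left_mono infdist_triangle_abs) auto
  finally show "\<bar>bump C m x - bump C m y\<bar> \<le> real m * dist x y" unfolding bump_def by linarith
qed (auto simp: bump_def infdist_nonneg)

lemma bump_tendsto_indicator:
  assumes "closed C" "C \<noteq> {}"
  shows "(\<lambda>m. bump C m x) \<longlonglongrightarrow> indicator C x"
proof (cases "x \<in> C")
  case True then show ?thesis by (simp add: bump_def)
next
  case False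
  then have pos: "infdist x C > 0" using assms
    by (metis in_closed_iff_infdist_zero infdist_nonneg less_eq_real_def)
  obtain k :: nat where k: "real k > 1 / infdist x C" using reals_Archimedean2 by blast
  have "bump C m x = 0" if "m \<ge> k" for m
  proof -
    have "1 / infdist x C < real m" using k that by linarith
    then show ?thesis using pos by (simp add: bump_def field_simps)
  qed
  then have "eventually (\<lambda>m. bump C m x = indicator C x) sequentially"
    using False by (auto simp: eventually_sequentially)
  then show ?thesis by (rule tendsto_eventually)
qed

text \<open>
  Otherwise \<open>\<rho>\<close> would be invariant under \<open>T p\<close> acting on the first coordinate alone, because the bumps
  determine the masses of closed sets and these determine the measure.
\<close>

lemma correlation_separates:
  assumes erg: "ergodic_map \<mu> (T p)" and ne: "\<rho> \<noteq> \<mu> \<Otimes>\<^sub>M \<nu>"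
  shows "\<exists>C m B. B \<in> sets \<nu> \<and> correlation (bump C m) B p \<noteq> correlation (bump C m) B 0"
proof (rule ccontr)
  assume "\<not> ?thesis"
  then have eq: "correlation (bump C m) B p = correlation (bump C m) B 0" if "B \<in> sets \<nu>" for C m B
    using that by blast
  have "\<rho> = \<mu> \<Otimes>\<^sub>M \<nu>"
  proof (rule product_if_invariant[OF erg])
    fix A B assume A: "A \<in> sets \<mu>" and B[measurable]: "B \<in> sets \<nu>"
    define D where "D = density \<rho> (indicator {z\<in>space \<rho>. snd z \<in> B})"
    have [measurable_cong]: "sets D = sets \<rho>" unfolding D_def by simp
    define m where "m s = distr D \<mu> (\<lambda>z. T s (fst z))" for s
    have em: "emeasure (m s) A = ennreal (rho.prob {z\<in>space \<rho>. T s (fst z) \<in> A \<and> snd z \<in> B})"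
      if [measurable]: "A \<in> sets \<mu>" for s A
    proof -
      have sp: "space D = space \<rho>" by (simp add: D_def)
      have "emeasure (m s) A = emeasure D {z\<in>space \<rho>. T s (fst z) \<in> A}"
        unfolding m_def by (subst emeasure_distr) (auto simp: sp vimage_def Int_def conj_commute)
      also have "\<dots> = (\<integral>\<^sup>+z. indicator {z\<in>space \<rho>. snd z \<in> B} z * indicator {z\<in>space \<rho>. T s (fst z) \<in> A} z \<partial>\<rho>)"
        unfolding D_def by (subst emeasure_density) auto
      also have "\<dots> = (\<integral>\<^sup>+z. indicator {z\<in>space \<rho>. T s (fst z) \<in> A \<and> snd z \<in> B} z \<partial>\<rho>)"
        by (rule nn_integral_cong) (auto simp: indicator_def)
      also have "\<dots> = emeasure \<rho> {z\<in>space \<rho>. T s (fst z) \<in> A \<and> snd z \<in> B}"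
        by (rule nn_integral_indicator) measurable
      finally show ?thesis by (simp add: rho.emeasure_eq_measure)
    qed
    have closed_eq: "emeasure (m p) C = emeasure (m 0) C" if C: "closed C" for C
    proof (cases "C = {}")
      case False
      have [measurable]: "C \<in> sets \<mu>" using C by (simp add: sets_mu)
      have lim: "(\<lambda>m. correlation (bump C m) B s) \<longlonglongrightarrow> rho.prob {z\<in>space \<rho>. T s (fst z) \<in> C \<and> snd z \<in> B}" for s
      proof -
        have "(\<lambda>m. correlation (bump C m) B s) \<longlonglongrightarrow> (\<integral>z. indicator {z\<in>space \<rho>. T s (fst z) \<in> C \<and> snd z \<in> B} z \<partial>\<rho>)"
          unfolding correlation_def
        proof (rule integral_dominated_convergence[where w="\<lambda>_. 1"])
          show "AE z in \<rho>. (\<lambda>m. observable (bump C m) B s z) \<longlonglongrightarrow> indicator {z\<in>space \<rho>. T s (fst z) \<in> C \<and> snd z \<in> B} z"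
          proof (intro AE_I2)
            fix z assume z: "z \<in> space \<rho>"
            have "(\<lambda>m. observable (bump C m) B s z) \<longlonglongrightarrow> indicator C (T s (fst z)) * indicator B (snd z)"
              unfolding observable_def by (intro tendsto_intros bump_tendsto_indicator C False)
            moreover have "indicator C (T s (fst z)) * indicator B (snd z) = (indicator {z\<in>space \<rho>. T s (fst z) \<in> C \<and> snd z \<in> B} z :: real)"
              using z by (auto simp: indicator_def)
            ultimately show "(\<lambda>m. observable (bump C m) B s z) \<longlonglongrightarrow> indicator {z\<in>space \<rho>. T s (fst z) \<in> C \<and> snd z \<in> B} z" by simp
          qed
          show "observable (bump C m) B s \<in> borel_measurable \<rho>" for m
            by (rule observable_measurable[OF test_function_bump B])
          show "AE z in \<rho>. norm (observable (bump C m) B s z) \<le> 1" for m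
            using observable_range[OF test_function_bump, of C m B s] by auto
        qed auto
        then show ?thesis by simp
      qed
      have "rho.prob {z\<in>space \<rho>. T p (fst z) \<in> C \<and> snd z \<in> B} = rho.prob {z\<in>space \<rho>. T 0 (fst z) \<in> C \<and> snd z \<in> B}"
        using LIMSEQ_unique[OF lim[of p]] lim[of 0] unfolding eq[OF B] by blast
      then show ?thesis by (simp add: em)
    qed simp
    have "m p = m 0"
    proof (rule measure_eqI_generator_eq[where E="Collect closed" and \<Omega>=UNIV and A="\<lambda>_. UNIV"])
      show "Int_stable (Collect closed :: 'a set set)" by (auto simp: Int_stable_def)
      have "sets \<mu> = sigma_sets UNIV (Collect closed)" unfolding sets_mu borel_eq_closed by simp
      then show "sets (m p) = sigma_sets UNIV (Collect closed)" "sets (m 0) = sigma_sets UNIV (Collect closed)"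
        by (simp_all add: m_def)
      show "emeasure (m p) UNIV \<noteq> \<infinity>" for i :: nat
        using em[of UNIV p] sets.top[of \<mu>] by simp
    qed (use closed_eq in auto)
    then have "ennreal (rho.prob {z\<in>space \<rho>. T p (fst z) \<in> A \<and> snd z \<in> B}) = ennreal (rho.prob {z\<in>space \<rho>. T 0 (fst z) \<in> A \<and> snd z \<in> B})"
      unfolding em[OF A, symmetric] by simp
    then show "rho.prob {z\<in>space \<rho>. T p (fst z) \<in> A \<and> snd z \<in> B} = rho.prob {z\<in>space \<rho>. fst z \<in> A \<and> snd z \<in> B}"
      by simp
  qed
  with ne show False by simp
qed

end

section \<open>Uniform convergence of correlations\<close>

text \<open>
  As \<open>T 0\<close> is the identity, the uniform bound on short time differences bounds the displacement from
  the starting point.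
\<close>

lemma almost_continuousE:
  fixes \<mu> :: "'a::metric_space measure"
  assumes ac: "almost_continuous_flow \<mu> T" and T0: "\<And>x. T 0 x = x" and e: "e > 0"
  obtains X where "X \<in> sets \<mu>" "measure \<mu> X > 1 - e"
    "\<And>e'. e' > 0 \<Longrightarrow> \<exists>d>0. \<forall>x\<in>X. \<forall>t. \<bar>t\<bar> \<le> d \<longrightarrow> dist (T t x) x < e'"
proof -
  obtain X where X: "X \<in> sets \<mu>" "measure \<mu> X > 1 - e"
    and c: "\<And>e'. e' > 0 \<Longrightarrow> \<exists>d>0. \<forall>x\<in>X. \<forall>t\<in>{-d..d}. \<forall>t'\<in>{-d..d}. dist (T t x) (T t' x) < e'"
    using ac e unfolding almost_continuous_flow_def by blast
  show thesis
  proof (rule that[OF X])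
    fix e' :: real assume "e' > 0"
    then obtain d where d: "d > 0" "\<forall>x\<in>X. \<forall>t\<in>{-d..d}. \<forall>t'\<in>{-d..d}. dist (T t x) (T t' x) < e'"
      using c by blast
    have "dist (T t x) x < e'" if "x \<in> X" "\<bar>t\<bar> \<le> d" for x t
    proof -
      have "dist (T t x) (T 0 x) < e'" using d that by (intro bspec[OF bspec[OF bspec[OF d(2)]]]) auto
      then show ?thesis by (simp add: T0)
    qed
    then show "\<exists>d>0. \<forall>x\<in>X. \<forall>t. \<bar>t\<bar> \<le> d \<longrightarrow> dist (T t x) x < e'" using d(1) by blast
  qed
qed

text \<open>
  Two trajectories whose observables nearly agree on most of a long block, both having nearly
  converged averages, must have nearly equal limits.
\<close>

lemma block_comparison:
  fixes a b :: "nat \<Rightarrow> real"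
  assumes a01: "\<And>n. 0 \<le> a n \<and> a n \<le> 1" and b01: "\<And>n. 0 \<le> b n \<and> b n \<le> 1"
    and a: "\<And>n. n \<ge> N \<Longrightarrow> \<bar>(\<Sum>j<n. a j) - real n * \<alpha>\<bar> \<le> real n * h"
    and b: "\<And>n. n \<ge> N \<Longrightarrow> \<bar>(\<Sum>j<n. b j) - real n * \<beta>\<bar> \<le> real n * h"
    and M: "M \<ge> N" and L: "L > 0" and k0: "k \<ge> 0"
    and freq: "real (card {n\<in>{M..M + L}. P n}) / real L > 1 - e"
    and P: "\<And>n. P n \<Longrightarrow> \<bar>a n - b n\<bar> \<le> k"
  shows "(real L + 1) * \<bar>\<alpha> - \<beta>\<bar> \<le> 2 * (2 * real M + real L + 1) * h + (real L + 1) * k + e * real L + 1"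
proof -
  \<comment> \<open>The block has \<open>L + 1\<close> terms, while frequencies are counted relative to \<open>L\<close>.\<close>
  have blk: "(\<Sum>j<M + L + 1. c j) = (\<Sum>j<M. c j) + (\<Sum>j\<in>{M..M + L}. c j)" for c :: "nat \<Rightarrow> real"
  proof -
    have "{..<M + L + 1} = {..<M} \<union> {M..M + L}" "{..<M} \<inter> {M..M + L} = {}" by auto
    then show ?thesis by (metis finite_lessThan finite_atLeastAtMost sum.union_disjoint)
  qed
  have sa: "\<bar>(\<Sum>j\<in>{M..M + L}. a j) - (real L + 1) * \<alpha>\<bar> \<le> (2 * real M + real L + 1) * h"
    using a[of M] a[of "M + L + 1"] M blk[of a] by (simp add: algebra_simps)
  have sb: "\<bar>(\<Sum>j\<in>{M..M + L}. b j) - (real L + 1) * \<beta>\<bar> \<le> (2 * real M + real L + 1) * h"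
    using b[of M] b[of "M + L + 1"] M blk[of b] by (simp add: algebra_simps)
  define G where "G = {n\<in>{M..M + L}. P n}"
  have G: "G \<subseteq> {M..M + L}" unfolding G_def by auto
  have "\<bar>(\<Sum>j\<in>{M..M + L}. a j) - (\<Sum>j\<in>{M..M + L}. b j)\<bar> \<le> (\<Sum>j\<in>{M..M + L}. \<bar>a j - b j\<bar>)"
    unfolding sum_subtractf[symmetric] by (rule sum_abs)
  also have "\<dots> = (\<Sum>j\<in>{M..M + L} - G. \<bar>a j - b j\<bar>) + (\<Sum>j\<in>G. \<bar>a j - b j\<bar>)"
    by (rule sum.subset_diff[OF G]) simp
  also have "(\<Sum>j\<in>G. \<bar>a j - b j\<bar>) \<le> real (card G) * k"
    by (rule sum_bounded_above) (auto simp: G_def P)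
  also have "\<dots> \<le> (real L + 1) * k"
    using card_mono[OF _ G] k0 by (intro mult_right_mono) auto
  also have "(\<Sum>j\<in>{M..M + L} - G. \<bar>a j - b j\<bar>) \<le> real (card ({M..M + L} - G)) * 1"
  proof (rule sum_bounded_above)
    fix j show "\<bar>a j - b j\<bar> \<le> 1" using a01[of j] b01[of j] by linarith
  qed
  also have "real (card ({M..M + L} - G)) = real L + 1 - real (card G)"
    using card_Diff_subset[OF finite_subset[OF G] G] card_mono[OF _ G] by simp
  also have "\<dots> \<le> e * real L + 1"
  proof -
    have "(1 - e) * real L < real (card G)" using freq L unfolding G_def by (simp add: field_simps)
    then show ?thesis by (simp add: algebra_simps)
  qed
  finally have ab: "\<bar>(\<Sum>j\<in>{M..M + L}. a j) - (\<Sum>j\<in>{M..M + L}. b j)\<bar> \<le> e * real L + 1 + (real L + 1) * k"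
    by simp
  have "(real L + 1) * \<bar>\<alpha> - \<beta>\<bar> = \<bar>(real L + 1) * \<alpha> - (real L + 1) * \<beta>\<bar>"
    unfolding right_diff_distrib[symmetric] abs_mult by simp
  then show ?thesis using sa sb ab unfolding abs_le_iff by linarith
qed

context flow_joining
begin

lemma observable_diff_le:
  assumes f: "test_function K f"
    and X: "\<And>x t. x \<in> X \<Longrightarrow> \<bar>t\<bar> \<le> d \<Longrightarrow> dist (T t x) x < e"
    and s: "\<bar>s - q\<bar> \<le> d" and e: "e > 0"
  shows "\<bar>observable f B s z - observable f B q z\<bar> \<le> K * e + indicator (- X) (T q (fst z))"
proof -
  have r: "0 \<le> observable f B s z \<and> observable f B s z \<le> 1" "0 \<le> observable f B q z \<and> observable f B q z \<le> 1"
    using observable_range[OF f] by auto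
  have K: "K \<ge> 0" using f by (simp add: test_function_def)
  have T: "T s (fst z) = T (s - q) (T q (fst z))" using T_add[of "s - q" q] by simp
  show ?thesis
  proof (cases "T q (fst z) \<in> X")
    case True
    have d: "dist (T s (fst z)) (T q (fst z)) < e" using X[OF True s] by (simp add: T)
    have "\<bar>observable f B s z - observable f B q z\<bar> \<le> \<bar>f (T s (fst z)) - f (T q (fst z))\<bar>"
      by (auto simp: observable_def indicator_def)
    also have "\<dots> \<le> K * dist (T s (fst z)) (T q (fst z))" using f by (simp add: test_function_def)
    also have "\<dots> \<le> K * e" using d K by (intro mult_left_mono) auto
    finally show ?thesis using True by simp
  next
    case False
    have "0 \<le> K * e" using K e by simp
    then show ?thesis using r False by (auto simp: indicator_def)
  qed
qed


lemma exceptional_integral: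
  assumes X[measurable]: "X \<in> sets \<mu>" and e: "mu.prob X > 1 - e"
  shows "integrable \<rho> (\<lambda>z. indicat_real (- X) (T q (fst z)))"
    and "(\<integral>z. indicat_real (- X) (T q (fst z)) \<partial>\<rho>) \<le> e"
proof -
  have Xc[measurable]: "- X \<in> sets \<mu>" using sets.compl_sets[OF X] by (simp add: Compl_eq_Diff_UNIV)
  show "integrable \<rho> (\<lambda>z. indicat_real (- X) (T q (fst z)))"
    by (rule rho.integrable_const_bound[of _ 1]) (auto simp: indicator_def)
  have "(\<integral>z. indicat_real (- X) (T q (fst z)) \<partial>\<rho>) = (\<integral>x. indicat_real (- X) (T q x) \<partial>distr \<rho> \<mu> fst)"
    by (rule integral_distr[symmetric]) measurable
  also have "\<dots> = (\<integral>x. indicat_real (- X) (T q x) \<partial>\<mu>)" by (simp add: distr_fst)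
  also have "\<dots> = (\<integral>x. indicat_real (- X) x \<partial>distr \<mu> \<mu> (T q))"
    by (rule integral_distr[symmetric]) measurable
  also have "\<dots> = mu.prob (- X)" by (simp add: mu.flow_distr)
  also have "\<dots> = 1 - mu.prob X" using mu.prob_compl[OF X] by (simp add: Compl_eq_Diff_UNIV)
  finally show "(\<integral>z. indicat_real (- X) (T q (fst z)) \<partial>\<rho>) \<le> e" using e by simp
qed

lemma correlation_diff_le:
  assumes f: "test_function K f" and B: "B \<in> sets \<nu>" and Xs: "X \<in> sets \<mu>" "mu.prob X > 1 - c"
    and X: "\<And>x t. x \<in> X \<Longrightarrow> \<bar>t\<bar> \<le> d \<Longrightarrow> dist (T t x) x < e"
    and s: "\<bar>s - q\<bar> \<le> d" and e: "e > 0"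
  shows "\<bar>correlation f B s - correlation f B q\<bar> \<le> K * e + c"
proof -
  note int = observable_integrable[OF f B]
  have "\<bar>correlation f B s - correlation f B q\<bar> = \<bar>\<integral>z. observable f B s z - observable f B q z \<partial>\<rho>\<bar>"
    unfolding correlation_def using int by simp
  also have "\<dots> \<le> (\<integral>z. \<bar>observable f B s z - observable f B q z\<bar> \<partial>\<rho>)" by (rule integral_abs_bound)
  also have "\<dots> \<le> (\<integral>z. K * e + indicator (- X) (T q (fst z)) \<partial>\<rho>)"
    by (rule integral_mono)
       (use int exceptional_integral(1)[OF Xs] observable_diff_le[OF f X s e] in auto)
  also have "\<dots> = K * e + (\<integral>z. indicator (- X) (T q (fst z)) \<partial>\<rho>)"
    using exceptional_integral(1)[OF Xs] by (simp add: rho.prob_space)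
  also have "\<dots> \<le> K * e + c" using exceptional_integral(2)[OF Xs] by simp
  finally show ?thesis .
qed

lemma correlation_continuous:
  assumes ac: "almost_continuous_flow \<mu> T" and f: "test_function K f" and B: "B \<in> sets \<nu>"
  shows "continuous_on UNIV (correlation f B)"
  unfolding continuous_on_iff
proof (intro ballI allI impI)
  fix q e :: real assume e: "e > 0"
  have K: "K \<ge> 0" using f by (simp add: test_function_def)
  obtain X where X: "X \<in> sets \<mu>" "mu.prob X > 1 - e / 4"
    and c: "\<And>e'. e' > 0 \<Longrightarrow> \<exists>d>0. \<forall>x\<in>X. \<forall>t. \<bar>t\<bar> \<le> d \<longrightarrow> dist (T t x) x < e'"
    using almost_continuousE[OF ac T_0, of "e / 4"] e by auto
  define e' where "e' = e / (4 * (K + 1))"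
  have e': "e' > 0" using e K by (simp add: e'_def)
  have Ke: "K * e' \<le> e / 4" using e K by (simp add: e'_def field_simps)
  obtain d where d: "d > 0" "\<And>x t. x \<in> X \<Longrightarrow> \<bar>t\<bar> \<le> d \<Longrightarrow> dist (T t x) x < e'" using c[OF e'] by blast
  have "\<bar>correlation f B s - correlation f B q\<bar> < e" if s: "\<bar>s - q\<bar> \<le> d" for s
    using correlation_diff_le[OF f B X d(2) s e'] Ke e by linarith
  then show "\<exists>d>0. \<forall>s\<in>UNIV. dist s q < d \<longrightarrow> dist (correlation f B s) (correlation f B q) < e"
    using d(1) by (intro exI[of _ d]) (auto simp: dist_real_def)
qed

text \<open>
  Averages of the observables shifted by \<open>s\<close> converge uniformly in \<open>s\<close> over compact sets, up to small
  measure: by almost continuity finitely many shifts control all others, except while the orbit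
  visits a set of small measure, and the frequency of these visits is itself an ergodic average.
\<close>

lemma uniform_correlation_averages:
  assumes ac: "almost_continuous_flow \<mu> T" and erg: "ergodic_map \<rho> (prod_flow T S t0)"
    and J: "finite J" and f: "\<And>i. i \<in> J \<Longrightarrow> test_function K (f i)" and B: "\<And>i. i \<in> J \<Longrightarrow> B i \<in> sets \<nu>"
    and K: "K \<ge> 0" and P: "compact P" and h: "h > 0" and c: "c > 0"
  shows "\<exists>W\<in>sets \<rho>. rho.prob W > 1 - c \<and> (\<exists>N0. \<forall>z\<in>W. \<forall>n\<ge>N0. \<forall>i\<in>J. \<forall>s\<in>P.
           \<bar>orbit_sum (prod_flow T S t0) (observable (f i) (B i) s) n z - real n * correlation (f i) (B i) s\<bar> \<le> real n * h)"
proof -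
  define \<tau> where "\<tau> = prod_flow T S t0"
  define e where "e = h / 8"
  have e: "e > 0" using h by (simp add: e_def)
  obtain X where X: "X \<in> sets \<mu>" "mu.prob X > 1 - e"
    and cont: "\<And>e'. e' > 0 \<Longrightarrow> \<exists>d>0. \<forall>x\<in>X. \<forall>t. \<bar>t\<bar> \<le> d \<longrightarrow> dist (T t x) x < e'"
    using almost_continuousE[OF ac T_0 e] by auto
  define e' where "e' = h / (8 * (K + 1))"
  have e': "e' > 0" using h K by (simp add: e'_def)
  have Ke: "K * e' \<le> h / 8" using h K by (simp add: e'_def field_simps)
  obtain d where d: "d > 0" "\<And>x t. x \<in> X \<Longrightarrow> \<bar>t\<bar> \<le> d \<Longrightarrow> dist (T t x) x < e'" using cont[OF e'] by blast
  obtain Q where Q: "finite Q" "P \<subseteq> (\<Union>q\<in>Q. ball q d)"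
    by (rule compactE_image[OF P, of P "\<lambda>q. ball q d"]) (use d(1) in auto)
  define v where "v q z = (indicator (- X) (T q (fst z)) :: real)" for q and z :: "'a \<times> 'b"
  define F where "F = (\<lambda>(i, q). observable (f i) (B i) q) ` (J \<times> Q) \<union> v ` Q"
  have Xc[measurable]: "- X \<in> sets \<mu>" using sets.compl_sets[OF X(1)] by (simp add: Compl_eq_Diff_UNIV)
  have vm: "v q \<in> borel_measurable \<rho>" for q unfolding v_def by measurable
  have "\<exists>W\<in>sets \<rho>. rho.prob W > 1 - c \<and> (\<exists>N0. \<forall>z\<in>W. \<forall>n\<ge>N0. \<forall>g\<in>F.
           \<bar>orbit_sum \<tau> g n z - real n * (\<integral>z. g z \<partial>\<rho>)\<bar> \<le> real n * e)"
  proof (rule rho.uniform_orbit_averages[where C=1])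
    show "finite F" unfolding F_def using J Q(1) by auto
    show "g \<in> borel_measurable \<rho>" if "g \<in> F" for g
      using that observable_measurable[OF f B] vm unfolding F_def by auto
    show "\<bar>g z\<bar> \<le> 1" if g: "g \<in> F" for g z
    proof -
      from g consider i q where "i \<in> J" "g = observable (f i) (B i) q" | q where "g = v q"
        unfolding F_def by auto
      then show ?thesis
      proof cases
        case 1 then show ?thesis using observable_range[OF f[OF 1(1)], of "B i" q z] by auto
      next
        case 2 then show ?thesis by (auto simp: v_def indicator_def)
      qed
    qed
  qed (use erg e c in \<open>auto simp: \<tau>_def\<close>)
  then obtain W N0 where W: "W \<in> sets \<rho>" "rho.prob W > 1 - c"
    and conv: "\<And>z n g. z \<in> W \<Longrightarrow> n \<ge> N0 \<Longrightarrow> g \<in> F \<Longrightarrow> \<bar>orbit_sum \<tau> g n z - real n * (\<integral>z. g z \<partial>\<rho>)\<bar> \<le> real n * e"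
    by blast
  have "\<bar>orbit_sum \<tau> (observable (f i) (B i) s) n z - real n * correlation (f i) (B i) s\<bar> \<le> real n * h"
    if z: "z \<in> W" and n: "n \<ge> N0" and i: "i \<in> J" and s: "s \<in> P" for z n i s
  proof -
    obtain q where q: "q \<in> Q" "\<bar>s - q\<bar> \<le> d" using Q(2) s by (force simp: dist_real_def)
    let ?g = "observable (f i) (B i)"
    have 1: "\<bar>orbit_sum \<tau> (?g q) n z - real n * correlation (f i) (B i) q\<bar> \<le> real n * e"
      unfolding correlation_def by (rule conv[OF z n]) (use i q in \<open>auto simp: F_def\<close>)
    have "\<bar>orbit_sum \<tau> (v q) n z - real n * (\<integral>z. v q z \<partial>\<rho>)\<bar> \<le> real n * e"
      by (rule conv[OF z n]) (use q in \<open>auto simp: F_def\<close>)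
    moreover have "real n * (\<integral>z. v q z \<partial>\<rho>) \<le> real n * e"
      unfolding v_def by (intro mult_left_mono exceptional_integral(2)[OF X]) auto
    ultimately have 2: "orbit_sum \<tau> (v q) n z \<le> 2 * (real n * e)" by linarith
    have "\<bar>orbit_sum \<tau> (?g s) n z - orbit_sum \<tau> (?g q) n z\<bar> \<le> (\<Sum>j<n. \<bar>?g s ((\<tau> ^^ j) z) - ?g q ((\<tau> ^^ j) z)\<bar>)"
      unfolding orbit_sum_def sum_subtractf[symmetric] by (rule sum_abs)
    also have "\<dots> \<le> (\<Sum>j<n. K * e' + v q ((\<tau> ^^ j) z))"
      unfolding v_def by (intro sum_mono observable_diff_le[OF f[OF i] d(2) q(2) e'])
    also have "\<dots> = real n * (K * e') + orbit_sum \<tau> (v q) n z"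
      by (simp add: orbit_sum_def sum.distrib)
    finally have 3: "\<bar>orbit_sum \<tau> (?g s) n z - orbit_sum \<tau> (?g q) n z\<bar> \<le> real n * (K * e') + 2 * (real n * e)"
      using 2 by linarith
    have "real n * \<bar>correlation (f i) (B i) s - correlation (f i) (B i) q\<bar> \<le> real n * (K * e' + e)"
      by (intro mult_left_mono correlation_diff_le[OF f[OF i] B[OF i] X d(2) q(2) e']) auto
    then have 4: "\<bar>real n * correlation (f i) (B i) s - real n * correlation (f i) (B i) q\<bar> \<le> real n * (K * e') + real n * e"
      by (simp add: right_diff_distrib[symmetric] abs_mult distrib_left)
    have 5: "real n * (K * e') \<le> real n * h / 8" using mult_left_mono[OF Ke, of "real n"] by simp
    have 6: "real n * e = real n * h / 8" by (simp add: e_def)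
    have "real n * h \<ge> 0" using h by simp
    then show ?thesis using 1 3 4 5 6 by linarith
  qed
  then show ?thesis using W unfolding \<tau>_def by blast
qed

text \<open>
  The exceptional set does not depend on the shift \<open>s\<close>. This matters when two points of one orbit are
  compared, because the time between them is then not known in advance.
\<close>

lemma AE_correlation_averages:
  assumes ac: "almost_continuous_flow \<mu> T" and erg: "ergodic_map \<rho> (prod_flow T S t0)"
    and f: "test_function K f" and B: "B \<in> sets \<nu>"
  shows "AE z in \<rho>. \<forall>s. (\<lambda>n. orbit_sum (prod_flow T S t0) (observable f B s) n z / real n) \<longlonglongrightarrow> correlation f B s"
proof -
  have K: "K \<ge> 0" using f by (simp add: test_function_def)
  define Q where "Q r k z \<longleftrightarrow> eventually (\<lambda>n. \<forall>s\<in>{- real r..real r}. \<bar>orbit_sum (prod_flow T S t0) (observable f B s) n z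
      - real n * correlation f B s\<bar> \<le> real n * (inverse (real (Suc k)) / 2)) sequentially" for r k :: nat and z
  have Q: "AE z in \<rho>. Q r k z" for r k
  proof -
    have "\<exists>W\<in>sets \<rho>. rho.prob W > 1 - inverse (real (Suc l)) \<and> (\<forall>z\<in>W. Q r k z)" for l
    proof -
      have "inverse (real (Suc k)) / 2 > 0" "inverse (real (Suc l)) > 0" by auto
      from uniform_correlation_averages[OF ac erg, of "{()}" K "\<lambda>_. f" "\<lambda>_. B" "{- real r..real r}", OF _ f B K _ this]
      show ?thesis unfolding Q_def eventually_sequentially by (simp, metis)
    qed
    then obtain W where W: "\<And>l. W l \<in> sets \<rho>" "\<And>l. rho.prob (W l) > 1 - inverse (real (Suc l))"
      "\<And>l z. z \<in> W l \<Longrightarrow> Q r k z" by metis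
    have Wm: "(\<Union>l. W l) \<in> sets \<rho>" using W(1) by auto
    have "rho.prob (\<Union>l. W l) \<ge> 1 - inverse (real (Suc l))" for l
      using W(2)[of l] rho.finite_measure_mono[of "W l" "\<Union>l. W l"] Wm by fastforce
    then have "(\<lambda>l. 1 - inverse (real (Suc l))) \<longlonglongrightarrow> 1 - 0 \<and> (\<forall>l. 1 - inverse (real (Suc l)) \<le> rho.prob (\<Union>l. W l))"
      by (intro conjI tendsto_intros LIMSEQ_inverse_real_of_nat) auto
    then have "1 \<le> rho.prob (\<Union>l. W l)" by (auto intro: LIMSEQ_le_const2)
    then have "rho.prob (\<Union>l. W l) = 1" using rho.prob_le_1[of "\<Union>l. W l"] by linarith
    then have "AE z in \<rho>. z \<in> (\<Union>l. W l)" using rho.prob_eq_1[OF Wm] by simp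
    then show ?thesis by eventually_elim (use W(3) in blast)
  qed
  have "AE z in \<rho>. \<forall>r k. Q r k z" unfolding AE_all_countable using Q by blast
  then show ?thesis
  proof eventually_elim
    case (elim z)
    show ?case
    proof (intro allI tendsto_averageI)
      fix s k
      obtain r :: nat where r: "real r \<ge> \<bar>s\<bar>" using real_arch_simple by blast
      from elim have "Q r k z" by simp
      then show "eventually (\<lambda>n. \<bar>orbit_sum (prod_flow T S t0) (observable f B s) n z - real n * correlation f B s\<bar>
          < real n * inverse (real (Suc k))) sequentially"
        unfolding Q_def using eventually_gt_at_top[of "0::nat"]
      proof eventually_elim
        case (elim n)
        have "s \<in> {- real r..real r}" using r by auto
        with elim(1) have "\<bar>orbit_sum (prod_flow T S t0) (observable f B s) n z - real n * correlation f B s\<bar> \<le> real n * (inverse (real (Suc k)) / 2)"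
          by blast
        also have "\<dots> < real n * inverse (real (Suc k))" using elim(2) by (intro mult_strict_left_mono) auto
        finally show ?case .
      qed
    qed
  qed
qed

end

section \<open>Separation of the fibres\<close>

context flow_joining
begin

lemma prod_flow_funpow:
  assumes "z \<in> space \<rho>"
  shows "(prod_flow T S t ^^ n) z = prod_flow T S (real n * t) z"
proof (induction n)
  case 0 then show ?case using rho.flow_0[OF assms] by simp
next
  case (Suc n)
  have "real (Suc n) * t = t + real n * t" by (simp add: algebra_simps)
  then show ?case using Suc rho.flow_add[OF assms, of t "real n * t"] by simp
qed

lemma orbit_sum_observable:
  assumes "(x, y) \<in> space \<rho>"
  shows "orbit_sum (prod_flow T S t) (observable f B s) n (x, y)
    = (\<Sum>j<n. f (T (real j * t + s) x) * indicator B (S (real j * t) y))"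
  unfolding orbit_sum_def
proof (rule sum.cong[OF refl])
  fix j
  have "T (real j * t + s) x = T s (T (real j * t) x)" by (simp add: T_add[symmetric] add.commute)
  then show "observable f B s ((prod_flow T S t ^^ j) (x, y)) = f (T (real j * t + s) x) * indicator B (S (real j * t) y)"
    unfolding prod_flow_funpow[OF assms] by (simp add: observable_def prod_flow_def)
qed

text \<open>
  For a joining other than the product every nonzero shift is detected by some correlation, and by
  continuity the same correlation detects the neighbouring shifts. The line without zero is covered by
  countably many of these neighbourhoods.
\<close>

lemma countable_separating_family:
  assumes ac: "almost_continuous_flow \<mu> T" and ne: "\<rho> \<noteq> \<mu> \<Otimes>\<^sub>M \<nu>"
    and erg: "\<And>p. p \<noteq> 0 \<Longrightarrow> ergodic_map \<mu> (T p)"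
  obtains Q :: "real set" and m :: "real \<Rightarrow> nat" and f :: "real \<Rightarrow> 'a \<Rightarrow> real"
    and B :: "real \<Rightarrow> 'b set" and g :: "real \<Rightarrow> real"
  where "countable Q" "\<forall>q\<in>Q. test_function (real (m q)) (f q)" "\<forall>q\<in>Q. B q \<in> sets \<nu>"
    "\<forall>q\<in>Q. g q > 0"
    "\<forall>q\<in>Q. open {s. \<bar>correlation (f q) (B q) s - correlation (f q) (B q) 0\<bar> > g q}"
    "UNIV - {0} \<subseteq> (\<Union>q\<in>Q. {s. \<bar>correlation (f q) (B q) s - correlation (f q) (B q) 0\<bar> > g q})"
proof -
  have ex: "\<forall>p\<in>UNIV - {0::real}. \<exists>w. snd (snd w) \<in> sets \<nu> \<and>
      correlation (bump (fst w) (fst (snd w))) (snd (snd w)) p \<noteq> correlation (bump (fst w) (fst (snd w))) (snd (snd w)) 0"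
  proof
    fix p :: real assume "p \<in> UNIV - {0}"
    then obtain C m B where "B \<in> sets \<nu>" "correlation (bump C m) B p \<noteq> correlation (bump C m) B 0"
      using correlation_separates[OF erg ne, of p] by auto
    then show "\<exists>w. snd (snd w) \<in> sets \<nu> \<and>
      correlation (bump (fst w) (fst (snd w))) (snd (snd w)) p \<noteq> correlation (bump (fst w) (fst (snd w))) (snd (snd w)) 0"
      by (intro exI[of _ "(C, m, B)"]) simp
  qed
  obtain w where w: "\<forall>p\<in>UNIV - {0::real}. snd (snd (w p)) \<in> sets \<nu> \<and>
      correlation (bump (fst (w p)) (fst (snd (w p)))) (snd (snd (w p))) p \<noteq> correlation (bump (fst (w p)) (fst (snd (w p)))) (snd (snd (w p))) 0"
    using bchoice[OF ex] by (elim exE)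
  define f where "f p = bump (fst (w p)) (fst (snd (w p)))" for p
  define m where "m p = fst (snd (w p))" for p
  define B where "B p = snd (snd (w p))" for p
  define g where "g p = \<bar>correlation (f p) (B p) p - correlation (f p) (B p) 0\<bar> / 2" for p
  define V where "V p = {s. \<bar>correlation (f p) (B p) s - correlation (f p) (B p) 0\<bar> > g p}" for p
  have B: "B p \<in> sets \<nu>" and sep: "correlation (f p) (B p) p \<noteq> correlation (f p) (B p) 0" if "p \<noteq> 0" for p
    using w that unfolding B_def f_def by simp_all
  have tf: "test_function (real (m p)) (f p)" for p
    unfolding f_def m_def by (rule test_function_bump)
  have g: "g p > 0" if "p \<noteq> 0" for p using sep[OF that] by (simp add: g_def)
  have inV: "p \<in> V p" if "p \<noteq> 0" for p using sep[OF that] by (simp add: V_def g_def)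
  have openV: "open (V p)" if p: "p \<noteq> 0" for p
  proof -
    have "continuous_on UNIV (\<lambda>s. \<bar>correlation (f p) (B p) s - correlation (f p) (B p) 0\<bar>)"
      by (intro continuous_intros correlation_continuous[OF ac tf B[OF p]])
    then show ?thesis unfolding V_def by (intro open_Collect_less) auto
  qed
  obtain \<F> where F: "\<F> \<subseteq> V ` (UNIV - {0})" "countable \<F>" "\<Union>\<F> = \<Union>(V ` (UNIV - {0}))"
    using Lindelof[of "V ` (UNIV - {0})"] openV by auto
  have "countable \<F> \<and> \<F> \<subseteq> V ` (UNIV - {0})" using F by simp
  then obtain Q where Q: "countable Q" "Q \<subseteq> UNIV - {0}" "\<F> = V ` Q"
    unfolding countable_subset_image by blast
  have "UNIV - {0} \<subseteq> (\<Union>q\<in>Q. {s. \<bar>correlation (f q) (B q) s - correlation (f q) (B q) 0\<bar> > g q})"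
    using F(3) Q(3) inV unfolding V_def[symmetric] by auto
  moreover have "\<forall>q\<in>Q. open {s. \<bar>correlation (f q) (B q) s - correlation (f q) (B q) 0\<bar> > g q}"
    using openV Q(2) unfolding V_def by blast
  moreover have "\<forall>q\<in>Q. test_function (real (m q)) (f q)" "\<forall>q\<in>Q. B q \<in> sets \<nu>" "\<forall>q\<in>Q. g q > 0"
    using tf B g Q(2) by blast+
  ultimately show thesis using that[of Q m f B g] Q(1) by blast
qed

text \<open>
  The contradiction at the heart of the argument. Two generic points over the same \<open>y\<close>, shadowing each
  other up to the shift \<open>p\<close> along a block of length proportional to its starting time, would give the
  same limit for an observable and for its shift by \<open>p\<close>.
\<close>

lemma block_shift_contradiction:
  assumes tf: "test_function K f"
    and z: "(x, y) \<in> space \<rho>" and z': "(x', y) \<in> space \<rho>"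
    and c1: "\<And>n. n \<ge> N0 \<Longrightarrow> \<bar>orbit_sum (prod_flow T S t) (observable f B 0) n (x, y) - real n * correlation f B 0\<bar> \<le> real n * h"
    and c2: "\<And>n. n \<ge> N0 \<Longrightarrow> \<bar>orbit_sum (prod_flow T S t) (observable f B p) n (x', y) - real n * correlation f B p\<bar> \<le> real n * h"
    and gap: "\<bar>correlation f B p - correlation f B 0\<bar> \<ge> \<eta>"
    and M: "M > N0" and L: "real L > 4 / \<eta>" "real L / real M \<ge> \<kappa>"
    and freq: "real (card {n\<in>{M..M + L}. dist (T (real n * t) x) (T (real n * t + p) x') < e}) / real L > 1 - e"
    and \<eta>: "\<eta> > 0" and \<kappa>: "\<kappa> > 0" and e: "e > 0" "(K + 1) * e \<le> \<eta> / 4" and h: "h = \<eta> * \<kappa> / (8 * (2 + \<kappa>))"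
  shows False
proof -
  have K: "K \<ge> 0" using tf by (simp add: test_function_def)
  have L0: "L > 0" using L(1) \<eta> by (metis divide_pos_pos less_trans of_nat_0_less_iff zero_less_numeral)
  have M0: "real M > 0" using M by simp
  define a where "a j = f (T (real j * t) x) * indicator B (S (real j * t) y)" for j
  define b where "b j = f (T (real j * t + p) x') * indicator B (S (real j * t) y)" for j
  have "(real L + 1) * \<bar>correlation f B 0 - correlation f B p\<bar>
      \<le> 2 * (2 * real M + real L + 1) * h + (real L + 1) * (K * e) + e * real L + 1"
  proof (rule block_comparison[where a=a and b=b and N=N0 and P="\<lambda>n. dist (T (real n * t) x) (T (real n * t + p) x') < e"])
    show "0 \<le> a n \<and> a n \<le> 1" "0 \<le> b n \<and> b n \<le> 1" for n
      using tf by (auto simp: a_def b_def test_function_def indicator_def)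
    show "\<bar>(\<Sum>j<n. a j) - real n * correlation f B 0\<bar> \<le> real n * h" if "n \<ge> N0" for n
      using c1[OF that] by (simp add: orbit_sum_observable[OF z] a_def)
    show "\<bar>(\<Sum>j<n. b j) - real n * correlation f B p\<bar> \<le> real n * h" if "n \<ge> N0" for n
      using c2[OF that] by (simp add: orbit_sum_observable[OF z'] b_def)
    show "\<bar>a n - b n\<bar> \<le> K * e" if d: "dist (T (real n * t) x) (T (real n * t + p) x') < e" for n
    proof -
      have "\<bar>a n - b n\<bar> \<le> \<bar>f (T (real n * t) x) - f (T (real n * t + p) x')\<bar>"
        by (auto simp: a_def b_def indicator_def)
      also have "\<dots> \<le> K * dist (T (real n * t) x) (T (real n * t + p) x')"
        using tf by (simp add: test_function_def)
      also have "\<dots> \<le> K * e" using d K by (intro mult_left_mono) auto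
      finally show ?thesis .
    qed
    show "0 \<le> K * e" using K e by simp
  qed (use M L0 freq in auto)
  moreover have "(real L + 1) * \<eta> \<le> (real L + 1) * \<bar>correlation f B 0 - correlation f B p\<bar>"
    using gap by (intro mult_left_mono) (auto simp: abs_minus_commute)
  ultimately have main: "(real L + 1) * \<eta> \<le> 2 * (2 * real M + real L + 1) * h + (real L + 1) * (K * e) + e * real L + 1"
    by linarith
  \<comment> \<open>Each of the three error terms is at most a quarter of the total gap: the accuracy of the averages up
    to time \<open>M + L + 1\<close>, since \<open>M \<le> L / \<kappa>\<close>; the tolerance and the bad times of the block; the end point.\<close>
  have h0: "h > 0" using \<eta> \<kappa> by (simp add: h)
  have blk: "real M \<le> real L / \<kappa>" using L(2) M0 \<kappa> by (simp add: field_simps)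
  have "2 * (2 * real M + real L + 1) * h \<le> 2 * (2 * ((real L + 1) / \<kappa>) + (real L + 1)) * h"
  proof (intro mult_right_mono mult_left_mono)
    have "real L / \<kappa> \<le> (real L + 1) / \<kappa>" using \<kappa> by (simp add: divide_right_mono)
    then show "2 * real M + real L + 1 \<le> 2 * ((real L + 1) / \<kappa>) + (real L + 1)" using blk by linarith
  qed (use h0 in auto)
  also have "\<dots> = (real L + 1) * (\<eta> / 4)"
  proof -
    define w where "w = 2 + \<kappa>"
    have w: "w > 0" using \<kappa> by (simp add: w_def)
    have wh: "(w / \<kappa>) * h = \<eta> / 8" using \<kappa> w unfolding h w_def[symmetric] by (simp add: field_simps)
    have "2 * (2 * ((real L + 1) / \<kappa>) + (real L + 1)) = 2 * (real L + 1) * (w / \<kappa>)"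
      using \<kappa> by (simp add: w_def field_simps)
    then have "2 * (2 * ((real L + 1) / \<kappa>) + (real L + 1)) * h = 2 * (real L + 1) * ((w / \<kappa>) * h)"
      by (simp only: mult.assoc)
    then show ?thesis unfolding wh by (rule trans) simp
  qed
  finally have 1: "2 * (2 * real M + real L + 1) * h \<le> (real L + 1) * (\<eta> / 4)" .
  have "(real L + 1) * (K * e) + e * real L \<le> (real L + 1) * ((K + 1) * e)"
    using e by (simp add: algebra_simps)
  also have "\<dots> \<le> (real L + 1) * (\<eta> / 4)" by (intro mult_left_mono e) auto
  finally have 2: "(real L + 1) * (K * e) + e * real L \<le> (real L + 1) * (\<eta> / 4)" .
  have "4 / \<eta> < real L + 1" using L(1) by linarith
  then have 3: "1 < (real L + 1) * (\<eta> / 4)" using \<eta> by (simp add: field_simps)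
  define Y where "Y = (real L + 1) * \<eta>"
  have "(real L + 1) * (\<eta> / 4) = Y / 4" by (simp add: Y_def)
  moreover have "Y > 0" unfolding Y_def using \<eta> by (intro mult_pos_pos) auto
  ultimately show False using main 1 2 3 unfolding Y_def[symmetric] by linarith
qed

text \<open>
  Take two nearby points in one fibre, outside a set of small measure. If they lie on different orbits,
  the switchable property makes them shadow each other with a shift \<open>p\<close> in the compact set \<open>P\<close>, in one
  of the two time directions, and the previous lemma applies. If one is the image of the other under
  \<open>T s\<close>, then genericity of both for the observable that detects \<open>s\<close> forces \<open>s = 0\<close>.
\<close>

lemma separated_fibres:
  assumes ac: "almost_continuous_flow \<mu> T" and ne: "\<rho> \<noteq> \<mu> \<Otimes>\<^sub>M \<nu>"
    and erg: "\<And>p. p \<noteq> 0 \<Longrightarrow> ergodic_map \<mu> (T p)"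
    and ergt: "ergodic_map \<rho> (prod_flow T S t0)"
    and sw: "switchable_R \<mu> T t0 P" and P: "compact P" "P \<subseteq> UNIV - {0}"
  obtains E d where "E \<in> sets \<rho>" "rho.prob E > 0" "d > 0"
    "\<And>x x' y. (x, y) \<in> E \<Longrightarrow> (x', y) \<in> E \<Longrightarrow> dist x x' < d \<Longrightarrow> x = x'"
proof -
  obtain Q :: "real set" and m :: "real \<Rightarrow> nat" and f :: "real \<Rightarrow> 'a \<Rightarrow> real"
      and B :: "real \<Rightarrow> 'b set" and g :: "real \<Rightarrow> real"
    where Q: "countable Q" and "\<forall>q\<in>Q. test_function (real (m q)) (f q)"
    and "\<forall>q\<in>Q. B q \<in> sets \<nu>" and "\<forall>q\<in>Q. g q > 0"
    and "\<forall>q\<in>Q. open {s. \<bar>correlation (f q) (B q) s - correlation (f q) (B q) 0\<bar> > g q}"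
    and cover: "UNIV - {0} \<subseteq> (\<Union>q\<in>Q. {s. \<bar>correlation (f q) (B q) s - correlation (f q) (B q) 0\<bar> > g q})"
    by (rule countable_separating_family[OF ac ne erg])
  then have tf: "\<And>q. q \<in> Q \<Longrightarrow> test_function (real (m q)) (f q)"
    and B: "\<And>q. q \<in> Q \<Longrightarrow> B q \<in> sets \<nu>" and g: "\<And>q. q \<in> Q \<Longrightarrow> g q > 0"
    and op: "\<And>q. q \<in> Q \<Longrightarrow> open {s. \<bar>correlation (f q) (B q) s - correlation (f q) (B q) 0\<bar> > g q}"
    by simp_all
  have PQ: "P \<subseteq> (\<Union>q\<in>Q. {s. \<bar>correlation (f q) (B q) s - correlation (f q) (B q) 0\<bar> > g q})"
    using P(2) cover by (rule subset_trans)
  obtain J where J: "J \<subseteq> Q" "finite J"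
    and PJ: "P \<subseteq> (\<Union>q\<in>J. {s. \<bar>correlation (f q) (B q) s - correlation (f q) (B q) 0\<bar> > g q})"
    by (rule compactE_image[OF P(1) op PQ])
  \<comment> \<open>The least gap over the finitely many observables needed for \<open>P\<close>; the entry \<open>1\<close> covers an empty \<open>P\<close>.\<close>
  define \<eta> where "\<eta> = Min (insert 1 (g ` J))"
  have \<eta>: "\<eta> > 0" unfolding \<eta>_def using J g by (subst Min_gr_iff) auto
  have \<eta>_le: "\<eta> \<le> g q" if "q \<in> J" for q unfolding \<eta>_def using J that by (intro Min_le) auto
  define K where "K = real (\<Sum>q\<in>J. m q)"
  have K: "K \<ge> 0" unfolding K_def by (rule of_nat_0_le_iff)
  have tfK: "test_function K (f q)" if q: "q \<in> J" for q
  proof (rule test_function_mono[OF tf])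
    show "real (m q) \<le> K" unfolding K_def using J(2) q by (intro of_nat_mono member_le_sum) auto
  qed (use J q in auto)
  \<comment> \<open>The tolerance \<open>e\<close> is fixed first, as \<open>\<kappa>\<close> depends on it; the accuracy \<open>h\<close> of the averages may then
    depend on \<open>\<kappa>\<close>, and \<open>N\<close> on the time after which this accuracy holds.\<close>
  define e where "e = min (1 / 8) (\<eta> / (4 * (K + 1)))"
  have e: "e > 0" using \<eta> K by (simp add: e_def)
  have e8: "e \<le> 1 / 8" unfolding e_def by (rule min.cobounded1)
  define w where "w = K + 1"
  have w: "w > 0" using K by (simp add: w_def)
  have "w * e \<le> w * (\<eta> / (4 * w))" using w by (intro mult_left_mono) (auto simp: e_def w_def)
  then have eK: "(K + 1) * e \<le> \<eta> / 4" using w unfolding w_def[symmetric] by simp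
  obtain \<kappa> where \<kappa>: "\<kappa> > 0" and sw1: "\<And>N::nat. \<exists>\<delta>>0. \<exists>Z\<in>sets \<mu>. mu.prob Z > 1 - e \<and>
        (\<forall>x\<in>Z. \<forall>y\<in>Z. dist x y < \<delta> \<and> x \<notin> flow_orbit T y \<longrightarrow>
           (\<exists>M L :: nat. \<exists>p\<in>P. M > N \<and> L > N \<and> real L / real M \<ge> \<kappa> \<and>
              (real (card {n\<in>{M..M + L}.
                   dist (T (real n * t0) x) (T (real n * t0 + p) y) < e}) / real L > 1 - e \<or>
               real (card {n\<in>{M..M + L}.
                   dist (T (- (real n * t0)) x) (T (- (real n * t0) + p) y) < e}) / real L > 1 - e)))"
    using sw e unfolding switchable_R_def by blast
  define h where "h = \<eta> * \<kappa> / (8 * (2 + \<kappa>))"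
  have h: "h > 0" unfolding h_def using \<eta> \<kappa> by simp
  have P0: "compact (insert 0 P)" using P(1) by simp
  have BJ: "B q \<in> sets \<nu>" if "q \<in> J" for q using B J that by blast
  have avg: "\<exists>W\<in>sets \<rho>. rho.prob W > 1 - 1 / 8 \<and> (\<exists>N0. \<forall>z\<in>W. \<forall>n\<ge>N0. \<forall>i\<in>J. \<forall>s\<in>insert 0 P.
           \<bar>orbit_sum (prod_flow T S t) (observable (f i) (B i) s) n z - real n * correlation (f i) (B i) s\<bar> \<le> real n * h)"
    if "ergodic_map \<rho> (prod_flow T S t)" for t
    by (rule uniform_correlation_averages[OF ac that J(2) tfK BJ K P0 h]) auto
  obtain W1 N1 where W1: "W1 \<in> sets \<rho>" "rho.prob W1 > 1 - 1 / 8"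
    and c1: "\<And>z n i s. z \<in> W1 \<Longrightarrow> n \<ge> N1 \<Longrightarrow> i \<in> J \<Longrightarrow> s \<in> insert 0 P \<Longrightarrow>
           \<bar>orbit_sum (prod_flow T S t0) (observable (f i) (B i) s) n z - real n * correlation (f i) (B i) s\<bar> \<le> real n * h"
    using avg[OF ergt] by blast
  obtain W2 N2 where W2: "W2 \<in> sets \<rho>" "rho.prob W2 > 1 - 1 / 8"
    and c2: "\<And>z n i s. z \<in> W2 \<Longrightarrow> n \<ge> N2 \<Longrightarrow> i \<in> J \<Longrightarrow> s \<in> insert 0 P \<Longrightarrow>
           \<bar>orbit_sum (prod_flow T S (- t0)) (observable (f i) (B i) s) n z - real n * correlation (f i) (B i) s\<bar> \<le> real n * h"
    using avg[OF rho.ergodic_map_flow_uminus[OF ergt]] by blast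
  obtain N3 :: nat where N3: "real N3 > 4 / \<eta>" using reals_Archimedean2 by blast
  define N where "N = max (max N1 N2) N3"
  obtain d Z where d: "d > 0" and Z: "Z \<in> sets \<mu>" "mu.prob Z > 1 - e"
    and sw2: "\<And>x y. x \<in> Z \<Longrightarrow> y \<in> Z \<Longrightarrow> dist x y < d \<Longrightarrow> x \<notin> flow_orbit T y \<Longrightarrow>
           (\<exists>M L :: nat. \<exists>p\<in>P. M > N \<and> L > N \<and> real L / real M \<ge> \<kappa> \<and>
              (real (card {n\<in>{M..M + L}.
                   dist (T (real n * t0) x) (T (real n * t0 + p) y) < e}) / real L > 1 - e \<or>
               real (card {n\<in>{M..M + L}.
                   dist (T (- (real n * t0)) x) (T (- (real n * t0) + p) y) < e}) / real L > 1 - e))"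
    using sw1[of N] by blast
  have "AE z in \<rho>. \<forall>q\<in>Q. \<forall>s. (\<lambda>n. orbit_sum (prod_flow T S t0) (observable (f q) (B q) s) n z / real n) \<longlonglongrightarrow> correlation (f q) (B q) s"
    unfolding AE_ball_countable[OF Q] using AE_correlation_averages[OF ac ergt tf B] by blast
  then obtain G where G: "G \<in> null_sets \<rho>" and Gc: "\<And>z. z \<in> space \<rho> \<Longrightarrow> z \<notin> G \<Longrightarrow>
      \<forall>q\<in>Q. \<forall>s. (\<lambda>n. orbit_sum (prod_flow T S t0) (observable (f q) (B q) s) n z / real n) \<longlonglongrightarrow> correlation (f q) (B q) s"
    unfolding eventually_ae_filter by blast
  define Z' where "Z' = {z\<in>space \<rho>. fst z \<in> Z}"
  have Z': "Z' \<in> sets \<rho>" "rho.prob Z' > 1 - 1 / 8"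
  proof -
    note [measurable] = Z(1)
    show "Z' \<in> sets \<rho>" unfolding Z'_def by measurable
    show "rho.prob Z' > 1 - 1 / 8" using emeasure_fst[OF Z(1)] Z(2) e8 unfolding Z'_def
      by (simp add: measure_def)
  qed
  \<comment> \<open>Generic in both time directions, inside the set given by the switchable property, and outside the
    null set of points that are not generic for some observable of the countable family.\<close>
  define E where "E = W1 \<inter> W2 \<inter> Z' - G"
  note [measurable] = W1(1) W2(1) Z'(1) null_setsD2[OF G]
  have E: "E \<in> sets \<rho>" unfolding E_def by measurable
  have Esp: "E \<subseteq> space \<rho>" using sets.sets_into_space[OF E] .
  have "rho.prob E > 0"
  proof -
    have "rho.prob E = rho.prob (W1 \<inter> W2 \<inter> Z')" unfolding E_def using G
      by (intro measure_Diff_null_set) auto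
    moreover have "1 - rho.prob (W1 \<inter> W2 \<inter> Z') = rho.prob (space \<rho> - (W1 \<inter> W2 \<inter> Z'))"
      by (rule rho.prob_compl[symmetric]) measurable
    moreover have "rho.prob (space \<rho> - (W1 \<inter> W2 \<inter> Z')) \<le> rho.prob ((space \<rho> - W1) \<union> ((space \<rho> - W2) \<union> (space \<rho> - Z')))"
      by (rule rho.finite_measure_mono) auto
    moreover have "\<dots> \<le> rho.prob (space \<rho> - W1) + rho.prob ((space \<rho> - W2) \<union> (space \<rho> - Z'))"
      by (rule measure_Un_le) auto
    moreover have "rho.prob ((space \<rho> - W2) \<union> (space \<rho> - Z')) \<le> rho.prob (space \<rho> - W2) + rho.prob (space \<rho> - Z')"
      by (rule measure_Un_le) auto
    ultimately show ?thesis using W1 W2 Z' by (simp add: rho.prob_compl)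
  qed
  moreover have "x = x'" if z: "(x, y) \<in> E" and z': "(x', y) \<in> E" and dist: "dist x x' < d" for x x' y
  proof (cases "x \<in> flow_orbit T x'")
    case True
    then obtain s where s: "x = T s x'" unfolding flow_orbit_def by blast
    have "s = 0"
    proof (rule ccontr)
      assume "s \<noteq> 0"
      then obtain q where q: "q \<in> Q" "\<bar>correlation (f q) (B q) s - correlation (f q) (B q) 0\<bar> > g q"
        using cover by blast
      have l1: "(\<lambda>n. orbit_sum (prod_flow T S t0) (observable (f q) (B q) 0) n (x, y) / real n) \<longlonglongrightarrow> correlation (f q) (B q) 0"
        using Gc[of "(x, y)"] z Esp q(1) by (auto simp: E_def)
      have l2: "(\<lambda>n. orbit_sum (prod_flow T S t0) (observable (f q) (B q) s) n (x', y) / real n) \<longlonglongrightarrow> correlation (f q) (B q) s"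
        using Gc[of "(x', y)"] z' Esp q(1) by (auto simp: E_def)
      have eq: "orbit_sum (prod_flow T S t0) (observable (f q) (B q) 0) n (x, y)
          = orbit_sum (prod_flow T S t0) (observable (f q) (B q) s) n (x', y)" for n
        using z z' Esp by (subst (1 2) orbit_sum_observable) (auto simp: s T_add[symmetric])
      have "correlation (f q) (B q) 0 = correlation (f q) (B q) s"
        using l1 l2 unfolding eq by (rule LIMSEQ_unique)
      then show False using q(2) g[OF q(1)] by simp
    qed
    then show ?thesis using s by simp
  next
    case False
    have "x \<in> Z" "x' \<in> Z" using z z' by (auto simp: E_def Z'_def)
    from sw2[OF this dist False] obtain M L p where p: "p \<in> P" and blk: "M > N" "L > N" "real L / real M \<ge> \<kappa>"
      and freq: "real (card {n\<in>{M..M + L}. dist (T (real n * t0) x) (T (real n * t0 + p) x') < e}) / real L > 1 - e \<or>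
         real (card {n\<in>{M..M + L}. dist (T (- (real n * t0)) x) (T (- (real n * t0) + p) x') < e}) / real L > 1 - e"
      by blast
    obtain q where q: "q \<in> J" "\<bar>correlation (f q) (B q) p - correlation (f q) (B q) 0\<bar> > g q"
      using PJ p by blast
    have gap: "\<bar>correlation (f q) (B q) p - correlation (f q) (B q) 0\<bar> \<ge> \<eta>" using q \<eta>_le by fastforce
    have sp: "(x, y) \<in> space \<rho>" "(x', y) \<in> space \<rho>" using z z' Esp by auto
    have zW: "(x, y) \<in> W1" "(x', y) \<in> W1" "(x, y) \<in> W2" "(x', y) \<in> W2" using z z' by (auto simp: E_def)
    have MN: "M > N1" "M > N2" using blk(1) by (auto simp: N_def)
    have "real N3 < real L" using blk(2) by (simp add: N_def)
    then have LN: "real L > 4 / \<eta>" using N3 by linarith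
    from freq have False
    proof
      assume fr: "real (card {n\<in>{M..M + L}. dist (T (real n * t0) x) (T (real n * t0 + p) x') < e}) / real L > 1 - e"
      show False
        by (rule block_shift_contradiction[OF tfK[OF q(1)] sp _ _ gap MN(1) LN blk(3) fr \<eta> \<kappa> e eK h_def])
           (use c1 zW q(1) p in auto)
    next
      assume "real (card {n\<in>{M..M + L}. dist (T (- (real n * t0)) x) (T (- (real n * t0) + p) x') < e}) / real L > 1 - e"
      then have fr: "real (card {n\<in>{M..M + L}. dist (T (real n * - t0) x) (T (real n * - t0 + p) x') < e}) / real L > 1 - e"
        by simp
      show False
        by (rule block_shift_contradiction[OF tfK[OF q(1)] sp _ _ gap MN(2) LN blk(3) fr \<eta> \<kappa> e eK h_def])
           (use c2 zW q(1) p in auto)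
    qed
    then show ?thesis ..
  qed
  ultimately show thesis using that[OF E _ d] by blast
qed

end

section \<open>Conditional distributions of real random variables\<close>

text \<open>
  Passing to limits from the right turns a monotone function on the rationals into a distribution
  function.
\<close>

lemma real_distribution_of_rational_cdf:
  fixes G :: "real \<Rightarrow> real"
  assumes mono: "\<And>p q. p \<in> \<rat> \<Longrightarrow> q \<in> \<rat> \<Longrightarrow> p \<le> q \<Longrightarrow> G p \<le> G q"
    and G0: "\<And>q. 0 \<le> G q" and G1: "\<And>q. q \<in> \<rat> \<Longrightarrow> G q \<le> 1"
    and top: "(\<lambda>n. G (real n)) \<longlonglongrightarrow> 1" and bot: "(\<lambda>n. G (- real n)) \<longlonglongrightarrow> 0"
  defines "F \<equiv> \<lambda>x. INF q\<in>{q\<in>\<rat>. x < q}. G q"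
  shows "real_distribution (interval_measure F)"
    and "emeasure (interval_measure F) {..x} = ennreal (F x)"
    and "(\<And>n. u n \<in> \<rat> \<and> x < u n) \<Longrightarrow> u \<longlonglongrightarrow> x \<Longrightarrow> (\<lambda>n. G (u n)) \<longlonglongrightarrow> F x"
    and "0 \<le> F x" "F x \<le> 1"
proof -
  have bdd: "bdd_below (G ` {q\<in>\<rat>. x < q})" for x using G0 by (auto simp: bdd_below_def)
  have ne: "{q\<in>\<rat>. x < q} \<noteq> {}" for x :: real using Rats_dense_in_real[of x "x + 1"] by auto
  have F_le: "F x \<le> G q" if "q \<in> \<rat>" "x < q" for x q
    unfolding F_def by (rule cINF_lower[OF bdd]) (use that in auto)
  have F_ge: "c \<le> F x" if "\<And>q. q \<in> \<rat> \<Longrightarrow> x < q \<Longrightarrow> c \<le> G q" for x c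
    unfolding F_def by (rule cINF_greatest[OF ne]) (use that in auto)
  have F_less: "\<exists>q\<in>\<rat>. x < q \<and> G q < c" if "F x < c" for x c
    using F_ge[of x c] that by (meson not_le)
  have monoF: "F x \<le> F y" if "x \<le> y" for x y
    by (rule F_ge) (use that F_le in auto)
  show F0: "0 \<le> F x" for x by (rule F_ge) (rule G0)
  show F1: "F x \<le> 1" for x
  proof -
    obtain q where "q \<in> \<rat>" "x < q" using ne[of x] by blast
    then show ?thesis using F_le[of q x] G1[of q] by linarith
  qed
  have right: "continuous (at_right a) F" for a
    unfolding continuous_within
  proof (rule order_tendstoI)
    fix c assume "c < F a"
    then show "eventually (\<lambda>x. c < F x) (at_right a)"
      unfolding eventually_at_right_field by (meson less_le_trans less_imp_le monoF lt_ex gt_ex)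
  next
    fix c assume "F a < c"
    then obtain q where q: "q \<in> \<rat>" "a < q" "G q < c" using F_less by blast
    then show "eventually (\<lambda>x. F x < c) (at_right a)"
      unfolding eventually_at_right_field using F_le by (meson le_less_trans)
  qed
  have lim_bot: "(F \<longlongrightarrow> 0) at_bot"
  proof (rule order_tendstoI)
    fix c :: real assume "c < 0"
    then show "eventually (\<lambda>x. c < F x) at_bot" by (intro always_eventually allI less_le_trans[OF _ F0])
  next
    fix c :: real assume "0 < c"
    from order_tendstoD(2)[OF bot this] obtain n where n: "G (- real n) < c"
      unfolding eventually_sequentially by blast
    have "F x < c" if "x < - real n" for x using F_le[of "- real n" x] that n by simp
    then show "eventually (\<lambda>x. F x < c) at_bot" unfolding eventually_at_bot_dense by blast
  qed
  have lim_top: "(F \<longlongrightarrow> 1) at_top"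
  proof (rule order_tendstoI)
    fix c :: real assume "c < 1"
    from order_tendstoD(1)[OF top this] obtain n where n: "c < G (real n)"
      unfolding eventually_sequentially by blast
    have "c < F x" if "x \<ge> real n" for x
    proof -
      have "G (real n) \<le> F x" by (rule F_ge) (use mono that in auto)
      then show ?thesis using n by simp
    qed
    then show "eventually (\<lambda>x. c < F x) at_top" unfolding eventually_at_top_linorder by blast
  next
    fix c :: real assume "1 < c"
    then show "eventually (\<lambda>x. F x < c) at_top" by (intro always_eventually allI le_less_trans[OF F1])
  qed
  show "real_distribution (interval_measure F)"
    by (rule real_distribution_interval_measure[OF monoF right lim_bot lim_top])
  show "emeasure (interval_measure F) {..x} = ennreal (F x)"
    by (rule emeasure_interval_measure_Iic[OF monoF right lim_bot])
  show "(\<lambda>n. G (u n)) \<longlonglongrightarrow> F x" if u: "\<And>n. u n \<in> \<rat> \<and> x < u n" and lim: "u \<longlonglongrightarrow> x"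
  proof (rule order_tendstoI)
    fix c assume "c < F x"
    then show "eventually (\<lambda>n. c < G (u n)) sequentially"
      using u by (intro always_eventually allI less_le_trans[OF _ F_le]) auto
  next
    fix c assume "F x < c"
    then obtain q where q: "q \<in> \<rat>" "x < q" "G q < c" using F_less by blast
    from order_tendstoD(2)[OF lim q(2)]
    show "eventually (\<lambda>n. G (u n) < c) sequentially"
    proof eventually_elim
      case (elim n)
      have "G (u n) \<le> G q" by (rule mono) (use u q elim in auto)
      then show ?case using q(3) by simp
    qed
  qed
qed

context prob_space
begin

text \<open>
  The conditional probability of \<open>C\<close> as a function on the base, namely the Radon-Nikodym density of the
  image of the measure restricted to \<open>C\<close>.
\<close>

lemma conditional_density:
  assumes \<nu>: "prob_space \<nu>" and [measurable]: "\<pi> \<in> M \<rightarrow>\<^sub>M \<nu>" and d: "distr M \<nu> \<pi> = \<nu>" and C[measurable]: "C \<in> sets M"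
  shows "\<exists>g. g \<in> borel_measurable \<nu> \<and> integrable \<nu> g \<and> (\<forall>y. 0 \<le> g y) \<and>
    (\<forall>B\<in>sets \<nu>. set_lebesgue_integral \<nu> B g = prob {z\<in>space M. z \<in> C \<and> \<pi> z \<in> B})"
proof -
  interpret N: prob_space \<nu> by fact
  define D where "D = distr (density M (indicator C)) \<nu> \<pi>"
  have eD: "emeasure D B = ennreal (prob {z\<in>space M. z \<in> C \<and> \<pi> z \<in> B})" if [measurable]: "B \<in> sets \<nu>" for B
  proof -
    have "emeasure D B = emeasure (density M (indicator C)) {z\<in>space M. \<pi> z \<in> B}"
      unfolding D_def by (subst emeasure_distr) (auto simp: vimage_def Int_def conj_commute)
    also have "\<dots> = (\<integral>\<^sup>+z. indicator C z * indicator {z\<in>space M. \<pi> z \<in> B} z \<partial>M)"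
      by (subst emeasure_density) auto
    also have "\<dots> = (\<integral>\<^sup>+z. indicator {z\<in>space M. z \<in> C \<and> \<pi> z \<in> B} z \<partial>M)"
      by (rule nn_integral_cong) (auto simp: indicator_def)
    also have "\<dots> = emeasure M {z\<in>space M. z \<in> C \<and> \<pi> z \<in> B}"
      by (rule nn_integral_indicator) measurable
    finally show ?thesis by (simp add: emeasure_eq_measure)
  qed
  have "absolutely_continuous \<nu> D"
    unfolding absolutely_continuous_def
  proof
    fix B assume B: "B \<in> null_sets \<nu>"
    then have [measurable]: "B \<in> sets \<nu>" by auto
    have "emeasure (distr M \<nu> \<pi>) B = 0" using B unfolding d by (rule null_setsD1)
    then have "emeasure M {z\<in>space M. \<pi> z \<in> B} = 0"
      by (subst (asm) emeasure_distr) (auto simp: vimage_def Int_def conj_commute)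
    then have "prob {z\<in>space M. \<pi> z \<in> B} = 0" by (simp add: measure_def)
    moreover have "prob {z\<in>space M. z \<in> C \<and> \<pi> z \<in> B} \<le> prob {z\<in>space M. \<pi> z \<in> B}"
      by (rule finite_measure_mono) auto
    ultimately have "prob {z\<in>space M. z \<in> C \<and> \<pi> z \<in> B} = 0"
      using measure_nonneg[of M "{z\<in>space M. z \<in> C \<and> \<pi> z \<in> B}"] by linarith
    then show "B \<in> null_sets D" using eD[of B] by (simp add: null_sets_def D_def)
  qed
  from N.Radon_Nikodym[OF this] obtain f where f[measurable]: "f \<in> borel_measurable \<nu>" and fD: "density \<nu> f = D"
    by (auto simp: D_def)
  have int: "(\<integral>\<^sup>+y. f y * indicator B y \<partial>\<nu>) = ennreal (prob {z\<in>space M. z \<in> C \<and> \<pi> z \<in> B})" if B: "B \<in> sets \<nu>" for B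
    using eD[OF B] unfolding fD[symmetric] by (simp add: emeasure_density B)
  have "(\<integral>\<^sup>+y. f y \<partial>\<nu>) = (\<integral>\<^sup>+y. f y * indicator (space \<nu>) y \<partial>\<nu>)"
    by (rule nn_integral_cong) simp
  then have "(\<integral>\<^sup>+y. f y \<partial>\<nu>) \<noteq> \<infinity>" using int[of "space \<nu>"] by simp
  then have fin: "AE y in \<nu>. f y \<noteq> \<infinity>" by (intro nn_integral_noteq_infinite) auto
  define g where "g y = enn2real (f y)" for y
  have [measurable]: "g \<in> borel_measurable \<nu>" unfolding g_def by measurable
  have hb: "has_bochner_integral \<nu> (\<lambda>y. indicator B y * g y) (prob {z\<in>space M. z \<in> C \<and> \<pi> z \<in> B})" if B[measurable]: "B \<in> sets \<nu>" for B
  proof (rule has_bochner_integral_nn_integral)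
    have "(\<integral>\<^sup>+y. ennreal (indicator B y * g y) \<partial>\<nu>) = (\<integral>\<^sup>+y. f y * indicator B y \<partial>\<nu>)"
      by (rule nn_integral_cong_AE) (use fin in \<open>auto elim!: eventually_mono simp: g_def indicator_def less_top\<close>)
    then show "(\<integral>\<^sup>+y. ennreal (indicator B y * g y) \<partial>\<nu>) = ennreal (prob {z\<in>space M. z \<in> C \<and> \<pi> z \<in> B})"
      using int[OF B] by simp
  qed (auto simp: g_def)
  have "integrable \<nu> (\<lambda>y. indicator (space \<nu>) y * g y)" using hb[of "space \<nu>"] by (auto simp: has_bochner_integral_iff)
  then have "integrable \<nu> g" by (rule iffD1[OF Bochner_Integration.integrable_cong, rotated 2]) auto
  moreover have "set_lebesgue_integral \<nu> B g = prob {z\<in>space M. z \<in> C \<and> \<pi> z \<in> B}" if "B \<in> sets \<nu>" for B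
    using hb[OF that] by (simp add: set_lebesgue_integral_def has_bochner_integral_iff)
  ultimately show ?thesis by (intro exI[of _ g]) (auto simp: g_def)
qed

text \<open>
  A regular conditional distribution of a real random variable, given \<open>\<pi>\<close>. The conditional
  probabilities of \<open>{..q}\<close> are densities, determined only up to null sets; over rational \<open>q\<close> the
  exceptional sets stay countable in number, and outside them the values extend to a distribution
  function.
\<close>

lemma real_conditional_distribution:
  assumes \<nu>: "prob_space \<nu>" and \<pi>[measurable]: "\<pi> \<in> M \<rightarrow>\<^sub>M \<nu>" and d: "distr M \<nu> \<pi> = \<nu>"
    and r[measurable]: "r \<in> borel_measurable M"
  obtains \<kappa> :: "'b \<Rightarrow> real measure" where "\<kappa> \<in> \<nu> \<rightarrow>\<^sub>M prob_algebra borel"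
    "\<And>x B. B \<in> sets \<nu> \<Longrightarrow> (\<integral>\<^sup>+y. emeasure (\<kappa> y) {..x} * indicator B y \<partial>\<nu>) = emeasure M {z\<in>space M. r z \<le> x \<and> \<pi> z \<in> B}"
proof -
  interpret N: prob_space \<nu> by fact
  define c where "c q B = prob {z\<in>space M. r z \<le> q \<and> \<pi> z \<in> B}" for q B
  have "\<forall>q. \<exists>g. g \<in> borel_measurable \<nu> \<and> integrable \<nu> g \<and> (\<forall>y. 0 \<le> g y) \<and>
    (\<forall>B\<in>sets \<nu>. set_lebesgue_integral \<nu> B g = c q B)"
  proof
    fix q
    have "{z\<in>space M. r z \<le> q} \<in> sets M" by measurable
    from conditional_density[OF \<nu> \<pi> d this]
    show "\<exists>g. g \<in> borel_measurable \<nu> \<and> integrable \<nu> g \<and> (\<forall>y. 0 \<le> g y) \<and>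
        (\<forall>B\<in>sets \<nu>. set_lebesgue_integral \<nu> B g = c q B)"
      by (simp add: c_def cong: conj_cong)
  qed
  from choice[OF this] obtain G where "\<forall>q. G q \<in> borel_measurable \<nu> \<and> integrable \<nu> (G q) \<and> (\<forall>y. 0 \<le> G q y) \<and>
    (\<forall>B\<in>sets \<nu>. set_lebesgue_integral \<nu> B (G q) = c q B)" by (elim exE)
  then have G[measurable]: "\<And>q. G q \<in> borel_measurable \<nu>" and intG: "\<And>q. integrable \<nu> (G q)"
    and G0: "\<And>q y. 0 \<le> G q y" and cG: "\<And>q B. B \<in> sets \<nu> \<Longrightarrow> set_lebesgue_integral \<nu> B (G q) = c q B"
    by simp_all
  have c_mono: "c p B \<le> c q B" if "p \<le> q" and [measurable]: "B \<in> sets \<nu>" for p q B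
    unfolding c_def by (rule finite_measure_mono) (use that in auto)
  have piB: "prob {z\<in>space M. \<pi> z \<in> B} = N.prob B" if [measurable]: "B \<in> sets \<nu>" for B
    using arg_cong[OF d, of "\<lambda>m. measure m B"]
    by (subst (asm) measure_distr) (auto simp: vimage_def Int_def conj_commute)
  have c_le: "c q B \<le> N.prob B" if B[measurable]: "B \<in> sets \<nu>" for q B
    unfolding c_def piB[OF B, symmetric] by (rule finite_measure_mono) auto
  have int_si: "set_integrable \<nu> B (G q)" if "B \<in> sets \<nu>" for B q
    unfolding set_integrable_def using intG[of q] that by (rule integrable_mult_indicator[rotated])
  have AEmono: "AE y in \<nu>. G p y \<le> G q y" if "p \<le> q" for p q
  proof -
    have "AE y in \<nu>. 0 \<le> G q y - G p y"
    proof (rule N.density_nonneg)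
      fix B assume B: "B \<in> sets \<nu>"
      have "set_lebesgue_integral \<nu> B (\<lambda>y. G q y - G p y) = c q B - c p B"
        using set_integral_diff(2)[OF int_si[OF B] int_si[OF B]] by (simp add: cG[OF B])
      then show "0 \<le> set_lebesgue_integral \<nu> B (\<lambda>y. G q y - G p y)" using c_mono[OF that B] by simp
    qed (simp add: intG)
    then show ?thesis by eventually_elim simp
  qed
  have AE1: "AE y in \<nu>. G q y \<le> 1" for q
  proof -
    have "AE y in \<nu>. 0 \<le> 1 - G q y"
    proof (rule N.density_nonneg)
      fix B assume B: "B \<in> sets \<nu>"
      have "set_integrable \<nu> B (\<lambda>_. 1 :: real)" unfolding set_integrable_def
        using B by (auto intro!: integrable_real_indicator simp: N.emeasure_eq_measure)
      from set_integral_diff(2)[OF this int_si[OF B]]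
      have "set_lebesgue_integral \<nu> B (\<lambda>y. 1 - G q y) = set_lebesgue_integral \<nu> B (\<lambda>y. 1) - c q B" by (simp add: cG[OF B])
      also have "set_lebesgue_integral \<nu> B (\<lambda>y. 1 :: real) = N.prob B"
        using B by (simp add: set_lebesgue_integral_def)
      finally show "0 \<le> set_lebesgue_integral \<nu> B (\<lambda>y. 1 - G q y)" using c_le[OF B] by simp
    qed (simp add: intG)
    then show ?thesis by eventually_elim simp
  qed
  have space_int: "(\<integral>y. G q y \<partial>\<nu>) = prob {z\<in>space M. r z \<le> q}" for q
  proof -
    have "(\<integral>y. G q y \<partial>\<nu>) = set_lebesgue_integral \<nu> (space \<nu>) (G q)"
      by (simp add: set_integral_space[OF intG])
    also have "\<dots> = prob {z\<in>space M. r z \<le> q}"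
      using cG[of "space \<nu>" q] measurable_space[OF \<pi>] by (simp add: c_def cong: conj_cong)
    finally show ?thesis .
  qed
  have AEtop: "AE y in \<nu>. (\<lambda>n. G (real n) y) \<longlonglongrightarrow> 1"
  proof -
    have good: "AE y in \<nu>. (\<forall>n::nat. G (real n) y \<le> 1) \<and> (\<forall>n. G (real n) y \<le> G (real (Suc n)) y)"
      by (intro AE_conjI) (simp_all add: AE_all_countable AE1 AEmono)
    define h where "h y = lim (\<lambda>n. G (real n) y)" for y
    have hm[measurable]: "h \<in> borel_measurable \<nu>" unfolding h_def by measurable
    have conv: "AE y in \<nu>. (\<lambda>n. G (real n) y) \<longlonglongrightarrow> h y \<and> 0 \<le> h y \<and> h y \<le> 1"
      using good
    proof eventually_elim
      case (elim y)
      then have "incseq (\<lambda>n. G (real n) y)" by (intro incseq_SucI) simp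
      then have c: "(\<lambda>n. G (real n) y) \<longlonglongrightarrow> h y" unfolding h_def
        using elim by (metis incseq_convergent convergent_LIMSEQ_iff convergent_def)
      moreover have "h y \<le> 1" using c by (rule LIMSEQ_le_const2) (use elim in auto)
      moreover have "0 \<le> h y" using c by (rule LIMSEQ_le_const) (use G0 in auto)
      ultimately show ?case by simp
    qed
    have L1: "(\<lambda>n. \<integral>y. G (real n) y \<partial>\<nu>) \<longlonglongrightarrow> (\<integral>y. h y \<partial>\<nu>)"
      by (rule integral_dominated_convergence[where w="\<lambda>_. 1"])
         (use conv AE1 G0 in \<open>auto elim!: eventually_mono\<close>)
    have L2: "(\<lambda>n. prob {z\<in>space M. r z \<le> real n}) \<longlonglongrightarrow> prob (\<Union>n. {z\<in>space M. r z \<le> real n})"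
      by (rule finite_Lim_measure_incseq) (auto simp: incseq_def)
    have U: "(\<Union>n. {z\<in>space M. r z \<le> real n}) = space M"
    proof -
      have "\<exists>n. r z \<le> real n" for z by (rule real_arch_simple)
      then show ?thesis by auto
    qed
    have ih: "(\<integral>y. h y \<partial>\<nu>) = 1"
      using LIMSEQ_unique[OF L1[unfolded space_int] L2] unfolding U prob_space .
    have h1: "AE y in \<nu>. norm (h y) \<le> 1" and h2: "AE y in \<nu>. 0 \<le> 1 - h y"
      using conv by (eventually_elim, simp)+
    have hint: "integrable \<nu> h" by (rule N.integrable_const_bound[OF h1 hm])
    have "(\<integral>y. 1 - h y \<partial>\<nu>) = 0" using hint ih by (simp add: N.prob_space)
    then have "AE y in \<nu>. 1 - h y = 0"
      using integral_nonneg_eq_0_iff_AE[of \<nu> "\<lambda>y. 1 - h y"] hint h2 by simp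
    with conv show ?thesis by eventually_elim auto
  qed
  have AEbot: "AE y in \<nu>. (\<lambda>n. G (- real n) y) \<longlonglongrightarrow> 0"
  proof -
    have good: "AE y in \<nu>. \<forall>n. G (- real (Suc n)) y \<le> G (- real n) y"
      by (simp add: AE_all_countable AEmono)
    define h where "h y = lim (\<lambda>n. G (- real n) y)" for y
    have hm[measurable]: "h \<in> borel_measurable \<nu>" unfolding h_def by measurable
    have conv: "AE y in \<nu>. (\<lambda>n. G (- real n) y) \<longlonglongrightarrow> h y \<and> 0 \<le> h y \<and> h y \<le> 1"
      using good AE1[of "- real 0"]
    proof eventually_elim
      case (elim y)
      then have dec: "decseq (\<lambda>n. G (- real n) y)" by (intro decseq_SucI) simp
      then have c: "(\<lambda>n. G (- real n) y) \<longlonglongrightarrow> h y" unfolding h_def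
        using G0 by (metis decseq_convergent convergent_LIMSEQ_iff convergent_def)
      moreover have "h y \<le> G (- real 0) y" by (rule decseq_ge[OF dec c])
      moreover have "0 \<le> h y" using c by (rule LIMSEQ_le_const) (use G0 in auto)
      ultimately show ?case using elim(2) by simp
    qed
    have L1: "(\<lambda>n. \<integral>y. G (- real n) y \<partial>\<nu>) \<longlonglongrightarrow> (\<integral>y. h y \<partial>\<nu>)"
      by (rule integral_dominated_convergence[where w="\<lambda>_. 1"])
         (use conv AE1 G0 in \<open>auto elim!: eventually_mono\<close>)
    have L2: "(\<lambda>n. prob {z\<in>space M. r z \<le> - real n}) \<longlonglongrightarrow> prob (\<Inter>n. {z\<in>space M. r z \<le> - real n})"
      by (rule finite_Lim_measure_decseq) (auto simp: decseq_def)
    have U: "(\<Inter>n. {z\<in>space M. r z \<le> - real n}) = {}"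
    proof -
      have "\<exists>n. \<not> r z \<le> - real n" for z
        using reals_Archimedean2[of "- r z"] by (metis minus_less_iff not_le)
      then show ?thesis by auto
    qed
    have ih: "(\<integral>y. h y \<partial>\<nu>) = 0"
      using LIMSEQ_unique[OF L1[unfolded space_int] L2] unfolding U measure_empty .
    have h1: "AE y in \<nu>. norm (h y) \<le> 1" and h2: "AE y in \<nu>. 0 \<le> h y"
      using conv by (eventually_elim, simp)+
    have hint: "integrable \<nu> h" by (rule N.integrable_const_bound[OF h1 hm])
    have "AE y in \<nu>. h y = 0"
      using integral_nonneg_eq_0_iff_AE[OF hint h2] ih by simp
    with conv show ?thesis by eventually_elim auto
  qed
  have "AE y in \<nu>. (\<forall>p\<in>\<rat>. \<forall>q\<in>\<rat>. p \<le> q \<longrightarrow> G p y \<le> G q y) \<and> (\<forall>q\<in>\<rat>. G q y \<le> 1)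
      \<and> (\<lambda>n. G (real n) y) \<longlonglongrightarrow> 1 \<and> (\<lambda>n. G (- real n) y) \<longlonglongrightarrow> 0"
  proof (intro AE_conjI AEtop AEbot)
    show "AE y in \<nu>. \<forall>p\<in>\<rat>. \<forall>q\<in>\<rat>. p \<le> q \<longrightarrow> G p y \<le> G q y"
      unfolding AE_ball_countable[OF countable_rat] using AEmono by auto
    show "AE y in \<nu>. \<forall>q\<in>\<rat>. G q y \<le> 1"
      unfolding AE_ball_countable[OF countable_rat] using AE1 by auto
  qed
  then obtain X where X: "X \<in> null_sets \<nu>" and good: "\<And>y. y \<in> space \<nu> \<Longrightarrow> y \<notin> X \<Longrightarrow>
      (\<forall>p\<in>\<rat>. \<forall>q\<in>\<rat>. p \<le> q \<longrightarrow> G p y \<le> G q y) \<and> (\<forall>q\<in>\<rat>. G q y \<le> 1)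
      \<and> (\<lambda>n. G (real n) y) \<longlonglongrightarrow> 1 \<and> (\<lambda>n. G (- real n) y) \<longlonglongrightarrow> 0"
    unfolding eventually_ae_filter by blast
  have Xs[measurable]: "X \<in> sets \<nu>" using X by auto
  define F where "F y x = (INF q\<in>{q\<in>\<rat>. x < q}. G q y)" for y x
  define \<kappa> where "\<kappa> y = (if y \<in> X then return borel 0 else interval_measure (F y))" for y
  have dist: "real_distribution (interval_measure (F y))"
    and cdf: "emeasure (interval_measure (F y)) {..x} = ennreal (F y x)"
    and lim: "(\<And>n. u n \<in> \<rat> \<and> x < u n) \<Longrightarrow> u \<longlonglongrightarrow> x \<Longrightarrow> (\<lambda>n. G (u n) y) \<longlonglongrightarrow> F y x"
    and F01: "0 \<le> F y x" "F y x \<le> 1"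
    if y: "y \<in> space \<nu>" "y \<notin> X" for y x u
    using good[OF y] G0 unfolding F_def
    by (auto intro!: real_distribution_of_rational_cdf)
  have Fm[measurable]: "(\<lambda>y. F y x) \<in> borel_measurable \<nu>" for x
    unfolding F_def
  proof (rule borel_measurable_cINF)
    show "countable {q\<in>\<rat>. x < q}" by (rule countable_subset[OF _ countable_rat]) auto
    show "bdd_below ((\<lambda>q. G q y) ` {q\<in>\<rat>. x < q})" for y using G0 by (auto simp: bdd_below_def)
  qed simp
  have \<kappa>m: "\<kappa> \<in> \<nu> \<rightarrow>\<^sub>M prob_algebra borel"
  proof (rule measurable_prob_algebra_generated)
    show "sets borel = sigma_sets UNIV (range (\<lambda>a::real. {..a}))" unfolding borel_eq_atMost by simp
    show "Int_stable (range (\<lambda>a::real. {..a}))" by (auto simp: Int_stable_def)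
    fix y assume y: "y \<in> space \<nu>"
    show "prob_space (\<kappa> y)" using dist[OF y] unfolding \<kappa>_def real_distribution_def
      by (auto simp: prob_space_return)
    show "sets (\<kappa> y) = sets borel" unfolding \<kappa>_def by simp
  next
    fix A :: "real set" assume "A \<in> range (\<lambda>a. {..a})"
    then obtain x where A: "A = {..x}" by auto
    have "(\<lambda>y. if y \<in> X then indicator {..x} (0::real) else ennreal (F y x)) \<in> borel_measurable \<nu>" by measurable
    moreover have "emeasure (\<kappa> y) A = (if y \<in> X then indicator {..x} (0::real) else ennreal (F y x))" if "y \<in> space \<nu>" for y
      using cdf[OF that] by (simp add: \<kappa>_def A)
    ultimately show "(\<lambda>y. emeasure (\<kappa> y) A) \<in> borel_measurable \<nu>"
      by (simp cong: measurable_cong)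
  qed simp
  moreover have "(\<integral>\<^sup>+y. emeasure (\<kappa> y) {..x} * indicator B y \<partial>\<nu>) = emeasure M {z\<in>space M. r z \<le> x \<and> \<pi> z \<in> B}"
    if B[measurable]: "B \<in> sets \<nu>" for x B
  proof -
    have "\<forall>n. \<exists>q. q \<in> \<rat> \<and> x < q \<and> q < x + inverse (real (Suc n))"
      using Rats_dense_in_real by (metis inverse_positive_iff_positive less_add_same_cancel1 of_nat_0_less_iff zero_less_Suc)
    from choice[OF this] obtain u where u: "\<And>n. u n \<in> \<rat> \<and> x < u n" "\<And>n. u n < x + inverse (real (Suc n))" by blast
    have "(\<lambda>n. x + inverse (real (Suc n))) \<longlonglongrightarrow> x + 0" by (intro tendsto_intros LIMSEQ_inverse_real_of_nat)
    then have ulim: "u \<longlonglongrightarrow> x"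
      by (intro tendsto_sandwich[of "\<lambda>_. x" u sequentially "\<lambda>n. x + inverse (real (Suc n))"])
         (use u in \<open>auto intro!: always_eventually less_imp_le\<close>)
    have AEX: "AE y in \<nu>. y \<notin> X" by (rule AE_not_in[OF X])
    have 1: "(\<lambda>n. \<integral>y. indicator B y * G (u n) y \<partial>\<nu>) \<longlonglongrightarrow> (\<integral>y. indicator B y * F y x \<partial>\<nu>)"
    proof (rule integral_dominated_convergence[where w="\<lambda>_. 1"])
      show "AE y in \<nu>. (\<lambda>n. indicator B y * G (u n) y) \<longlonglongrightarrow> indicator B y * F y x"
        using AEX AE_space by eventually_elim (intro tendsto_mult tendsto_const lim u ulim)
      show "AE y in \<nu>. norm (indicator B y * G (u n) y) \<le> 1" for n
        using AE1[of "u n"] by eventually_elim (use G0 in \<open>auto simp: indicator_def\<close>)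
    qed auto
    have "(\<integral>y. indicator B y * G (u n) y \<partial>\<nu>) = c (u n) B" for n
      using cG[OF B, of "u n"] by (simp add: set_lebesgue_integral_def)
    moreover have "(\<lambda>n. c (u n) B) \<longlonglongrightarrow> c x B"
    proof -
      have "(\<lambda>n. \<integral>z. indicator {z\<in>space M. r z \<le> u n \<and> \<pi> z \<in> B} z \<partial>M) \<longlonglongrightarrow> (\<integral>z. indicat_real {z\<in>space M. r z \<le> x \<and> \<pi> z \<in> B} z \<partial>M)"
      proof (rule integral_dominated_convergence[where w="\<lambda>_. 1 :: real"])
        show "AE z in M. (\<lambda>n. indicator {z\<in>space M. r z \<le> u n \<and> \<pi> z \<in> B} z) \<longlonglongrightarrow> (indicator {z\<in>space M. r z \<le> x \<and> \<pi> z \<in> B} z :: real)"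
        proof (intro AE_I2 tendsto_eventually)
          fix z
          show "eventually (\<lambda>n. indicator {z\<in>space M. r z \<le> u n \<and> \<pi> z \<in> B} z = (indicator {z\<in>space M. r z \<le> x \<and> \<pi> z \<in> B} z :: real)) sequentially"
          proof (cases "r z \<le> x")
            case True
            then have "r z \<le> u n" for n using u(1)[of n] by linarith
            then show ?thesis using True by (simp add: indicator_def)
          next
            case False
            then have "x < r z" by simp
            from order_tendstoD(2)[OF ulim this] show ?thesis
              by eventually_elim (use False in \<open>auto simp: indicator_def\<close>)
          qed
        qed
      qed (auto simp: indicator_def)
      then show ?thesis unfolding c_def by simp
    qed
    ultimately have 2: "(\<integral>y. indicator B y * F y x \<partial>\<nu>) = c x B"
      using LIMSEQ_unique[OF 1] by simp
    have AEF: "AE y in \<nu>. 0 \<le> F y x \<and> F y x \<le> 1"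
      using AEX AE_space by eventually_elim (use F01 in auto)
    have "(\<integral>\<^sup>+y. emeasure (\<kappa> y) {..x} * indicator B y \<partial>\<nu>) = (\<integral>\<^sup>+y. ennreal (indicator B y * F y x) \<partial>\<nu>)"
      by (rule nn_integral_cong_AE) (use AEX AE_space in \<open>eventually_elim, auto simp: \<kappa>_def cdf indicator_def\<close>)
    also have "\<dots> = ennreal (\<integral>y. indicator B y * F y x \<partial>\<nu>)"
    proof (rule nn_integral_eq_integral)
      show "integrable \<nu> (\<lambda>y. indicator B y * F y x)"
      proof (rule N.integrable_const_bound)
        show "AE y in \<nu>. norm (indicator B y * F y x) \<le> 1"
          using AEF by eventually_elim (auto simp: indicator_def)
      qed measurable
      show "AE y in \<nu>. 0 \<le> indicator B y * F y x" using AEF by eventually_elim simp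
    qed
    finally show ?thesis unfolding 2 c_def by (simp add: emeasure_eq_measure)
  qed
  ultimately show thesis by (rule that)
qed

end

section \<open>Coding by real numbers and atoms of conditional measures\<close>

text \<open>
  Base three with digits zero and one leaves gaps, so the digits can be read off by comparison with one.
\<close>

definition ternary :: "(nat \<Rightarrow> bool) \<Rightarrow> real" where
  "ternary b = (\<Sum>j. of_bool (b j) * (1 / 3) ^ j)"

primrec ternary_tail :: "real \<Rightarrow> nat \<Rightarrow> real" where
  "ternary_tail r 0 = r"
| "ternary_tail r (Suc j) = 3 * (ternary_tail r j - of_bool (ternary_tail r j \<ge> 1))"

lemma summable_ternary: "summable (\<lambda>j. of_bool (b j) * (1 / 3 :: real) ^ j)"
  by (rule summable_comparison_test'[of "\<lambda>j. (1 / 3 :: real) ^ j" 0]) (auto intro: summable_geometric)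

lemma ternary_head: "ternary b = of_bool (b 0) + ternary (\<lambda>j. b (Suc j)) / 3"
proof -
  have "(\<Sum>j. of_bool (b (Suc j)) * (1 / 3 :: real) ^ Suc j) = (\<Sum>j. (1 / 3) * (of_bool (b (Suc j)) * (1 / 3) ^ j))"
    by (rule suminf_cong) simp
  also have "\<dots> = (1 / 3) * ternary (\<lambda>j. b (Suc j))"
    unfolding ternary_def by (rule suminf_mult[OF summable_ternary])
  finally show ?thesis
    using suminf_split_head[OF summable_ternary, of b] unfolding ternary_def by simp
qed

lemma ternary_bounds: "0 \<le> ternary b" "ternary b \<le> 3 / 2"
proof -
  show "0 \<le> ternary b" unfolding ternary_def by (rule suminf_nonneg[OF summable_ternary]) simp
  have "ternary b \<le> (\<Sum>j. (1 / 3 :: real) ^ j)" unfolding ternary_def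
    by (rule suminf_le[OF _ summable_ternary summable_geometric]) auto
  also have "\<dots> = 3 / 2" by (subst suminf_geometric) auto
  finally show "ternary b \<le> 3 / 2" .
qed

lemma ternary_ge_1_iff: "ternary b \<ge> 1 \<longleftrightarrow> b 0"
  using ternary_head[of b] ternary_bounds[of "\<lambda>j. b (Suc j)"] by (cases "b 0") auto

lemma ternary_tail: "ternary_tail (ternary b) j = ternary (\<lambda>i. b (i + j))"
proof (induction j)
  case (Suc j)
  have "ternary_tail (ternary b) (Suc j) = 3 * (ternary (\<lambda>i. b (i + j)) - of_bool (b j))"
    by (simp add: Suc ternary_ge_1_iff)
  also have "\<dots> = ternary (\<lambda>i. b (i + Suc j))" using ternary_head[of "\<lambda>i. b (i + j)"] by simp
  finally show ?case .
qed simp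

lemma ternary_digit: "ternary_tail (ternary b) j \<ge> 1 \<longleftrightarrow> b j"
  by (simp add: ternary_tail ternary_ge_1_iff)

text \<open>
  A separable complete metric space is a measurable retract of the real line: a point is coded by
  the digits saying which members of a dense sequence are close to it, and is recovered as a limit.
\<close>

lemma real_retract:
  fixes q :: "nat \<Rightarrow> 'a::complete_space"
  assumes dense: "\<And>x e. e > 0 \<Longrightarrow> \<exists>i. dist x (q i) < e"
  obtains \<phi> :: "'a \<Rightarrow> real" and \<psi> :: "real \<Rightarrow> 'a"
  where "\<phi> \<in> borel_measurable borel" "\<psi> \<in> borel_measurable borel" "\<forall>x. \<psi> (\<phi> x) = x"
proof -
  define near where "near x j \<longleftrightarrow> dist x (q (snd (prod_decode j))) < (1 / 2) ^ fst (prod_decode j)" for x j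
  define \<phi> where "\<phi> x = ternary (near x)" for x
  have [measurable]: "(\<lambda>x. dist x a) \<in> borel_measurable borel" for a :: 'a
    by (intro borel_measurable_continuous_onI continuous_intros)
  have \<phi>m: "\<phi> \<in> borel_measurable borel"
    unfolding \<phi>_def ternary_def near_def by measurable
  have tm[measurable]: "(\<lambda>r. ternary_tail r j) \<in> borel_measurable borel" for j
    by (induction j) (simp_all add: of_bool_def)
  define idx where "idx k r = (LEAST i. ternary_tail r (prod_encode (k, i)) \<ge> 1)" for k r
  have im[measurable]: "idx k \<in> borel \<rightarrow>\<^sub>M count_space UNIV" for k
    unfolding idx_def by measurable
  have [measurable]: "(\<lambda>r. q (idx k r)) \<in> borel_measurable borel" for k
    by (rule measurable_compose[OF im]) simp
  define C where "C = {r. \<forall>k. dist (q (idx k r)) (q (idx (Suc k) r)) \<le> 2 * (1 / 2) ^ k}"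
  have C[measurable]: "C \<in> sets borel"
  proof -
    have "(\<lambda>r. dist (q (idx k r)) (q (idx (Suc k) r))) \<in> borel_measurable borel" for k
    proof -
      have "(\<lambda>r. (idx k r, idx (Suc k) r)) \<in> borel \<rightarrow>\<^sub>M count_space UNIV \<Otimes>\<^sub>M count_space UNIV" by measurable
      then have "(\<lambda>r. (idx k r, idx (Suc k) r)) \<in> borel \<rightarrow>\<^sub>M count_space UNIV"
        by (simp add: pair_measure_countable)
      from measurable_compose[OF this, of "\<lambda>(i, j). dist (q i) (q j)" borel] show ?thesis by simp
    qed
    note [measurable] = this
    have "C = {r\<in>space borel. \<forall>k. dist (q (idx k r)) (q (idx (Suc k) r)) \<le> 2 * (1 / 2) ^ k}" by (simp add: C_def)
    also have "\<dots> \<in> sets borel" by measurable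
    finally show ?thesis .
  qed
  \<comment> \<open>Off \<open>C\<close> the approximations need not converge; the constant \<open>q 0\<close> is an arbitrary default there.\<close>
  define p where "p k r = (if r \<in> C then q (idx k r) else q 0)" for k r
  have [measurable]: "p k \<in> borel_measurable borel" for k unfolding p_def by measurable
  define \<psi> where "\<psi> r = lim (\<lambda>k. p k r)" for r
  have conv: "(\<lambda>k. p k r) \<longlonglongrightarrow> \<psi> r" for r
  proof -
    have step: "dist (p k r) (p (Suc k) r) \<le> 2 * (1 / 2) ^ k" for k
      by (auto simp: p_def C_def)
    have far: "dist (p m r) (p (m + n) r) \<le> 4 * (1 / 2) ^ m - 4 * (1 / 2) ^ (m + n)" for m n
    proof (induction n)
      case (Suc n)
      have "dist (p m r) (p (m + Suc n) r) \<le> dist (p m r) (p (m + n) r) + dist (p (m + n) r) (p (Suc (m + n)) r)"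
        by (simp add: dist_triangle)
      then show ?case using Suc step[of "m + n"] by simp
    qed simp
    have far2: "dist (p m r) (p n r) \<le> 4 * (1 / 2) ^ m" if "m \<le> n" for m n
    proof -
      have "dist (p m r) (p n r) \<le> 4 * (1 / 2) ^ m - 4 * (1 / 2) ^ n" using far[of m "n - m"] that by simp
      moreover have "(0::real) \<le> 4 * (1 / 2) ^ n" by simp
      ultimately show ?thesis by linarith
    qed
    have "Cauchy (\<lambda>k. p k r)"
    proof (rule metric_CauchyI)
      fix e :: real assume e: "e > 0"
      have "(\<lambda>m. 8 * (1 / 2 :: real) ^ m) \<longlonglongrightarrow> 8 * 0" by (intro tendsto_intros LIMSEQ_power_zero) auto
      then have "eventually (\<lambda>m. 8 * (1 / 2 :: real) ^ m < e) sequentially" using e by (intro order_tendstoD) auto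
      then obtain N where N: "8 * (1 / 2 :: real) ^ N < e" unfolding eventually_sequentially by blast
      show "\<exists>M. \<forall>m\<ge>M. \<forall>n\<ge>M. dist (p m r) (p n r) < e"
      proof (intro exI allI impI)
        fix m n assume "N \<le> m" "N \<le> n"
        then have "dist (p N r) (p m r) \<le> 4 * (1 / 2) ^ N" "dist (p N r) (p n r) \<le> 4 * (1 / 2) ^ N" using far2 by auto
        moreover have "dist (p m r) (p n r) \<le> dist (p N r) (p m r) + dist (p N r) (p n r)" by (rule dist_triangle3)
        ultimately show "dist (p m r) (p n r) < e" using N by linarith
      qed
    qed
    then show ?thesis unfolding \<psi>_def by (simp add: Cauchy_convergent_iff convergent_LIMSEQ_iff)
  qed
  have \<psi>m: "\<psi> \<in> borel_measurable borel"
    by (rule borel_measurable_LIMSEQ_metric[where f=p]) (use conv in auto)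
  moreover have "\<psi> (\<phi> x) = x" for x
  proof -
    have close: "dist x (q (idx k (\<phi> x))) < (1 / 2) ^ k" for k
    proof -
      have iff: "ternary_tail (\<phi> x) (prod_encode (k, i)) \<ge> 1 \<longleftrightarrow> dist x (q i) < (1 / 2) ^ k" for i
        unfolding \<phi>_def ternary_digit by (simp add: near_def)
      obtain i where "dist x (q i) < (1 / 2) ^ k" using dense[of "(1 / 2) ^ k" x] by auto
      then show ?thesis unfolding idx_def iff by (rule LeastI)
    qed
    have "dist (q (idx k (\<phi> x))) (q (idx (Suc k) (\<phi> x))) \<le> 2 * (1 / 2) ^ k" for k
    proof -
      have "dist (q (idx k (\<phi> x))) (q (idx (Suc k) (\<phi> x))) \<le> dist x (q (idx k (\<phi> x))) + dist x (q (idx (Suc k) (\<phi> x)))"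
        by (rule dist_triangle3)
      also have "\<dots> \<le> (1 / 2) ^ k + (1 / 2) ^ Suc k" using close[of k] close[of "Suc k"] by linarith
      also have "\<dots> \<le> 2 * (1 / 2) ^ k" by simp
      finally show ?thesis .
    qed
    then have "\<phi> x \<in> C" by (simp add: C_def)
    then have pk: "p k (\<phi> x) = q (idx k (\<phi> x))" for k by (simp add: p_def)
    have "(\<lambda>k. p k (\<phi> x)) \<longlonglongrightarrow> x"
    proof (rule tendstoI)
      fix e :: real assume e: "e > 0"
      have "(\<lambda>m. (1 / 2 :: real) ^ m) \<longlonglongrightarrow> 0" by (intro LIMSEQ_power_zero) auto
      from order_tendstoD(2)[OF this e]
      show "eventually (\<lambda>k. dist (p k (\<phi> x)) x < e) sequentially"
        by eventually_elim (metis close pk dist_commute less_trans)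
    qed
    then show ?thesis using conv LIMSEQ_unique by blast
  qed
  ultimately show thesis using that[OF \<phi>m] by blast
qed

lemma borel_eq_rational_atMost:
  "sets (borel :: real measure) = sigma_sets UNIV (range (\<lambda>q::rat. {..of_rat q}))"
proof -
  define N where "N = sigma UNIV (range (\<lambda>q::rat. {..of_rat q :: real}))"
  have "{..a} \<in> sets N" for a :: real
  proof -
    have eq: "{..a} = (\<Inter>q\<in>{q::rat. a < of_rat q}. {..of_rat q})"
    proof (intro equalityI subsetI)
      fix x :: real assume x: "x \<in> (\<Inter>q\<in>{q::rat. a < of_rat q}. {..of_rat q})"
      show "x \<in> {..a}"
      proof (rule ccontr)
        assume "x \<notin> {..a}"
        then have "a < x" by simp
        from of_rat_dense[OF this] obtain q where "a < of_rat q" "of_rat q < x" by blast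
        then show False using x by force
      qed
    qed auto
    have "{q::rat. a < of_rat q} \<noteq> {}" using of_rat_dense[of a "a + 1"] by auto
    then show ?thesis unfolding eq
      by (intro sets.countable_INT') (auto simp: N_def)
  qed
  moreover have spN: "space N = UNIV" by (simp add: N_def space_measure_of_conv)
  ultimately have "sigma_sets UNIV (range (\<lambda>a::real. {..a})) \<subseteq> sets N"
    using sets.sigma_sets_subset[of "range (\<lambda>a::real. {..a})" N] by auto
  moreover have "sets (borel :: real measure) = sigma_sets UNIV (range (\<lambda>a::real. {..a}))"
    unfolding borel_eq_atMost by simp
  moreover have "sigma_sets UNIV (range (\<lambda>q::rat. {..of_rat q :: real})) \<subseteq> sets borel"
    using sets.sigma_sets_subset[of "range (\<lambda>q::rat. {..of_rat q :: real})" borel]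
    by (simp add: image_subset_iff)
  moreover have "sets N = sigma_sets UNIV (range (\<lambda>q::rat. {..of_rat q :: real}))" by (simp add: N_def)
  ultimately show ?thesis by blast
qed

context flow_joining
begin

text \<open>
  The mass that the conditional measure on a fibre gives to the point itself is an invariant function.
  When some set of positive measure has countable fibres it does not vanish, so by ergodicity it is
  bounded below almost everywhere, and a probability measure has only finitely many atoms of
  at least a given mass.
\<close>

lemma finite_extension_if_countable_fibres:
  fixes \<phi> :: "'a \<Rightarrow> real" and \<psi> :: "real \<Rightarrow> 'a"
  assumes \<phi>: "\<phi> \<in> borel_measurable borel" and \<psi>: "\<psi> \<in> borel_measurable borel" and retract: "\<And>x. \<psi> (\<phi> x) = x"
    and single: "\<And>y. y \<in> space \<nu> \<Longrightarrow> {y} \<in> sets \<nu>"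
    and erg: "ergodic_flow \<rho> (prod_flow T S)"
    and E: "E \<in> sets \<rho>" "rho.prob E > 0" "\<And>y. countable {x. (x, y) \<in> E}"
  shows "finite_extension \<rho> (prod_flow T S) \<nu> S snd"
proof -
  have \<phi>m[measurable]: "\<phi> \<in> borel_measurable \<mu>" using \<phi> by (simp add: measurable_cong_sets[OF sets_mu refl])
  have \<psi>m[measurable]: "\<psi> \<in> borel \<rightarrow>\<^sub>M \<mu>" using \<psi> by (simp add: measurable_cong_sets[OF refl sets_mu])
  have "(\<lambda>z. \<phi> (fst z)) \<in> borel_measurable \<rho>" by measurable
  from rho.real_conditional_distribution[OF nu.prob_space_axioms measurable_snd_rho distr_snd this]
  obtain \<kappa> :: "'b \<Rightarrow> real measure" where \<kappa>[measurable]: "\<kappa> \<in> \<nu> \<rightarrow>\<^sub>M prob_algebra borel"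
    and \<kappa>_int: "\<And>x B. B \<in> sets \<nu> \<Longrightarrow> (\<integral>\<^sup>+y. emeasure (\<kappa> y) {..x} * indicator B y \<partial>\<nu>) = emeasure \<rho> {z\<in>space \<rho>. \<phi> (fst z) \<le> x \<and> snd z \<in> B}"
    by blast
  define k' where "k' y = distr (\<kappa> y) \<mu> \<psi>" for y
  define k where "k y = distr (k' y) \<rho> (\<lambda>x. (x, y))" for y
  have k'm[measurable]: "k' \<in> \<nu> \<rightarrow>\<^sub>M prob_algebra \<mu>"
    unfolding k'_def by (rule measurable_compose[OF \<kappa> measurable_distr_prob_space[OF \<psi>m]])
  have pairm: "(\<lambda>(y, x). (x, y)) \<in> \<nu> \<Otimes>\<^sub>M \<mu> \<rightarrow>\<^sub>M \<rho>"
    by (simp add: measurable_cong_sets[OF refl sets_rho])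
  have km[measurable]: "k \<in> \<nu> \<rightarrow>\<^sub>M prob_algebra \<rho>"
    unfolding k_def by (rule measurable_distr_prob_space2[OF k'm pairm])
  have \<kappa>_sets: "sets (\<kappa> y) = sets borel" and \<kappa>_prob: "prob_space (\<kappa> y)" if "y \<in> space \<nu>" for y
    using measurable_space[OF \<kappa> that] by (auto simp: space_prob_algebra)
  have k'_sets: "sets (k' y) = sets \<mu>" and k'_prob: "prob_space (k' y)" if "y \<in> space \<nu>" for y
    using measurable_space[OF k'm that] by (auto simp: space_prob_algebra)
  have secm: "{x. (x, y) \<in> A} \<in> sets \<mu>" if "A \<in> sets \<rho>" "y \<in> space \<nu>" for A y
  proof -
    have "(\<lambda>x. (x, y)) \<in> \<mu> \<rightarrow>\<^sub>M \<rho>" using that(2) by (simp add: measurable_cong_sets[OF refl sets_rho])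
    from measurable_sets[OF this that(1)] show ?thesis by (simp add: vimage_def)
  qed
  have k_k': "emeasure (k y) A = emeasure (k' y) {x. (x, y) \<in> A}" if "A \<in> sets \<rho>" "y \<in> space \<nu>" for A y
  proof -
    have "(\<lambda>x. (x, y)) \<in> k' y \<rightarrow>\<^sub>M \<rho>"
      using that(2) by (simp add: measurable_cong_sets[OF k'_sets[OF that(2)] sets_rho])
    moreover have "space (k' y) = UNIV" using sets_eq_imp_space_eq[OF k'_sets[OF that(2)]] by simp
    ultimately show ?thesis unfolding k_def using that(1) by (subst emeasure_distr) (auto simp: vimage_def)
  qed
  have disint: "emeasure \<rho> A = (\<integral>\<^sup>+y. emeasure (k y) A \<partial>\<nu>)" if A: "A \<in> sets \<rho>" for A
  proof -
    define L where "L = (borel :: real measure) \<Otimes>\<^sub>M \<nu>"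
    define K where "K y = distr (\<kappa> y) L (\<lambda>u. (u, y))" for y
    define m1 where "m1 = distr \<rho> L (\<lambda>z. (\<phi> (fst z), snd z))"
    define m2 where "m2 = \<nu> \<bind> K"
    have Km[measurable]: "K \<in> \<nu> \<rightarrow>\<^sub>M prob_algebra L"
      unfolding K_def L_def by (rule measurable_distr_prob_space2[OF \<kappa>]) measurable
    have \<nu>_in: "\<nu> \<in> space (prob_algebra \<nu>)" using nu.prob_space_axioms by (simp add: space_prob_algebra)
    have em2: "emeasure m2 X = (\<integral>\<^sup>+y. emeasure (K y) X \<partial>\<nu>)" if "X \<in> sets L" for X
      unfolding m2_def by (rule emeasure_bind_prob_algebra[OF \<nu>_in Km that])
    have K\<kappa>: "emeasure (K y) X = emeasure (\<kappa> y) {u. (u, y) \<in> X}" if X: "X \<in> sets L" and y: "y \<in> space \<nu>" for X y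
    proof -
      have "(\<lambda>u. (u, y)) \<in> \<kappa> y \<rightarrow>\<^sub>M L" using y unfolding L_def
        by (simp add: measurable_cong_sets[OF \<kappa>_sets[OF y] refl])
      moreover have "space (\<kappa> y) = UNIV" using sets_eq_imp_space_eq[OF \<kappa>_sets[OF y]] by simp
      ultimately show ?thesis unfolding K_def using X by (subst emeasure_distr) (auto simp: vimage_def)
    qed
    let ?E = "{a \<times> b |a b. a \<in> range (\<lambda>x::real. {..x}) \<and> b \<in> sets \<nu>}"
    have "m1 = m2"
    proof (rule measure_eqI_generator_eq[where \<Omega>="UNIV \<times> space \<nu>" and E="?E"
          and A="\<lambda>n. {..real n} \<times> space \<nu>"])
      show "Int_stable ?E"
      proof (rule Int_stableI)
        fix a b assume "a \<in> ?E"
          "b \<in> ?E"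
        then obtain x B x' B' where *: "a = {..x} \<times> B" "b = {..x'} \<times> B'" "B \<in> sets \<nu>" "B' \<in> sets \<nu>" by auto
        then have "a \<inter> b = {..min x x'} \<times> (B \<inter> B')" by auto
        then show "a \<inter> b \<in> ?E" using * by blast
      qed
      show "?E \<subseteq> Pow (UNIV \<times> space \<nu>)"
        using sets.sets_into_space by fastforce
      have gen: "sets L = sigma_sets (UNIV \<times> space \<nu>) ?E"
      proof -
        have "sets L = sets (sigma (space borel \<times> space \<nu>) ?E)"
          unfolding L_def
        proof (rule sets_pair_eq[where Ca="range (\<lambda>n::nat. {..real n})" and Cb="{space \<nu>}"])
          show "sets borel = sigma_sets (space borel) (range (\<lambda>x::real. {..x}))" unfolding borel_eq_atMost by simp
          show "\<Union> (range (\<lambda>n. {..real n})) = space borel" using real_arch_simple by auto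
          show "sets \<nu> = sigma_sets (space \<nu>) (sets \<nu>)" by (simp add: sets.sigma_sets_eq)
        qed (auto simp: sets.space_closed)
        also have "\<dots> = sigma_sets (UNIV \<times> space \<nu>) ?E"
          by (subst sets_measure_of) (use sets.sets_into_space in fastforce)+
        finally show ?thesis .
      qed
      show "sets m1 = sigma_sets (UNIV \<times> space \<nu>) ?E"
        unfolding m1_def using gen by simp
      show "sets m2 = sigma_sets (UNIV \<times> space \<nu>) ?E"
        unfolding gen[symmetric] m2_def by (rule sets_bind'[OF \<nu>_in Km])
      show "range (\<lambda>n. {..real n} \<times> space \<nu>) \<subseteq> ?E" by blast
      show "(\<Union>n. {..real n} \<times> space \<nu>) = UNIV \<times> space \<nu>" using real_arch_simple by auto
      have m1m: "(\<lambda>z. (\<phi> (fst z), snd z)) \<in> \<rho> \<rightarrow>\<^sub>M L" unfolding L_def by measurable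
      have "prob_space m1" unfolding m1_def by (rule rho.prob_space_distr[OF m1m])
      then interpret m1: prob_space m1 .
      show "emeasure m1 ({..real n} \<times> space \<nu>) \<noteq> \<infinity>" for n by simp
      fix X assume "X \<in> ?E"
      then obtain x B where X: "X = {..x} \<times> B" and B: "B \<in> sets \<nu>" by auto
      have XL: "X \<in> sets L" unfolding X L_def using B by auto
      have "emeasure m1 X = emeasure \<rho> {z\<in>space \<rho>. \<phi> (fst z) \<le> x \<and> snd z \<in> B}"
        unfolding m1_def by (subst emeasure_distr[OF m1m XL]) (auto intro!: arg_cong[of _ _ "emeasure \<rho>"] simp: X)
      also have "\<dots> = (\<integral>\<^sup>+y. emeasure (\<kappa> y) {..x} * indicator B y \<partial>\<nu>)" by (rule \<kappa>_int[OF B, symmetric])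
      also have "\<dots> = (\<integral>\<^sup>+y. emeasure (K y) X \<partial>\<nu>)"
      proof (rule nn_integral_cong)
        fix y assume y: "y \<in> space \<nu>"
        have "{u. (u, y) \<in> X} = (if y \<in> B then {..x} else {})" by (auto simp: X)
        then show "emeasure (\<kappa> y) {..x} * indicator B y = emeasure (K y) X"
          unfolding K\<kappa>[OF XL y] by simp
      qed
      also have "\<dots> = emeasure m2 X" by (rule em2[OF XL, symmetric])
      finally show "emeasure m1 X = emeasure m2 X" .
    qed
    define A' where "A' = {p\<in>space L. (\<psi> (fst p), snd p) \<in> A}"
    have "(\<lambda>p. (\<psi> (fst p), snd p)) \<in> L \<rightarrow>\<^sub>M \<rho>" unfolding L_def
      by (simp add: measurable_cong_sets[OF refl sets_rho])
    from measurable_sets[OF this A] have A'L: "A' \<in> sets L"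
      unfolding A'_def by (simp add: vimage_def Int_def conj_commute)
    have m1m: "(\<lambda>z. (\<phi> (fst z), snd z)) \<in> \<rho> \<rightarrow>\<^sub>M L" unfolding L_def by measurable
    have spL: "space L = UNIV \<times> space \<nu>" unfolding L_def by (simp add: space_pair_measure)
    have Asp: "A \<subseteq> UNIV \<times> space \<nu>" using sets.sets_into_space[OF A] by (simp add: space_rho)
    have "emeasure \<rho> A = emeasure m1 A'"
      unfolding m1_def by (subst emeasure_distr[OF m1m A'L])
        (use Asp in \<open>auto intro!: arg_cong[of _ _ "emeasure \<rho>"] simp: A'_def spL space_rho retract\<close>)
    also have "\<dots> = (\<integral>\<^sup>+y. emeasure (K y) A' \<partial>\<nu>)" unfolding \<open>m1 = m2\<close> by (rule em2[OF A'L])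
    also have "\<dots> = (\<integral>\<^sup>+y. emeasure (k y) A \<partial>\<nu>)"
    proof (rule nn_integral_cong)
      fix y assume y: "y \<in> space \<nu>"
      have \<psi>k: "\<psi> \<in> \<kappa> y \<rightarrow>\<^sub>M \<mu>" by (simp add: measurable_cong_sets[OF \<kappa>_sets[OF y] refl])
      have sp: "space (\<kappa> y) = UNIV" using sets_eq_imp_space_eq[OF \<kappa>_sets[OF y]] by simp
      have "emeasure (k y) A = emeasure (\<kappa> y) {u. (\<psi> u, y) \<in> A}"
        unfolding k_k'[OF A y] k'_def by (subst emeasure_distr[OF \<psi>k secm[OF A y]]) (simp add: vimage_def sp)
      then show "emeasure (K y) A' = emeasure (k y) A"
        using K\<kappa>[OF A'L y] y by (simp add: A'_def spL)
    qed
    finally show ?thesis .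
  qed
  have disint': "emeasure \<rho> A = (\<integral>\<^sup>+y. emeasure (k' y) {x. (x, y) \<in> A} \<partial>\<nu>)" if A: "A \<in> sets \<rho>" for A
    unfolding disint[OF A] by (rule nn_integral_cong) (rule k_k'[OF A])
  define \<Phi> where "\<Phi> z = measure (k' (snd z)) {fst z}" for z
  have \<Phi>m[measurable]: "\<Phi> \<in> borel_measurable \<rho>"
    unfolding \<Phi>_def
  proof (rule measure_measurable_prob_algebra2)
    show "(\<lambda>z. k' (snd z)) \<in> \<rho> \<rightarrow>\<^sub>M prob_algebra \<mu>" by measurable
    have inj: "\<phi> x = \<phi> x' \<longleftrightarrow> x = x'" for x x' by (metis retract)
    have "(SIGMA z:space \<rho>. {fst z}) = {p\<in>space (\<rho> \<Otimes>\<^sub>M \<mu>). \<phi> (fst (fst p)) = \<phi> (snd p)}"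
      by (auto simp: inj space_pair_measure)
    also have "\<dots> \<in> sets (\<rho> \<Otimes>\<^sub>M \<mu>)" by measurable
    finally show "(SIGMA z:space \<rho>. {fst z}) \<in> sets (\<rho> \<Otimes>\<^sub>M \<mu>)" .
  qed
  have inv: "AE z in \<rho>. \<Phi> (prod_flow T S t z) = \<Phi> z" for t
  proof -
    have AEq: "AE y in \<nu>. emeasure (k' (S t y)) {x. \<phi> x \<le> q} = emeasure (k' y) {x. \<phi> (T t x) \<le> q}" for q :: real
    proof -
      have A[measurable]: "{x. \<phi> x \<le> q} \<in> sets \<mu>" and At[measurable]: "{x. \<phi> (T t x) \<le> q} \<in> sets \<mu>"
      proof -
        have "{x\<in>space \<mu>. \<phi> x \<le> q} \<in> sets \<mu>" "{x\<in>space \<mu>. \<phi> (T t x) \<le> q} \<in> sets \<mu>" by measurable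
        then show "{x. \<phi> x \<le> q} \<in> sets \<mu>" "{x. \<phi> (T t x) \<le> q} \<in> sets \<mu>" by simp_all
      qed
      have [measurable]: "k' \<in> \<nu> \<rightarrow>\<^sub>M subprob_algebra \<mu>" by (rule measurable_prob_algebraD[OF k'm])
      define h1 where "h1 y = emeasure (k' (S t y)) {x. \<phi> x \<le> q}" for y
      define h2 where "h2 y = emeasure (k' y) {x. \<phi> (T t x) \<le> q}" for y
      have h[measurable]: "h1 \<in> borel_measurable \<nu>" "h2 \<in> borel_measurable \<nu>"
        unfolding h1_def h2_def by measurable
      have "density \<nu> h1 = density \<nu> h2"
      proof (rule measure_eqI)
        fix B assume "B \<in> sets (density \<nu> h1)"
        then have B[measurable]: "B \<in> sets \<nu>" by simp
        define B' where "B' = {y\<in>space \<nu>. S (- t) y \<in> B}"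
        have B'[measurable]: "B' \<in> sets \<nu>" unfolding B'_def by measurable
        have BB': "S t y \<in> B' \<longleftrightarrow> y \<in> B" if "y \<in> space \<nu>" for y
          using that nu.flow_add[of y "- t" t] nu.flow_0[of y] nu.flow_space[of y t] by (simp add: B'_def)
        have R1: "{x. \<phi> x \<le> q} \<times> B' \<in> sets \<rho>" and R2: "{x. \<phi> (T t x) \<le> q} \<times> B \<in> sets \<rho>"
          unfolding sets_rho using A At by auto
        have "emeasure (density \<nu> h1) B = (\<integral>\<^sup>+y. h1 y * indicator B y \<partial>\<nu>)" by (rule emeasure_density) auto
        also have "\<dots> = (\<integral>\<^sup>+y. emeasure (k' (S t y)) {x. \<phi> x \<le> q} * indicator B' (S t y) \<partial>\<nu>)"
          by (rule nn_integral_cong) (auto simp: h1_def indicator_def BB')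
        also have "\<dots> = (\<integral>\<^sup>+y. emeasure (k' y) {x. \<phi> x \<le> q} * indicator B' y \<partial>distr \<nu> \<nu> (S t))"
          by (rule nn_integral_distr[symmetric]) measurable
        also have "\<dots> = (\<integral>\<^sup>+y. emeasure (k' y) {x. (x, y) \<in> {x. \<phi> x \<le> q} \<times> B'} \<partial>\<nu>)"
          unfolding nu.flow_distr by (rule nn_integral_cong) (auto simp: indicator_def)
        also have "\<dots> = emeasure \<rho> ({x. \<phi> x \<le> q} \<times> B')" by (rule disint'[OF R1, symmetric])
        also have "\<dots> = emeasure \<rho> {z\<in>space \<rho>. prod_flow T S t z \<in> {x. \<phi> x \<le> q} \<times> B'}"
          by (rule rho.emeasure_flow[OF R1, symmetric])
        also have "{z\<in>space \<rho>. prod_flow T S t z \<in> {x. \<phi> x \<le> q} \<times> B'} = {x. \<phi> (T t x) \<le> q} \<times> B"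
          using sets.sets_into_space[OF B] BB' by (auto simp: space_rho prod_flow_def)
        also have "emeasure \<rho> ({x. \<phi> (T t x) \<le> q} \<times> B) = (\<integral>\<^sup>+y. emeasure (k' y) {x. (x, y) \<in> {x. \<phi> (T t x) \<le> q} \<times> B} \<partial>\<nu>)"
          by (rule disint'[OF R2])
        also have "\<dots> = (\<integral>\<^sup>+y. h2 y * indicator B y \<partial>\<nu>)"
          by (rule nn_integral_cong) (auto simp: h2_def indicator_def)
        also have "\<dots> = emeasure (density \<nu> h2) B" by (rule emeasure_density[symmetric]) auto
        finally show "emeasure (density \<nu> h1) B = emeasure (density \<nu> h2) B" .
      qed simp
      then have "AE y in \<nu>. h1 y = h2 y" using nu.density_unique_iff[OF h] by simp
      then show ?thesis by (simp add: h1_def h2_def)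
    qed
    have "AE y in \<nu>. \<forall>q::rat. emeasure (k' (S t y)) {x. \<phi> x \<le> of_rat q} = emeasure (k' y) {x. \<phi> (T t x) \<le> of_rat q}"
      unfolding AE_all_countable using AEq by blast
    then have AEy: "AE y in \<nu>. \<forall>x. measure (k' (S t y)) {T t x} = measure (k' y) {x}"
      using AE_space
    proof eventually_elim
      case (elim y)
      then have y: "y \<in> space \<nu>" and Sy: "S t y \<in> space \<nu>" using nu.flow_space by auto
      define n1 where "n1 = distr (k' (S t y)) borel \<phi>"
      define n2 where "n2 = distr (k' y) borel (\<lambda>x. \<phi> (T t x))"
      have f1: "\<phi> \<in> k' (S t y) \<rightarrow>\<^sub>M borel" by (simp add: measurable_cong_sets[OF k'_sets[OF Sy] refl])
      have f2: "(\<lambda>x. \<phi> (T t x)) \<in> k' y \<rightarrow>\<^sub>M borel" by (simp add: measurable_cong_sets[OF k'_sets[OF y] refl])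
      have sp: "space (k' (S t y)) = UNIV" "space (k' y) = UNIV"
        using sets_eq_imp_space_eq[OF k'_sets[OF Sy]] sets_eq_imp_space_eq[OF k'_sets[OF y]] by auto
      have e1: "emeasure n1 X = emeasure (k' (S t y)) {x. \<phi> x \<in> X}" if "X \<in> sets borel" for X
        unfolding n1_def by (subst emeasure_distr[OF f1 that]) (simp add: sp vimage_def)
      have e2: "emeasure n2 X = emeasure (k' y) {x. \<phi> (T t x) \<in> X}" if "X \<in> sets borel" for X
        unfolding n2_def by (subst emeasure_distr[OF f2 that]) (simp add: sp vimage_def)
      have "n1 = n2"
      proof (rule measure_eqI_generator_eq_countable[where E="range (\<lambda>q::rat. {..of_rat q})" and \<Omega>=UNIV and A="range (\<lambda>q::rat. {..of_rat q})"])
        show "Int_stable (range (\<lambda>q::rat. {..of_rat q :: real}))"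
        proof (rule Int_stableI)
          fix a b assume "a \<in> range (\<lambda>q::rat. {..of_rat q :: real})" "b \<in> range (\<lambda>q::rat. {..of_rat q :: real})"
          then obtain p q where "a = {..of_rat p}" "b = {..of_rat q}" by auto
          then have "a \<inter> b = {..of_rat (min p q)}" by (auto simp: min_def of_rat_less_eq)
          then show "a \<inter> b \<in> range (\<lambda>q::rat. {..of_rat q :: real})" by blast
        qed
        show "emeasure n1 X = emeasure n2 X" if "X \<in> range (\<lambda>q::rat. {..of_rat q})" for X
          using that elim by (auto simp: e1 e2)
        show "sets n1 = sigma_sets UNIV (range (\<lambda>q::rat. {..of_rat q}))" "sets n2 = sigma_sets UNIV (range (\<lambda>q::rat. {..of_rat q}))"
          unfolding n1_def n2_def by (simp_all add: borel_eq_rational_atMost)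
        show "\<Union> (range (\<lambda>q::rat. {..of_rat q :: real})) = UNIV"
        proof -
          have "\<exists>q::rat. x \<le> of_rat q" for x :: real using of_rat_dense[of x "x + 1"] by (auto intro: less_imp_le)
          then show ?thesis by auto
        qed
        have "prob_space n1" unfolding n1_def by (rule prob_space.prob_space_distr[OF k'_prob[OF Sy] f1])
        then interpret n1: prob_space n1 .
        show "emeasure n1 a \<noteq> \<infinity>" for a by simp
      qed auto
      \<comment> \<open>Both sides are masses of the atom coded by \<open>\<phi> (T t x)\<close>.\<close>
      have inj: "\<phi> x = \<phi> x' \<longleftrightarrow> x = x'" for x x' by (metis retract)
      have injT: "T t x' = T t x \<longleftrightarrow> x' = x" for x x' using T_add[of "- t" t] by (metis T_0 add.left_inverse)
      show ?case
      proof
        fix x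
        have "emeasure (k' (S t y)) {T t x} = emeasure n1 {\<phi> (T t x)}" by (simp add: e1 inj)
        also have "\<dots> = emeasure (k' y) {x}" unfolding \<open>n1 = n2\<close> by (simp add: e2 inj injT)
        finally show "measure (k' (S t y)) {T t x} = measure (k' y) {x}" by (simp add: measure_def)
      qed
    qed
    have "AE z in \<rho>. \<forall>x. measure (k' (S t (snd z))) {T t x} = measure (k' (snd z)) {x}"
      by (rule AE_distrD[of snd \<rho> \<nu>]) (measurable, subst distr_snd, rule AEy)
    then show ?thesis by eventually_elim (simp add: \<Phi>_def prod_flow_def)
  qed
  have atoms: "\<exists>c>0. rho.prob {z\<in>space \<rho>. \<Phi> z > c} > 0"
  proof (rule ccontr)
    assume no: "\<not> ?thesis"
    have "AE z in \<rho>. \<Phi> z \<le> inverse (real (Suc n))" for n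
    proof -
      have [measurable]: "{z\<in>space \<rho>. \<Phi> z > inverse (real (Suc n))} \<in> sets \<rho>" by measurable
      have "rho.prob {z\<in>space \<rho>. \<Phi> z > inverse (real (Suc n))} = 0"
      proof -
        have "inverse (real (Suc n)) > 0" by simp
        with no have "\<not> rho.prob {z\<in>space \<rho>. \<Phi> z > inverse (real (Suc n))} > 0" by blast
        then show ?thesis
          using measure_nonneg[of \<rho> "{z\<in>space \<rho>. \<Phi> z > inverse (real (Suc n))}"] by linarith
      qed
      then have "AE z in \<rho>. z \<notin> {z\<in>space \<rho>. \<Phi> z > inverse (real (Suc n))}" by (subst (asm) rho.prob_eq_0) auto
      then show ?thesis using AE_space by eventually_elim auto
    qed
    then have "AE z in \<rho>. \<forall>n. \<Phi> z \<le> inverse (real (Suc n))" unfolding AE_all_countable by blast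
    then have AE0: "AE z in \<rho>. \<Phi> z = 0"
    proof eventually_elim
      case (elim z)
      have "\<not> 0 < \<Phi> z"
      proof
        assume "0 < \<Phi> z"
        from reals_Archimedean[OF this] obtain n where "inverse (real (Suc n)) < \<Phi> z" by blast
        with elim show False by (meson not_le)
      qed
      moreover have "0 \<le> \<Phi> z" by (simp add: \<Phi>_def)
      ultimately show ?case by simp
    qed
    note [measurable] = E(1)
    define E0 where "E0 = {z\<in>space \<rho>. z \<in> E \<and> \<Phi> z = 0}"
    have E0[measurable]: "E0 \<in> sets \<rho>" unfolding E0_def by measurable
    have "rho.prob E = rho.prob E0"
      by (rule measure_eq_AE) (use AE0 AE_space in \<open>eventually_elim, auto simp: E0_def\<close>)
    moreover have "emeasure \<rho> E0 = (\<integral>\<^sup>+y. 0 \<partial>\<nu>)"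
      unfolding disint'[OF E0]
    proof (rule nn_integral_cong)
      fix y assume y: "y \<in> space \<nu>"
      interpret ky: prob_space "k' y" by (rule k'_prob[OF y])
      have "{x} \<in> null_sets (k' y)" if "(x, y) \<in> E0" for x
      proof -
        have "measure (k' y) {x} = 0" using that by (simp add: E0_def \<Phi>_def)
        moreover have "{x} \<in> sets (k' y)" unfolding k'_sets[OF y] sets_mu by simp
        ultimately show ?thesis by (simp add: null_sets_def ky.emeasure_eq_measure)
      qed
      moreover have "countable {x. (x, y) \<in> E0}"
        by (rule countable_subset[OF _ E(3)[of y]]) (auto simp: E0_def)
      ultimately have "(\<Union>x\<in>{x. (x, y) \<in> E0}. {x}) \<in> null_sets (k' y)" by (intro null_sets_UN') auto
      then have "{x. (x, y) \<in> E0} \<in> null_sets (k' y)" by simp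
      then show "emeasure (k' y) {x. (x, y) \<in> E0} = 0" by (rule null_setsD1)
    qed
    ultimately show False using E(2) by (simp add: measure_def)
  qed
  then obtain c where c: "c > 0" "rho.prob {z\<in>space \<rho>. \<Phi> z > c} > 0" by blast
  define A where "A = {z\<in>space \<rho>. \<Phi> z > c}"
  have A[measurable]: "A \<in> sets \<rho>" unfolding A_def by measurable
  have "AE z in \<rho>. prod_flow T S t z \<in> A \<longleftrightarrow> z \<in> A" for t
    using inv[of t] AE_space by eventually_elim (use rho.flow_space in \<open>auto simp: A_def\<close>)
  then have "rho.prob A = 1" using erg A c(2) unfolding ergodic_flow_def A_def[symmetric] by fastforce
  then have e1: "(\<integral>\<^sup>+y. emeasure (k' y) {x. (x, y) \<in> A} \<partial>\<nu>) = 1"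
    using disint'[OF A] by (simp add: rho.emeasure_eq_measure)
  have le1: "emeasure (k' y) {x. (x, y) \<in> A} \<le> 1" if "y \<in> space \<nu>" for y
    using prob_space.emeasure_le_1[OF k'_prob[OF that]] .
  have AE1: "AE y in \<nu>. emeasure (k' y) {x. (x, y) \<in> A} = 1"
  proof -
    have m[measurable]: "(\<lambda>y. emeasure (k' y) {x. (x, y) \<in> A}) \<in> borel_measurable \<nu>"
    proof -
      have "(\<lambda>y. emeasure (k y) A) \<in> borel_measurable \<nu>"
        using measurable_prob_algebraD[OF km] A by measurable
      then show ?thesis by (simp add: k_k'[OF A] cong: measurable_cong)
    qed
    have "(\<integral>\<^sup>+y. 1 - emeasure (k' y) {x. (x, y) \<in> A} \<partial>\<nu>) = (\<integral>\<^sup>+y. 1 \<partial>\<nu>) - (\<integral>\<^sup>+y. emeasure (k' y) {x. (x, y) \<in> A} \<partial>\<nu>)"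
      by (rule nn_integral_diff) (use le1 e1 in auto)
    also have "\<dots> = 0" by (simp add: e1 nu.emeasure_space_1)
    finally have "AE y in \<nu>. 1 - emeasure (k' y) {x. (x, y) \<in> A} = 0"
      by (subst (asm) nn_integral_0_iff_AE) auto
    then show ?thesis using AE_space
    proof eventually_elim
      case (elim y)
      then have "1 \<le> emeasure (k' y) {x. (x, y) \<in> A}" by (simp add: diff_eq_0_iff_ennreal)
      then show ?case using le1[OF elim(2)] by (rule antisym[rotated])
    qed
  qed
  have fib: "AE y in \<nu>. \<exists>F\<subseteq>space \<rho>. finite F \<and> emeasure (k y) F = 1"
    using AE1 AE_space
  proof eventually_elim
    case (elim y)
    then have y: "y \<in> space \<nu>" by simp
    interpret ky: prob_space "k' y" by (rule k'_prob[OF y])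
    have s1: "{x} \<in> sets (k' y)" for x unfolding k'_sets[OF y] sets_mu by simp
    define F where "F = {x. (x, y) \<in> A}"
    have Fc: "measure (k' y) {x} > c" if "x \<in> F" for x using that by (simp add: F_def A_def \<Phi>_def)
    have "finite F"
    proof (rule ccontr)
      assume inf: "infinite F"
      obtain n :: nat where n: "real n > 1 / c" using reals_Archimedean2 by blast
      obtain F' where F': "F' \<subseteq> F" "finite F'" "card F' = n" using infinite_arbitrarily_large[OF inf] by blast
      have "real n * c \<le> (\<Sum>x\<in>F'. measure (k' y) {x})"
        unfolding F'(3)[symmetric] by (rule sum_bounded_below) (use Fc F'(1) in \<open>auto intro: less_imp_le\<close>)
      also have "\<dots> = measure (k' y) F'"
        by (rule ky.finite_measure_eq_sum_singleton[symmetric]) (use F' s1 in auto)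
      also have "\<dots> \<le> 1" by (rule ky.prob_le_1)
      finally show False using n c(1) by (simp add: field_simps)
    qed
    then have fin: "finite (F \<times> {y})" by simp
    have sub: "F \<times> {y} \<subseteq> space \<rho>" using y by (auto simp: space_rho)
    have "F \<times> {y} \<in> sets \<rho>" unfolding sets_rho
      using secm[OF A y] single[OF y] by (intro pair_measureI) (auto simp: F_def)
    then have "emeasure (k y) (F \<times> {y}) = 1" using elim by (subst k_k'[OF _ y]) (auto simp: F_def)
    then show ?case using fin sub by blast
  qed
  have "AE y in \<nu>. emeasure (k y) (snd -` {y} \<inter> space \<rho>) = 1"
  proof (rule AE_I2)
    fix y assume y: "y \<in> space \<nu>"
    interpret ky: prob_space "k' y" by (rule k'_prob[OF y])
    have "snd -` {y} \<inter> space \<rho> \<in> sets \<rho>" by (rule measurable_sets[OF measurable_snd_rho single[OF y]])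
    from k_k'[OF this y] have "emeasure (k y) (snd -` {y} \<inter> space \<rho>) = emeasure (k' y) UNIV"
      using y by (simp add: space_rho)
    also have "\<dots> = 1" using ky.emeasure_space_1 sets_eq_imp_space_eq[OF k'_sets[OF y]] by simp
    finally show "emeasure (k y) (snd -` {y} \<inter> space \<rho>) = 1" .
  qed
  then have "disintegration \<rho> \<nu> snd k" unfolding disintegration_def using km disint by blast
  moreover have "factor_map \<rho> (prod_flow T S) \<nu> S snd"
    unfolding factor_map_def using rho.flow nu.flow measurable_snd_rho distr_snd
    by (auto simp: prod_flow_def)
  ultimately show ?thesis unfolding finite_extension_def using fib by blast
qed

end

section \<open>Joinings of flows with the SWR-property\<close>

lemma sigma_compact_dense_sequence:
  assumes "sigma_compact (UNIV :: 'a::metric_space set)"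
  obtains q :: "nat \<Rightarrow> 'a::metric_space" where "\<And>x e. e > 0 \<Longrightarrow> \<exists>i. dist x (q i) < e"
proof -
  obtain K :: "nat \<Rightarrow> 'a set" where K: "\<And>n. compact (K n)" "UNIV = (\<Union>n. K n)"
    using assms unfolding sigma_compact_def by blast
  have "\<exists>D. finite D \<and> K n \<subseteq> (\<Union>d\<in>D. ball d (inverse (real (Suc m))))" for n m
  proof -
    have open_balls: "\<And>d. d \<in> K n \<Longrightarrow> open (ball d (inverse (real (Suc m))))" by simp
    have "K n \<subseteq> (\<Union>d\<in>K n. ball d (inverse (real (Suc m))))" by auto
    from compactE_image[OF K(1) open_balls this]
    obtain D where "finite D" "K n \<subseteq> (\<Union>d\<in>D. ball d (inverse (real (Suc m))))" .
    then show ?thesis by blast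
  qed
  then obtain D where D: "\<And>n m. finite (D n m)" "\<And>n m. K n \<subseteq> (\<Union>d\<in>D n m. ball d (inverse (real (Suc m))))"
    by metis
  define C where "C = (\<Union>n. \<Union>m. D n m)"
  have "countable (D n m)" for n m by (rule countable_finite[OF D(1)])
  then have "countable C" unfolding C_def by simp
  have near: "\<exists>d\<in>C. dist x d < e" if e: "e > 0" for x e
  proof -
    obtain n where "x \<in> K n" using K(2) by blast
    moreover obtain m where "inverse (real (Suc m)) < e" using reals_Archimedean[OF e] by blast
    ultimately obtain d where "d \<in> D n m" "dist d x < inverse (real (Suc m))" using D(2)[of n m] by auto
    moreover have "d \<in> C" using \<open>d \<in> D n m\<close> unfolding C_def by blast
    ultimately show ?thesis using \<open>inverse (real (Suc m)) < e\<close>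
      by (intro bexI[of _ d]) (simp_all add: dist_commute)
  qed
  then have "C \<noteq> {}" using zero_less_one by blast
  show thesis
  proof
    show "\<exists>i. dist x (from_nat_into C i) < e" if "e > 0" for x e
      using near[OF that, of x] range_from_nat_into[OF \<open>C \<noteq> {}\<close> \<open>countable C\<close>] by (metis imageE)
  qed
qed

lemma standard_borel_singleton:
  assumes "standard_borel M" "y \<in> space M" shows "{y} \<in> sets M"
proof -
  obtain \<tau> where \<tau>: "topspace \<tau> = space M" "completely_metrizable_space \<tau>"
    and sets: "sets M = sigma_sets (space M) {U. openin \<tau> U}"
    using assms(1) unfolding standard_borel_def by blast
  have "t1_space \<tau>"
    using \<tau>(2) by (intro metrizable_imp_t1_space completely_metrizable_imp_metrizable_space)
  then have "closedin \<tau> {y}" using assms(2) \<tau>(1) by (simp add: t1_space_closedin_singleton)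
  then have "openin \<tau> (space M - {y})" using \<tau>(1) by (simp add: closedin_def)
  then have "space M - {y} \<in> sets M" unfolding sets by (auto intro: sigma_sets.Basic)
  then have "space M - (space M - {y}) \<in> sets M" by (rule sets.compl_sets)
  moreover have "space M - (space M - {y}) = {y}" using assms(2) by auto
  ultimately show ?thesis by simp
qed

lemma standard_borel_countably_generated:
  assumes "standard_borel M"
  obtains G where "countable G" "G \<subseteq> Pow (space M)" "sets M = sigma_sets (space M) G"
proof -
  obtain \<tau> where \<tau>: "topspace \<tau> = space M" "second_countable \<tau>"
    and sets: "sets M = sigma_sets (space M) {U. openin \<tau> U}"
    using assms unfolding standard_borel_def by blast
  obtain G where G: "countable G" "\<forall>V\<in>G. openin \<tau> V" "\<forall>U x. openin \<tau> U \<and> x \<in> U \<longrightarrow> (\<exists>V\<in>G. x \<in> V \<and> V \<subseteq> U)"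
    using \<tau>(2) unfolding second_countable_def by blast
  have sub: "G \<subseteq> Pow (space M)" using G(2) openin_subset \<tau>(1) by blast
  have "sigma_sets (space M) {U. openin \<tau> U} = sigma_sets (space M) G"
  proof (rule sigma_sets_eqI)
    fix U assume "U \<in> {U. openin \<tau> U}"
    then have "U = \<Union>{V\<in>G. V \<subseteq> U}" using G(3) by blast
    moreover have "\<Union>{V\<in>G. V \<subseteq> U} \<in> sigma_sets (space M) G"
      by (rule sigma_sets_UNION) (use G(1) in \<open>auto intro: countable_subset\<close>)
    ultimately show "U \<in> sigma_sets (space M) G" by simp
  next
    fix V assume "V \<in> G"
    then show "V \<in> sigma_sets (space M) {U. openin \<tau> U}" using G(2) by (auto intro: sigma_sets.Basic)
  qed
  then show thesis using that[OF G(1) sub] sets by simp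
qed

text \<open>
  Through the coding map the Borel sets are the preimages of the Borel sets of the line.
\<close>

lemma real_retract_countably_generated:
  fixes \<phi> :: "'a::topological_space \<Rightarrow> real"
  assumes \<phi>: "\<phi> \<in> borel_measurable borel" and \<psi>: "\<psi> \<in> borel_measurable borel" and retract: "\<And>x. \<psi> (\<phi> x) = x"
  shows "sets borel = sigma_sets UNIV (range (\<lambda>q::rat. \<phi> -` {..of_rat q}))"
proof -
  have "A \<in> sets borel \<longleftrightarrow> (\<exists>B\<in>sets borel. A = \<phi> -` B)" for A
  proof
    assume "A \<in> sets borel"
    then have "\<psi> -` A \<in> sets borel" using measurable_sets[OF \<psi>, of A] by simp
    moreover have "A = \<phi> -` (\<psi> -` A)" using retract by auto
    ultimately show "\<exists>B\<in>sets borel. A = \<phi> -` B" by blast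
  next
    assume "\<exists>B\<in>sets borel. A = \<phi> -` B"
    then show "A \<in> sets borel" using measurable_sets[OF \<phi>] by auto
  qed
  then have "sets borel = {\<phi> -` B |B. B \<in> sets (borel :: real measure)}" by blast
  then have "sets borel = {\<phi> -` B \<inter> UNIV |B. B \<in> sets (borel :: real measure)}" by simp
  also have "\<dots> = sigma_sets UNIV {\<phi> -` B \<inter> UNIV |B. B \<in> range (\<lambda>q::rat. {..of_rat q})}"
    unfolding borel_eq_rational_atMost by (rule sigma_sets_vimage_commute) simp
  also have "{\<phi> -` B \<inter> UNIV |B. B \<in> range (\<lambda>q::rat. {..of_rat q})} = range (\<lambda>q::rat. \<phi> -` {..of_rat q})" by auto
  finally show ?thesis .
qed

lemma countably_generated_pair:
  assumes G: "countable G" "G \<subseteq> Pow (space M)" "sets M = sigma_sets (space M) G"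
    and H: "countable H" "H \<subseteq> Pow (space N)" "sets N = sigma_sets (space N) H"
  obtains E where "countable E" "sets (M \<Otimes>\<^sub>M N) = sigma_sets (space M \<times> space N) E"
proof -
  define G' where "G' = insert (space M) G"
  define H' where "H' = insert (space N) H"
  have top: "sigma_sets \<Omega> F = sigma_sets \<Omega> (insert \<Omega> F)" for \<Omega> :: "'c set" and F
    by (rule sigma_sets_eqI) (auto intro: sigma_sets_top sigma_sets.Basic)
  define E where "E = {a \<times> b | a b. a \<in> G' \<and> b \<in> H'}"
  have "E = (\<lambda>(a, b). a \<times> b) ` (G' \<times> H')" unfolding E_def by auto
  then have "countable E" using G(1) H(1) by (simp add: G'_def H'_def)
  moreover have "sets (M \<Otimes>\<^sub>M N) = sets (sigma (space M \<times> space N) E)" unfolding E_def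
  proof (rule sets_pair_eq[where Ca="{space M}" and Cb="{space N}"])
    show "sets M = sigma_sets (space M) G'" unfolding G'_def G(3) by (rule top)
    show "sets N = sigma_sets (space N) H'" unfolding H'_def H(3) by (rule top)
  qed (use G(2) H(2) in \<open>auto simp: G'_def H'_def\<close>)
  moreover have "E \<subseteq> Pow (space M \<times> space N)"
  proof
    fix e assume "e \<in> E"
    then obtain a b where "e = a \<times> b" "a \<in> G'" "b \<in> H'" unfolding E_def by blast
    moreover from this have "a \<subseteq> space M" "b \<subseteq> space N" using G(2) H(2) unfolding G'_def H'_def by blast+
    ultimately show "e \<in> Pow (space M \<times> space N)" by (simp add: Sigma_mono)
  qed
  ultimately show thesis using that[of E] by simp
qed

theorem theorem4:
  fixes \<mu> :: "'a::complete_space measure" and T :: "real \<Rightarrow> 'a \<Rightarrow> 'a"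
    and \<nu> :: "'b measure" and S :: "real \<Rightarrow> 'b \<Rightarrow> 'b"
    and \<rho> :: "('a \<times> 'b) measure"
  assumes "sigma_compact (UNIV :: 'a set)"
    and "sets \<mu> = sets borel"
    and "standard_borel_prob_space \<mu>"
    and "weakly_mixing_flow \<mu> T"
    and "almost_continuous_flow \<mu> T"
    and "SWR_property \<mu> T"
    and "standard_borel_prob_space \<nu>"
    and "ergodic_flow \<nu> S"
    and "ergodic_joining \<mu> T \<nu> S \<rho>"
  shows "\<rho> = \<mu> \<Otimes>\<^sub>M \<nu> \<or> finite_extension \<rho> (prod_flow T S) \<nu> S snd"
proof (cases "\<rho> = \<mu> \<Otimes>\<^sub>M \<nu>")
  case ne: False
  have erg: "ergodic_flow \<rho> (prod_flow T S)" using assms(9) by (simp add: ergodic_joining_def)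
  have pm: "prob_space \<mu>" and pn: "prob_space \<nu>" and sbn: "standard_borel \<nu>" and pr: "prob_space \<rho>"
    using assms(3,7,9) by (simp_all add: standard_borel_prob_space_def ergodic_joining_def joining_def)
  interpret mu: prob_flow \<mu> T
    using pm assms(4) by (simp add: prob_flow_def prob_flow_axioms_def weakly_mixing_flow_def)
  interpret nu: prob_flow \<nu> S
    using pn assms(8) by (simp add: prob_flow_def prob_flow_axioms_def ergodic_flow_def)
  interpret rho: prob_flow \<rho> "prod_flow T S"
    using pr erg by (simp add: prob_flow_def prob_flow_axioms_def ergodic_flow_def)
  interpret flow_joining \<mu> T \<nu> S \<rho>
    using assms(2,9) by unfold_locales (simp_all add: ergodic_joining_def joining_def)
  obtain q :: "nat \<Rightarrow> 'a" where dense: "\<And>x e. e > 0 \<Longrightarrow> \<exists>i. dist x (q i) < e"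
    using sigma_compact_dense_sequence[OF assms(1)] by blast
  obtain \<phi> :: "'a \<Rightarrow> real" and \<psi> :: "real \<Rightarrow> 'a"
    where \<phi>: "\<phi> \<in> borel_measurable borel" and \<psi>: "\<psi> \<in> borel_measurable borel" and "\<forall>x. \<psi> (\<phi> x) = x"
    by (rule real_retract[OF dense])
  then have retract: "\<And>x. \<psi> (\<phi> x) = x" by simp
  obtain H where H: "countable H" "H \<subseteq> Pow (space \<nu>)" "sets \<nu> = sigma_sets (space \<nu>) H"
    by (rule standard_borel_countably_generated[OF sbn])
  have "sets \<mu> = sigma_sets (space \<mu>) (range (\<lambda>q::rat. \<phi> -` {..of_rat q}))"
    using real_retract_countably_generated[OF \<phi> \<psi> retract] assms(2) by simp
  then obtain G where G: "countable G" "sets (\<mu> \<Otimes>\<^sub>M \<nu>) = sigma_sets (space \<mu> \<times> space \<nu>) G"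
    using countably_generated_pair[OF _ _ _ H, of "range (\<lambda>q::rat. \<phi> -` {..of_rat q})" \<mu>] by auto
  have "sets \<rho> = sigma_sets (space \<rho>) G" using G(2) sets_rho space_rho by simp
  from rho.countable_nonergodic_times[OF erg this G(1)]
  have bad: "countable {t. t > 0 \<and> \<not> ergodic_map \<rho> (prod_flow T S t)}" .
  obtain P where P: "compact P" "P \<subseteq> UNIV - {0}" "uncountable {t0. t0 > 0 \<and> switchable_R \<mu> T t0 P}"
    using assms(6) unfolding SWR_property_def by blast
  have "\<not> {t0. t0 > 0 \<and> switchable_R \<mu> T t0 P} \<subseteq> {t. t > 0 \<and> \<not> ergodic_map \<rho> (prod_flow T S t)}"
    using P(3) bad countable_subset by blast
  then obtain t0 where t0: "switchable_R \<mu> T t0 P" "ergodic_map \<rho> (prod_flow T S t0)" by blast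
  obtain E d where E: "E \<in> sets \<rho>" "rho.prob E > 0" and d: "d > 0"
    and sep: "\<And>x x' y. (x, y) \<in> E \<Longrightarrow> (x', y) \<in> E \<Longrightarrow> dist x x' < d \<Longrightarrow> x = x'"
    using separated_fibres[OF assms(5) ne weakly_mixing_time_ergodic[OF pm assms(4)] t0(2,1) P(1,2)] by blast
  have "countable {x. (x, y) \<in> E}" for y
  proof -
    obtain r :: "'a \<Rightarrow> nat" where r: "\<And>x. dist x (q (r x)) < d / 2"
      using dense[OF half_gt_zero[OF d]] by metis
    have "inj_on r {x. (x, y) \<in> E}"
    proof (rule inj_onI)
      fix x x' assume xx: "x \<in> {x. (x, y) \<in> E}" "x' \<in> {x. (x, y) \<in> E}" "r x = r x'"
      have "dist x x' \<le> dist x (q (r x)) + dist x' (q (r x))" by (rule dist_triangle2)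
      also have "\<dots> < d" using r[of x] r[of x'] xx(3) by simp
      finally show "x = x'" using sep xx by blast
    qed
    then show ?thesis by (rule countableI)
  qed
  then have "finite_extension \<rho> (prod_flow T S) \<nu> S snd"
    by (intro finite_extension_if_countable_fibres[OF \<phi> \<psi> retract standard_borel_singleton[OF sbn] erg E])
  then show ?thesis ..
qed simp

end
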